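(* Let $A$, $B$ and $D$ be three closed linear operators on a complex Banach space $X$, with $D$ invertible and with both $A$ and $B$ commuting with $D$. Assume that (a) the operator $D$ is (invertible and) sectorial of angle $\varphi_1\in(0,\pi)$; (b) there exists $\varphi_2\in(\varphi_1,\pi)$ such that $H(\lambda):=(\lambda^2+\lambda B+A)^{-1}$ exists in $\mathcal L(X)$ for every $\lambda\in\Sigma_{\varphi_2}$; (c) $H\in H^\infty(\Sigma_{\varphi_2};\mathcal L(X))$; and (d) the functions $\lambda\mapsto\lambda^2H(\lambda)$, $\lambda\mapsto\lambda BH(\lambda)$ and $\lambda\mapsto AH(\lambda)$ are uniformly bounded in $\Sigma_{\varphi_2}$ with values in $\mathcal L(X)$. Fix $\theta\in(0,1)$ and $1\le p\le\infty$, and let $L_{\theta,p}$ be the operator on $\mathsf D_D(\theta,p)$ given by \[ \mathsf D_{L_{\theta,p}}:=\{x\in\mathsf D_{D^2}\cap\mathsf D_{BD}\cap\mathsf D_A:\ D^2x,\ BDx,\ Ax\in\mathsf D_D(\theta,p)\},\qquad L_{\theta,p}x:=D^2x+BDx+Ax . \] Let $\hat D$ be a closed extension of $D$, and let $\hat L_{\theta,p}$ be the operator on $\mathsf D_{\hat D}(\theta,p)$ given by \[ \mathsf D_{\hat L_{\theta,p}}:=\{x\in\mathsf D_{\hat D^2}\cap\mathsf D_{B\hat D}\cap\mathsf D_A:\ \hat D^2x,\ B\hat Dx,\ Ax\in\mathsf D_{\hat D}(\theta,p)\},\qquad \hat L_{\theta,p}x:=\hat D^2x+B\hat Dx+Ax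 . \] Then for every $f\in\mathsf D_{\hat D}(\theta,p)$ and every $x_0\in\mathsf D_{\hat L_{\theta,p}}$ satisfying the compatibility condition $f-\hat L_{\theta,p}x_0\in\mathsf D_D(\theta,p)$ there exists a unique solution $x\in\mathsf D_{\hat L_{\theta,p}}$ of the problem \[ \hat D^2x+B\hat Dx+Ax=f,\qquad x-x_0\in\mathsf D_{L_{\theta,p}} . \]
   Context: $\mathsf D_C$ denotes the domain of a closed operator $C$, equipped with the graph norm; compositions such as $BD$, $D^2$, $B\hat D$, $\hat D^2$ have their natural domains, e.g. $\mathsf D_{BD}=\{x\in\mathsf D_D: Dx\in\mathsf D_B\}$; the sum $\lambda^2+\lambda B+A$ has its natural domain $\mathsf D_A\cap\mathsf D_B$. For $\varphi\in(0,\pi)$, $\Sigma_\varphi:=\{\lambda\in\mathbb C\setminus\{0\}:|\arg\lambda|\le\varphi\}\cup\{0\}$. $H^\infty(\Sigma_{\varphi};\mathcal L(X))$ denotes the bounded holomorphic $\mathcal L(X)$-valued functions on the sector (holomorphic in its interior). A closed operator $D$ is sectorial of angle $\varphi\in(0,\pi)$ if $\sigma(D)\subseteq\Sigma_\varphi$ and for every $\varphi'\in(\varphi,\pi)$ one has $\sup_{\lambda\notin\Sigma_{\varphi'}}\|\lambda R(\lambda,D)\|<\infty$, where $R(\lambda,D)=(\lambda-D)^{-1}$ ($D$ need not be densely defined). An operator $A$ commutes with an invertible operator $D$ if $AD\subseteq DA$ (natural domains), equivalently $D^{-1}A\subseteq AD^{-1}$. For any closed operator $C$ on $X$, $\mathsf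 D_C(\theta,p):=(X,\mathsf D_C)_{\theta,p}$ denotes the real interpolation space between $X$ and $\mathsf D_C$. *)

theory Defs
  imports "HOL-Analysis.Analysis"
begin

section \<open>Complex Banach spaces\<close>

class complex_banach = banach +
  fixes scaleC :: "complex \<Rightarrow> 'a \<Rightarrow> 'a"  (infixr \<open>*\<^sub>C\<close> 75)
  assumes scaleC_add_right: "c *\<^sub>C (x + y) = c *\<^sub>C x + c *\<^sub>C y"
    and scaleC_add_left: "(c + d) *\<^sub>C x = c *\<^sub>C x + d *\<^sub>C x"
    and scaleC_scaleC: "c *\<^sub>C (d *\<^sub>C x) = (c * d) *\<^sub>C x"
    and scaleC_of_real: "complex_of_real r *\<^sub>C x = r *\<^sub>R x"
    and norm_scaleC: "norm (c *\<^sub>C x) = cmod c * norm x"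

lemma scaleC_one: "1 *\<^sub>C x = (x::'a::complex_banach)"
  using scaleC_of_real[of 1 x] by simp

interpretation complex_vector: vector_space "scaleC :: complex \<Rightarrow> 'a \<Rightarrow> 'a::complex_banach"
  by unfold_locales (simp_all add: scaleC_add_right scaleC_add_left scaleC_scaleC scaleC_one)

lemma bounded_linear_scaleC: "bounded_linear (\<lambda>x::'a::complex_banach. c *\<^sub>C x)"
proof (rule bounded_linear_intro[where K = "cmod c"])
  show "c *\<^sub>C (r *\<^sub>R x) = r *\<^sub>R (c *\<^sub>C x)" for r and x :: 'a
    by (simp add: scaleC_of_real[symmetric] scaleC_scaleC mult.commute)
qed (simp_all add: scaleC_add_right norm_scaleC mult.commute)

instantiation complex :: complex_banach
begin

definition scaleC_complex :: "complex \<Rightarrow> complex \<Rightarrow> complex" where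
  "scaleC_complex c z = c * z"

instance
  by standard (simp_all add: scaleC_complex_def algebra_simps norm_mult scaleR_conv_of_real)

end

text \<open>The type of bounded \<open>\<real>\<close>-linear maps into a complex Banach space is itself a
  complex Banach space; \<open>bounded_clinear_ops\<close> below is its closed complex subspace of
  \<open>\<complex>\<close>-linear maps.\<close>

instantiation blinfun :: (real_normed_vector, complex_banach) complex_banach
begin

definition scaleC_blinfun :: "complex \<Rightarrow> ('a \<Rightarrow>\<^sub>L 'b) \<Rightarrow> ('a \<Rightarrow>\<^sub>L 'b)" where
  "scaleC_blinfun c T = Blinfun (\<lambda>x. c *\<^sub>C T x)"

lemma blinfun_apply_scaleC: "blinfun_apply (c *\<^sub>C T) x = c *\<^sub>C blinfun_apply T x"
  for T :: "'a \<Rightarrow>\<^sub>L 'b"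
  unfolding scaleC_blinfun_def
  by (subst bounded_linear_Blinfun_apply)
     (auto intro: bounded_linear_compose[OF bounded_linear_scaleC] blinfun.bounded_linear_right)

instance
proof
  fix c d :: complex and r :: real and S T :: "'a \<Rightarrow>\<^sub>L 'b"
  show "c *\<^sub>C (S + T) = c *\<^sub>C S + c *\<^sub>C T"
    by (rule blinfun_eqI) (simp add: blinfun_apply_scaleC blinfun.add_left scaleC_add_right)
  show "(c + d) *\<^sub>C T = c *\<^sub>C T + d *\<^sub>C T"
    by (rule blinfun_eqI) (simp add: blinfun_apply_scaleC blinfun.add_left scaleC_add_left)
  show "c *\<^sub>C (d *\<^sub>C T) = (c * d) *\<^sub>C T"
    by (rule blinfun_eqI) (simp add: blinfun_apply_scaleC scaleC_scaleC)
  show "complex_of_real r *\<^sub>C T = r *\<^sub>R T"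
    by (rule blinfun_eqI) (simp add: blinfun_apply_scaleC blinfun.scaleR_left scaleC_of_real)
  have le: "norm (a *\<^sub>C U) \<le> cmod a * norm U" for a and U :: "'a \<Rightarrow>\<^sub>L 'b"
  proof (rule norm_blinfun_bound)
    show "norm (blinfun_apply (a *\<^sub>C U) x) \<le> cmod a * norm U * norm x" for x
      using mult_left_mono[OF norm_blinfun[of U x], of "cmod a"]
      by (simp add: blinfun_apply_scaleC norm_scaleC mult.assoc)
  qed simp
  show "norm (c *\<^sub>C T) = cmod c * norm T"
  proof (cases "c = 0")
    case True
    with le[of c T] show ?thesis by simp
  next
    case False
    have "T = inverse c *\<^sub>C (c *\<^sub>C T)"
      by (rule blinfun_eqI) (simp add: blinfun_apply_scaleC False)
    then have "norm T \<le> norm (c *\<^sub>C T) / cmod c"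
      using le[of "inverse c" "c *\<^sub>C T"] by (simp add: norm_inverse divide_inverse mult.commute)
    with False have "cmod c * norm T \<le> norm (c *\<^sub>C T)"
      by (simp add: pos_le_divide_eq mult.commute)
    with le[of c T] show ?thesis by simp
  qed
qed

end

definition bounded_clinear :: "('a::complex_banach \<Rightarrow> 'b::complex_banach) \<Rightarrow> bool" where
  "bounded_clinear f \<longleftrightarrow> bounded_linear f \<and> Vector_Spaces.linear scaleC scaleC f"

text \<open>The space \<open>L(X)\<close>.\<close>

definition bounded_clinear_ops :: "('a::complex_banach \<Rightarrow>\<^sub>L 'a) set" where
  "bounded_clinear_ops = {T. bounded_clinear (blinfun_apply T)}"


section \<open>Unbounded operators\<close>

text \<open>Values of \<open>op_app C\<close> outside \<open>op_dom C\<close> are junk and never enter a definition below.\<close>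

datatype 'a operator = Operator (op_dom: "'a set") (op_app: "'a \<Rightarrow> 'a")

definition closed_operator :: "'a::complex_banach operator \<Rightarrow> bool" where
  "closed_operator C \<longleftrightarrow>
     complex_vector.subspace (op_dom C) \<and>
     (\<forall>x\<in>op_dom C. \<forall>y\<in>op_dom C. op_app C (x + y) = op_app C x + op_app C y) \<and>
     (\<forall>c. \<forall>x\<in>op_dom C. op_app C (c *\<^sub>C x) = c *\<^sub>C op_app C x) \<and>
     closed {(x, op_app C x) |x. x \<in> op_dom C}"

definition op_extends :: "'a operator \<Rightarrow> 'a operator \<Rightarrow> bool"  (infix \<open>\<subseteq>\<^sub>o\<^sub>p\<close> 50) where
  "S \<subseteq>\<^sub>o\<^sub>p T \<longleftrightarrow> op_dom S \<subseteq> op_dom T \<and> (\<forall>x\<in>op_dom S. op_app T x = op_app S x)"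

definition op_id :: "'a operator" where
  "op_id = Operator UNIV (\<lambda>x. x)"

definition op_add :: "'a::complex_banach operator \<Rightarrow> 'a operator \<Rightarrow> 'a operator"
    (infixl \<open>+\<^sub>o\<^sub>p\<close> 65) where
  "S +\<^sub>o\<^sub>p T = Operator (op_dom S \<inter> op_dom T) (\<lambda>x. op_app S x + op_app T x)"

text \<open>Also for \<open>c = 0\<close> the domain of \<open>c C\<close> is that of \<open>C\<close>.\<close>

definition op_scale :: "complex \<Rightarrow> 'a::complex_banach operator \<Rightarrow> 'a operator"
    (infixr \<open>\<cdot>\<^sub>o\<^sub>p\<close> 75) where
  "c \<cdot>\<^sub>o\<^sub>p C = Operator (op_dom C) (\<lambda>x. c *\<^sub>C op_app C x)"

definition op_comp :: "'a operator \<Rightarrow> 'a operator \<Rightarrow> 'a operator"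
    (infixl \<open>\<circ>\<^sub>o\<^sub>p\<close> 70) where
  "S \<circ>\<^sub>o\<^sub>p T = Operator {x \<in> op_dom T. op_app T x \<in> op_dom S} (\<lambda>x. op_app S (op_app T x))"

definition commutes_with :: "'a operator \<Rightarrow> 'a operator \<Rightarrow> bool" where
  "commutes_with A D \<longleftrightarrow> A \<circ>\<^sub>o\<^sub>p D \<subseteq>\<^sub>o\<^sub>p D \<circ>\<^sub>o\<^sub>p A"

text \<open>\<open>R = C\<^sup>-\<^sup>1\<close> exists in \<open>L(X)\<close>.\<close>

definition is_bounded_inverse :: "'a::complex_banach operator \<Rightarrow> ('a \<Rightarrow>\<^sub>L 'a) \<Rightarrow> bool" where
  "is_bounded_inverse C R \<longleftrightarrow> R \<in> bounded_clinear_ops \<and>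
     (\<forall>y. R y \<in> op_dom C \<and> op_app C (R y) = y) \<and> (\<forall>x\<in>op_dom C. R (op_app C x) = x)"

definition invertible_operator :: "'a::complex_banach operator \<Rightarrow> bool" where
  "invertible_operator C \<longleftrightarrow> (\<exists>R. is_bounded_inverse C R)"

abbreviation op_shift :: "complex \<Rightarrow> 'a::complex_banach operator \<Rightarrow> 'a operator" where
  "op_shift z C \<equiv> (z \<cdot>\<^sub>o\<^sub>p op_id) +\<^sub>o\<^sub>p ((-1) \<cdot>\<^sub>o\<^sub>p C)"

definition op_spectrum :: "'a::complex_banach operator \<Rightarrow> complex set" where
  "op_spectrum C = {z. \<not> invertible_operator (op_shift z C)}"

definition resolvent :: "complex \<Rightarrow> 'a::complex_banach operator \<Rightarrow> ('a \<Rightarrow>\<^sub>L 'a)" where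
  "resolvent z C = (THE R. is_bounded_inverse (op_shift z C) R)"

lemma is_bounded_inverse_unique:
  assumes "is_bounded_inverse C R" "is_bounded_inverse C S"
  shows "R = S"
  using assms by (intro blinfun_eqI) (metis is_bounded_inverse_def)

lemma is_bounded_inverse_resolvent:
  assumes "z \<notin> op_spectrum C"
  shows "is_bounded_inverse (op_shift z C) (resolvent z C)"
proof -
  obtain R where "is_bounded_inverse (op_shift z C) R"
    using assms by (auto simp: op_spectrum_def invertible_operator_def)
  then show ?thesis
    unfolding resolvent_def
    by (rule theI) (use \<open>is_bounded_inverse _ R\<close> is_bounded_inverse_unique in blast)
qed


section \<open>Sectors and sectorial operators\<close>

definition sector :: "real \<Rightarrow> complex set" where
  "sector \<phi> = {z. z \<noteq> 0 \<and> \<bar>Arg z\<bar> \<le> \<phi>} \<union> {0}"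

definition sectorial :: "'a::complex_banach operator \<Rightarrow> real \<Rightarrow> bool" where
  "sectorial C \<phi> \<longleftrightarrow> closed_operator C \<and> op_spectrum C \<subseteq> sector \<phi> \<and>
     (\<forall>\<phi>'\<in>{\<phi><..<pi}. bdd_above ((\<lambda>z. norm (z *\<^sub>C resolvent z C)) ` (- sector \<phi>')))"

text \<open>\<open>H\<^sup>\<infinity>(S; Y)\<close> for a closed complex subspace \<open>Y\<close> of a complex Banach space:
  functions bounded on all of \<open>S\<close> and complex differentiable in norm on the interior of \<open>S\<close>.\<close>

definition H_infty :: "complex set \<Rightarrow> 'b::complex_banach set \<Rightarrow> (complex \<Rightarrow> 'b) set" where
  "H_infty S Y = {F. F ` S \<subseteq> Y \<and> bounded (F ` S) \<and>
     (\<forall>z\<in>interior S. \<exists>F'\<in>Y. (F has_derivative (\<lambda>h. h *\<^sub>C F')) (at z))}"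

definition uniformly_bounded_ops ::
    "complex set \<Rightarrow> (complex \<Rightarrow> 'a::complex_banach \<Rightarrow> 'a) \<Rightarrow> bool" where
  "uniformly_bounded_ops S F \<longleftrightarrow>
     (\<forall>z\<in>S. bounded_clinear (F z)) \<and> bdd_above ((\<lambda>z. onorm (F z)) ` S)"


section \<open>Real interpolation\<close>

text \<open>The K-functional of the couple formed by \<open>X\<close> and the domain of \<open>C\<close> with its graph norm.\<close>

definition K_functional :: "'a::complex_banach operator \<Rightarrow> real \<Rightarrow> 'a \<Rightarrow> real" where
  "K_functional C t x =
     Inf {norm a + t * (norm b + norm (op_app C b)) |a b. b \<in> op_dom C \<and> x = a + b}"

text \<open>Membership in the real interpolation space: \<open>t powr (- \<theta>) * K(t, x)\<close> lies in
  \<open>L\<^sup>p\<close> of the half line for the measure \<open>dt / t\<close>. By continuity in \<open>t\<close> of the K-functional,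
  the essential supremum for \<open>p = \<infinity>\<close> is a supremum.\<close>

definition interp_space :: "'a::complex_banach operator \<Rightarrow> real \<Rightarrow> ennreal \<Rightarrow> 'a set" where
  "interp_space C \<theta> p = {x.
     if p = \<infinity> then bdd_above ((\<lambda>t. t powr (- \<theta>) * K_functional C t x) ` {0<..})
     else (\<integral>\<^sup>+ t \<in> {0<..}. ennreal ((t powr (- \<theta>) * K_functional C t x) powr enn2real p / t)
             \<partial>lborel) < \<infinity>}"


section \<open>The operator of the abstract problem\<close>

definition L_op :: "'a::complex_banach operator \<Rightarrow> 'a operator \<Rightarrow> 'a operator \<Rightarrow>
    real \<Rightarrow> ennreal \<Rightarrow> 'a operator" where
  "L_op A B D \<theta> p = Operator
     {x \<in> op_dom (D \<circ>\<^sub>o\<^sub>p D) \<inter> op_dom (B \<circ>\<^sub>o\<^sub>p D) \<inter> op_dom A.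
        op_app (D \<circ>\<^sub>o\<^sub>p D) x \<in> interp_space D \<theta> p \<and>
        op_app (B \<circ>\<^sub>o\<^sub>p D) x \<in> interp_space D \<theta> p \<and>
        op_app A x \<in> interp_space D \<theta> p}
     (\<lambda>x. op_app (D \<circ>\<^sub>o\<^sub>p D) x + op_app (B \<circ>\<^sub>o\<^sub>p D) x + op_app A x)"

end

theory Submission
  imports Defs
begin

text \<open>Write \<open>P(\<lambda>) = \<lambda>\<^sup>2 + \<lambda> B + A\<close>, so that \<open>H(\<lambda>)\<close> inverts \<open>P(\<lambda>)\<close>. Since \<open>D\<close>
is a part of its extension, the substitution \<open>x = x0 + u\<close> turns the problem into
\<open>D\<^sup>2 u + B D u + A u = g\<close> with datum \<open>g = f - L x0\<close> in the interpolation space of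
\<open>D\<close> and \<open>u\<close> sought in the domain of \<open>L\<^bsub>\<theta>,p\<^esub>\<close>. The left side is formally \<open>P(D) u\<close>, so
the solution ought to be \<open>H(D) g\<close>. All of this rests on one contour: the two rays
\<open>arg \<lambda> = \<plusminus>\<phi>\<close> with \<open>\<phi>1 < \<phi> < \<phi>2\<close>, which lie both in the sector where \<open>H\<close> lives and
in the resolvent set of \<open>D\<close>. They may run through the origin, because the resolvent of
the invertible operator \<open>D\<close> stays bounded there.

\<^emph>\<open>Existence\<close> (\<open>pencil_solution_exists\<close>). Put \<open>2 \<pi> \<i> u = \<integral> H(\<lambda>) R(\<lambda>,D) g d\<lambda>\<close>. Writing
\<open>D R(\<lambda>,D) = \<lambda> R(\<lambda>,D) - 1\<close>, and noting that the integral of \<open>H(\<lambda>) g\<close> vanishes by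
Cauchy's theorem, one obtains \<open>D\<^sup>2 u\<close> and \<open>B D u\<close> as integrals of
\<open>T(\<lambda>) D R(\<lambda>,D) g\<close> against \<open>d\<lambda> / \<lambda>\<close>, where \<open>T(\<lambda>)\<close> is \<open>\<lambda>\<^sup>2 H(\<lambda>)\<close> and \<open>\<lambda> B H(\<lambda>)\<close>
respectively; both families are bounded by the hypotheses. For \<open>A u\<close> the contour is cut
off at \<open>|\<lambda>| = e\<^sup>n\<close> and closed by an arc inside the sector. The identity
\<open>A H = 1 - \<lambda>\<^sup>2 H - \<lambda> B H\<close> then leaves \<open>2 \<pi> \<i> g\<close> from the full circle, of which the arc
inside the sector contributes \<open>2 \<phi>\<close> and the resolvent outside the sector \<open>2 \<pi> - 2 \<phi>\<close>.
Closedness of \<open>A\<close> gives the equation in the limit.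

\<^emph>\<open>Regularity\<close> (\<open>symbol_integral_in_interp_space\<close>). Since \<open>|D R(\<lambda>,D) g|\<close> is bounded by a
multiple of \<open>K(1/|\<lambda>|, g)\<close>, the integrals converge. To estimate \<open>K(t, v)\<close> for such an
integral \<open>v\<close>, cut the rays at \<open>|\<lambda>| = 1/t\<close>. The outer part is small in \<open>X\<close>. On the inner
part \<open>T D R g = T \<lambda> R g - T g\<close>: the first term lies in the domain of \<open>D\<close>, and the second is
moved by Cauchy's theorem to the arc \<open>|\<lambda>| = 1/t\<close>, where it is a bounded operator applied to
\<open>g\<close>. The resulting bound on \<open>K(t, v)\<close> by dilates of \<open>K(t, g)\<close> preserves the
interpolation space by a discrete Hardy inequality (\<open>interp_space_Hardy\<close>). The remaining
term \<open>A u\<close> lies in the space because \<open>A u = g - D\<^sup>2 u - B D u\<close>.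

\<^emph>\<open>Uniqueness\<close> (\<open>pencil_solution_unique\<close>). If \<open>P(D) u = 0\<close>, then
\<open>R(\<lambda>,D) u = H(\<lambda>) (\<lambda> u + D u + B u)\<close> on the rays, so both sides are pieces of one entire
function that behaves like \<open>u / \<lambda>\<close> at infinity. Integrating it over the rays, once closed
outside and once inside the sector, gives \<open>2 \<pi> \<i> u = 0\<close>.

Contours are parametrised by \<open>\<lambda> = exp (s + \<i> \<psi>)\<close>: sectors become strips, rays and arcs the
sides of a rectangle, and \<open>d\<lambda> / \<lambda>\<close> becomes \<open>ds\<close>, which matches the measure \<open>dt / t\<close> of
the interpolation norm. Integrals are taken over bounded intervals and passed to the limit.\<close>

section \<open>Cauchy's theorem for vector-valued functions\<close>

lemma bounded_bilinear_scaleC: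
  "bounded_bilinear (scaleC :: complex \<Rightarrow> 'a \<Rightarrow> 'a::complex_banach)"
proof
  fix r :: real and a b :: complex and x y :: 'a
  show "(a + b) *\<^sub>C x = a *\<^sub>C x + b *\<^sub>C x" by (rule scaleC_add_left)
  show "a *\<^sub>C (x + y) = a *\<^sub>C x + a *\<^sub>C y" by (rule scaleC_add_right)
  show "(r *\<^sub>R a) *\<^sub>C x = r *\<^sub>R (a *\<^sub>C x)"
    by (simp add: scaleC_of_real[symmetric] scaleC_scaleC scaleC_complex_def)
  show "a *\<^sub>C (r *\<^sub>R x) = r *\<^sub>R (a *\<^sub>C x)"
    by (simp add: scaleC_of_real[symmetric] scaleC_scaleC mult.commute)
  show "\<exists>K. \<forall>a x. norm (a *\<^sub>C (x::'a)) \<le> norm a * norm x * K"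
    by (rule exI[of _ 1]) (simp add: norm_scaleC)
qed

lemmas continuous_on_scaleC = bounded_bilinear.continuous_on[OF bounded_bilinear_scaleC]
lemmas tendsto_scaleC = bounded_bilinear.tendsto[OF bounded_bilinear_scaleC]
lemmas scaleC_diff_right = bounded_bilinear.diff_right[OF bounded_bilinear_scaleC]
lemmas scaleC_diff_left = bounded_bilinear.diff_left[OF bounded_bilinear_scaleC]
lemmas scaleC_minus_left = bounded_bilinear.minus_left[OF bounded_bilinear_scaleC]
lemmas scaleC_minus_right = bounded_bilinear.minus_right[OF bounded_bilinear_scaleC]
lemmas scaleC_zero_left = bounded_bilinear.zero_left[OF bounded_bilinear_scaleC]
lemmas scaleC_zero_right = bounded_bilinear.zero_right[OF bounded_bilinear_scaleC]

lemma integral_scaleC: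
  fixes f :: "real \<Rightarrow> 'a::complex_banach"
  assumes "continuous_on {a..b} f"
  shows "integral {a..b} (\<lambda>s. c *\<^sub>C f s) = c *\<^sub>C integral {a..b} f"
  using integral_linear[OF integrable_continuous_real[OF assms] bounded_linear_scaleC[of c]]
  by (simp add: o_def)

text \<open>The derivative is taken within \<open>S\<close>, which will contain boundary points, and its continuity is part
of the notion because Cauchy's theorem below differentiates under the integral sign.\<close>

definition C1_holomorphic_on :: "(complex \<Rightarrow> 'a::complex_banach) \<Rightarrow> complex set \<Rightarrow> bool"
    (infixl \<open>C1'_holomorphic'_on\<close> 50) where
  "f C1_holomorphic_on S \<longleftrightarrow> (\<exists>f'. continuous_on S f' \<and>
     (\<forall>z\<in>S. (f has_derivative (\<lambda>h. h *\<^sub>C f' z)) (at z within S)))"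

lemma C1_holomorphic_imp_continuous: "f C1_holomorphic_on S \<Longrightarrow> continuous_on S f"
  unfolding C1_holomorphic_on_def
  by (meson continuous_on_eq_continuous_within has_derivative_continuous)

text \<open>Resolvent-type identities have exactly this form: the difference quotient is given by a
formula \<open>Q\<close> that is separately continuous, and its diagonal is the derivative.\<close>

lemma C1_holomorphic_from_difference:
  fixes f :: "complex \<Rightarrow> 'a::complex_banach"
  assumes diff: "\<And>z w. z \<in> S \<Longrightarrow> w \<in> S \<Longrightarrow> f w - f z = (w - z) *\<^sub>C Q z w"
    and cont: "\<And>z. z \<in> S \<Longrightarrow> continuous_on S (Q z)"
    and diag: "continuous_on S (\<lambda>z. Q z z)"
  shows "f C1_holomorphic_on S"
  unfolding C1_holomorphic_on_def
proof (intro exI[of _ "\<lambda>z. Q z z"] conjI ballI diag)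
  fix z assume z: "z \<in> S"
  have "(Q z \<longlongrightarrow> Q z z) (at z within S)"
    using cont[OF z] z by (simp add: continuous_on_def)
  then have "((\<lambda>w. norm (Q z w - Q z z)) \<longlongrightarrow> 0) (at z within S)"
    using LIM_zero tendsto_norm_zero by blast
  moreover have "\<forall>\<^sub>F w in at z within S.
      norm (norm (f w - f z - (w - z) *\<^sub>C Q z z) / norm (w - z)) \<le> norm (Q z w - Q z z)"
    unfolding eventually_at_filter
    by (rule always_eventually)
      (use z in \<open>auto simp: diff scaleC_diff_right[symmetric] norm_scaleC\<close>)
  ultimately have "((\<lambda>w. norm (f w - f z - (w - z) *\<^sub>C Q z z) / norm (w - z)) \<longlongrightarrow> 0)
      (at z within S)"
    by (rule Lim_null_comparison[rotated])
  then show "(f has_derivative (\<lambda>h. h *\<^sub>C Q z z)) (at z within S)"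
    unfolding has_derivative_iff_norm
    using bounded_bilinear.bounded_linear_left[OF bounded_bilinear_scaleC] by blast
qed

lemma C1_holomorphic_scaleC_ident:
  assumes "f C1_holomorphic_on S"
  shows "(\<lambda>z. z *\<^sub>C f z) C1_holomorphic_on S"
proof -
  obtain f' where f': "continuous_on S f'"
    "\<And>z. z \<in> S \<Longrightarrow> (f has_derivative (\<lambda>h. h *\<^sub>C f' z)) (at z within S)"
    using assms by (auto simp: C1_holomorphic_on_def)
  show ?thesis
    unfolding C1_holomorphic_on_def
  proof (intro exI[of _ "\<lambda>z. f z + z *\<^sub>C f' z"] conjI ballI)
    show "continuous_on S (\<lambda>z. f z + z *\<^sub>C f' z)"
      by (intro continuous_intros continuous_on_scaleC f' C1_holomorphic_imp_continuous assms)
    fix z assume z: "z \<in> S"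
    show "((\<lambda>z. z *\<^sub>C f z) has_derivative (\<lambda>h. h *\<^sub>C (f z + z *\<^sub>C f' z))) (at z within S)"
      using bounded_bilinear.FDERIV[OF bounded_bilinear_scaleC has_derivative_ident f'(2)[OF z]]
      by (simp add: scaleC_add_right scaleC_scaleC mult.commute add.commute)
  qed
qed

lemma C1_holomorphic_compose_exp:
  assumes "f C1_holomorphic_on S" "exp ` Z \<subseteq> S"
  shows "(\<lambda>\<zeta>. f (exp \<zeta>)) C1_holomorphic_on Z"
proof -
  obtain f' where f': "continuous_on S f'"
    "\<And>z. z \<in> S \<Longrightarrow> (f has_derivative (\<lambda>h. h *\<^sub>C f' z)) (at z within S)"
    using assms by (auto simp: C1_holomorphic_on_def)
  show ?thesis
    unfolding C1_holomorphic_on_def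
  proof (intro exI[of _ "\<lambda>\<zeta>. exp \<zeta> *\<^sub>C f' (exp \<zeta>)"] conjI ballI)
    show "continuous_on Z (\<lambda>\<zeta>. exp \<zeta> *\<^sub>C f' (exp \<zeta>))"
      by (intro continuous_on_scaleC continuous_on_compose2[OF f'(1) _ assms(2)] continuous_intros)
    fix \<zeta> assume "\<zeta> \<in> Z"
    then have "(f has_derivative (\<lambda>h. h *\<^sub>C f' (exp \<zeta>))) (at (exp \<zeta>) within exp ` Z)"
      using f'(2) assms(2) has_derivative_subset by blast
    moreover have "(exp has_derivative (\<lambda>h. exp \<zeta> * h)) (at \<zeta> within Z)"
      using DERIV_exp[of \<zeta>] has_field_derivative_at_within has_field_derivative_def by blast
    ultimately show "((\<lambda>\<zeta>. f (exp \<zeta>)) has_derivative (\<lambda>h. h *\<^sub>C exp \<zeta> *\<^sub>C f' (exp \<zeta>)))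
        (at \<zeta> within Z)"
      using diff_chain_within[of exp _ \<zeta> Z f] by (simp add: o_def scaleC_scaleC mult.commute)
  qed
qed

lemma continuous_on_Complex [continuous_intros]:
  "continuous_on S f \<Longrightarrow> continuous_on S g \<Longrightarrow> continuous_on S (\<lambda>x. Complex (f x) (g x))"
  unfolding Complex_eq by (intro continuous_intros)

text \<open>Along a horizontal segment the derivative of \<open>F\<close> in the direction \<open>\<psi>\<close> is \<open>\<i>\<close> times its
derivative in the direction \<open>s\<close>. Hence the integral over the segment, as a function of
\<open>\<psi>\<close>, has as derivative the difference of the end point values, and the fundamental theorem
of calculus in \<open>\<psi>\<close> gives the claim.\<close>

lemma Cauchy_rectangle:
  fixes F :: "complex \<Rightarrow> 'a::complex_banach"
  assumes hol: "F C1_holomorphic_on Z"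
    and sub: "\<And>s \<psi>. s \<in> {a..b} \<Longrightarrow> \<psi> \<in> {\<alpha>..\<beta>} \<Longrightarrow> Complex s \<psi> \<in> Z"
    and "a \<le> b" "\<alpha> \<le> \<beta>"
  shows "integral {a..b} (\<lambda>s. F (Complex s \<beta>) - F (Complex s \<alpha>)) =
         \<i> *\<^sub>C integral {\<alpha>..\<beta>} (\<lambda>\<psi>. F (Complex b \<psi>) - F (Complex a \<psi>))"
proof -
  obtain F' where F': "continuous_on Z F'"
    "\<And>z. z \<in> Z \<Longrightarrow> (F has_derivative (\<lambda>h. h *\<^sub>C F' z)) (at z within Z)"
    using hol by (auto simp: C1_holomorphic_on_def)
  note contF = C1_holomorphic_imp_continuous[OF hol]
  have cont: "continuous_on {a..b} (\<lambda>s. F (Complex s \<psi>))" if "\<psi> \<in> {\<alpha>..\<beta>}" for \<psi>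
    by (rule continuous_on_compose2[OF contF]) (use sub that in \<open>auto intro!: continuous_intros\<close>)
  have dpsi: "((\<lambda>\<psi>. F (Complex s \<psi>)) has_vector_derivative \<i> *\<^sub>C F' (Complex s \<psi>))
      (at \<psi> within {\<alpha>..\<beta>})" if "s \<in> {a..b}" "\<psi> \<in> {\<alpha>..\<beta>}" for s \<psi>
  proof -
    have "((\<lambda>\<psi>. Complex s \<psi>) has_derivative (\<lambda>h. of_real h * \<i>)) (at \<psi> within {\<alpha>..\<beta>})"
      unfolding Complex_eq by (auto intro!: derivative_eq_intros)
    moreover have "(F has_derivative (\<lambda>h. h *\<^sub>C F' (Complex s \<psi>)))
        (at (Complex s \<psi>) within Complex s ` {\<alpha>..\<beta>})"
      by (rule has_derivative_subset[OF F'(2)]) (use sub that in auto)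
    ultimately show ?thesis
      using diff_chain_within[of "Complex s"]
      by (fastforce simp: has_vector_derivative_def o_def scaleC_scaleC scaleC_of_real[symmetric])
  qed
  have ds: "((\<lambda>s. F (Complex s \<psi>)) has_vector_derivative F' (Complex s \<psi>))
      (at s within {a..b})" if "s \<in> {a..b}" "\<psi> \<in> {\<alpha>..\<beta>}" for s \<psi>
  proof -
    have "((\<lambda>s. Complex s \<psi>) has_derivative (\<lambda>h. of_real h)) (at s within {a..b})"
      unfolding Complex_eq by (auto intro!: derivative_eq_intros)
    moreover have "(F has_derivative (\<lambda>h. h *\<^sub>C F' (Complex s \<psi>)))
        (at (Complex s \<psi>) within (\<lambda>s. Complex s \<psi>) ` {a..b})"
      by (rule has_derivative_subset[OF F'(2)]) (use sub that in auto)
    ultimately show ?thesis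
      using diff_chain_within[of "\<lambda>s. Complex s \<psi>"]
      by (fastforce simp: has_vector_derivative_def o_def scaleC_of_real)
  qed
  define \<Phi> where "\<Phi> \<psi> = integral {a..b} (\<lambda>s. F (Complex s \<psi>))" for \<psi>
  have "(\<Phi> has_vector_derivative \<i> *\<^sub>C (F (Complex b \<psi>) - F (Complex a \<psi>))) (at \<psi> within {\<alpha>..\<beta>})"
    if psi: "\<psi> \<in> {\<alpha>..\<beta>}" for \<psi>
  proof -
    have "continuous_on ({\<alpha>..\<beta>} \<times> cbox a b) (\<lambda>x. \<i> *\<^sub>C F' (Complex (snd x) (fst x)))"
      by (intro continuous_on_scaleC continuous_on_compose2[OF F'(1)] continuous_intros)
        (use sub in auto)
    then have "(\<Phi> has_vector_derivative integral {a..b} (\<lambda>s. \<i> *\<^sub>C F' (Complex s \<psi>)))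
        (at \<psi> within {\<alpha>..\<beta>})"
      unfolding \<Phi>_def cbox_interval[symmetric]
      by (intro leibniz_rule_vector_derivative)
        (use dpsi cont psi in \<open>auto simp: split_beta intro: integrable_continuous_real\<close>)
    moreover have "continuous_on {a..b} (\<lambda>s. F' (Complex s \<psi>))"
      by (rule continuous_on_compose2[OF F'(1)]) (use sub psi in \<open>auto intro!: continuous_intros\<close>)
    moreover have "integral {a..b} (\<lambda>s. F' (Complex s \<psi>)) = F (Complex b \<psi>) - F (Complex a \<psi>)"
      by (rule integral_unique[OF fundamental_theorem_of_calculus]) (use ds psi \<open>a \<le> b\<close> in auto)
    ultimately show ?thesis by (simp add: integral_scaleC)
  qed
  then have "((\<lambda>\<psi>. \<i> *\<^sub>C (F (Complex b \<psi>) - F (Complex a \<psi>))) has_integral \<Phi> \<beta> - \<Phi> \<alpha>) {\<alpha>..\<beta>}"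
    by (rule fundamental_theorem_of_calculus[OF \<open>\<alpha> \<le> \<beta>\<close>])
  moreover have "continuous_on {\<alpha>..\<beta>} (\<lambda>\<psi>. F (Complex b \<psi>) - F (Complex a \<psi>))"
    by (intro continuous_intros continuous_on_compose2[OF contF])
      (use sub \<open>a \<le> b\<close> in auto)
  moreover have "\<Phi> \<beta> - \<Phi> \<alpha> = integral {a..b} (\<lambda>s. F (Complex s \<beta>) - F (Complex s \<alpha>))"
    unfolding \<Phi>_def
    by (rule integral_diff[symmetric]; rule integrable_continuous_real; rule cont)
      (use \<open>\<alpha> \<le> \<beta>\<close> in auto)
  ultimately show ?thesis
    by (simp add: integral_unique integral_scaleC[symmetric])
qed

text \<open>A uniformly bounded, strongly continuous family of operators may be applied to a continuous
vector.\<close>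

lemma continuous_on_bounded_family:
  fixes T :: "'p::metric_space \<Rightarrow> 'a::real_normed_vector \<Rightarrow> 'b::real_normed_vector"
  assumes add: "\<And>z x y. z \<in> S \<Longrightarrow> T z (x - y) = T z x - T z y"
    and bd: "\<And>z x. z \<in> S \<Longrightarrow> norm (T z x) \<le> C * norm x"
    and cont: "\<And>x. continuous_on S (\<lambda>z. T z x)"
    and w: "continuous_on S w"
  shows "continuous_on S (\<lambda>z. T z (w z))"
  unfolding continuous_on_def
proof
  fix z assume z: "z \<in> S"
  have "((\<lambda>y. T y (w y - w z)) \<longlongrightarrow> 0) (at z within S)"
  proof (rule Lim_null_comparison)
    show "\<forall>\<^sub>F y in at z within S. norm (T y (w y - w z)) \<le> C * norm (w y - w z)"
      unfolding eventually_at_filter by (rule always_eventually) (use bd in auto)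
    show "((\<lambda>y. C * norm (w y - w z)) \<longlongrightarrow> 0) (at z within S)"
      using w z by (auto intro!: tendsto_eq_intros LIM_zero tendsto_norm_zero tendsto_mult_right_zero simp: continuous_on_def)
  qed
  moreover have "((\<lambda>y. T y (w z)) \<longlongrightarrow> T z (w z)) (at z within S)"
    using cont z by (simp add: continuous_on_def)
  ultimately have "((\<lambda>y. T y (w y - w z) + T y (w z)) \<longlongrightarrow> 0 + T z (w z)) (at z within S)"
    by (rule tendsto_add)
  moreover have "\<forall>\<^sub>F y in at z within S. T y (w y - w z) + T y (w z) = T y (w y)"
    unfolding eventually_at_filter by (rule always_eventually) (use add in auto)
  ultimately show "((\<lambda>y. T y (w y)) \<longlongrightarrow> T z (w z)) (at z within S)"
    using tendsto_cong by fastforce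
qed

section \<open>Contours in logarithmic coordinates\<close>

text \<open>The sets \<open>|arg z| \<le> \<phi>\<close> and \<open>|arg z| \<ge> \<phi>\<close> without the origin, described by the cosine
of the argument so that the outer region can be swept by the angles from \<open>\<phi>\<close> to
\<open>2 \<pi> - \<phi>\<close> across the branch cut. Both are closed at the boundary: they meet in the rays.\<close>

definition inner_region :: "real \<Rightarrow> complex set" where
  "inner_region \<phi> = {z. z \<noteq> 0 \<and> cmod z * cos \<phi> \<le> Re z}"

definition outer_region :: "real \<Rightarrow> complex set" where
  "outer_region \<phi> = {z. z \<noteq> 0 \<and> Re z \<le> cmod z * cos \<phi>}"

abbreviation rays :: "real \<Rightarrow> complex set" where
  "rays \<phi> \<equiv> inner_region \<phi> \<inter> outer_region \<phi>"

abbreviation polar :: "real \<Rightarrow> real \<Rightarrow> complex" where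
  "polar s \<psi> \<equiv> exp (Complex s \<psi>)"

lemma Re_polar: "Re (polar s \<psi>) = exp s * cos \<psi>"
  by (simp add: Re_exp)

lemma polar_inner: "\<bar>\<psi>\<bar> \<le> \<phi> \<Longrightarrow> \<phi> \<le> pi \<Longrightarrow> polar s \<psi> \<in> inner_region \<phi>"
  using cos_monotone_0_pi_le[of "\<bar>\<psi>\<bar>" \<phi>]
  by (auto simp: inner_region_def Re_polar)

lemma polar_outer:
  assumes "\<phi> \<le> \<psi>" "\<psi> \<le> 2 * pi - \<phi>" "0 \<le> \<phi>"
  shows "polar s \<psi> \<in> outer_region \<phi>"
proof -
  have "cos \<psi> \<le> cos \<phi>"
  proof (cases "\<psi> \<le> pi")
    case True
    then show ?thesis using cos_monotone_0_pi_le[of \<phi> \<psi>] assms by simp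
  next
    case False
    then have "cos (2 * pi - \<psi>) \<le> cos \<phi>"
      using cos_monotone_0_pi_le[of \<phi> "2 * pi - \<psi>"] assms by simp
    then show ?thesis by (simp add: cos_diff)
  qed
  then show ?thesis by (simp add: outer_region_def Re_polar)
qed

lemma polar_rays: "0 \<le> \<phi> \<Longrightarrow> \<phi> \<le> pi \<Longrightarrow> polar s \<phi> \<in> rays \<phi>"
  "0 \<le> \<phi> \<Longrightarrow> \<phi> \<le> pi \<Longrightarrow> polar s (- \<phi>) \<in> rays \<phi>"
  by (auto simp: inner_region_def outer_region_def Re_polar)

text \<open>The rays are run through with the sector on the left: in along the upper ray and out along
the lower one. The integrand is meant against \<open>ds = d\<lambda> / \<lambda>\<close>.\<close>

definition ray_diff :: "real \<Rightarrow> (complex \<Rightarrow> 'a::complex_banach) \<Rightarrow> real \<Rightarrow> 'a" where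
  "ray_diff \<phi> q s = q (polar s (- \<phi>)) - q (polar s \<phi>)"

abbreviation ray_integral :: "real \<Rightarrow> real \<Rightarrow> real \<Rightarrow> (complex \<Rightarrow> 'a::complex_banach) \<Rightarrow> 'a" where
  "ray_integral \<phi> a b q \<equiv> integral {a..b} (ray_diff \<phi> q)"

lemma continuous_on_ray_diff:
  assumes "continuous_on (rays \<phi>) q" "0 \<le> \<phi>" "\<phi> \<le> pi"
  shows "continuous_on A (ray_diff \<phi> q)"
  unfolding ray_diff_def
  by (intro continuous_intros continuous_on_compose2[OF assms(1)])
    (use polar_rays assms(2,3) in auto)

lemma norm_ray_diff_le:
  assumes "\<And>z. z \<in> rays \<phi> \<Longrightarrow> norm z = exp s \<Longrightarrow> norm (q z) \<le> c" "0 \<le> \<phi>" "\<phi> \<le> pi"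
  shows "norm (ray_diff \<phi> q s) \<le> 2 * c"
proof -
  have "norm (q (polar s (- \<phi>))) \<le> c" "norm (q (polar s \<phi>)) \<le> c"
    using assms polar_rays by auto
  then show ?thesis
    unfolding ray_diff_def using norm_triangle_ineq4[of "q (polar s (- \<phi>))" "q (polar s \<phi>)"] by simp
qed

text \<open>The rays cut off at radii \<open>e\<^sup>a\<close> and \<open>e\<^sup>b\<close> can be closed by arcs inside the sector, or (next
lemma) outside it; \<open>q\<close> then has to be holomorphic on the corresponding side.\<close>

lemma ray_integral_inner:
  assumes "q C1_holomorphic_on inner_region \<phi>" "0 \<le> \<phi>" "\<phi> \<le> pi" "a \<le> b"
  shows "ray_integral \<phi> a b q =
    - (\<i> *\<^sub>C integral {- \<phi>..\<phi>} (\<lambda>\<psi>. q (polar b \<psi>) - q (polar a \<psi>)))"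
proof -
  let ?Z = "{z. \<bar>Im z\<bar> \<le> \<phi>}"
  have "exp ` ?Z \<subseteq> inner_region \<phi>"
  proof safe
    fix z assume "\<bar>Im z\<bar> \<le> \<phi>"
    then show "exp z \<in> inner_region \<phi>"
      using polar_inner[of "Im z" \<phi> "Re z"] assms by (simp add: complex_eq_iff)
  qed
  from C1_holomorphic_compose_exp[OF assms(1) this]
  have "integral {a..b} (\<lambda>s. q (polar s \<phi>) - q (polar s (-\<phi>))) =
         \<i> *\<^sub>C integral {- \<phi>..\<phi>} (\<lambda>\<psi>. q (polar b \<psi>) - q (polar a \<psi>))"
    by (rule Cauchy_rectangle) (use assms in auto)
  moreover have "ray_diff \<phi> q = (\<lambda>s. - (q (polar s \<phi>) - q (polar s (-\<phi>))))"
    by (simp add: ray_diff_def fun_eq_iff)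
  ultimately show ?thesis by (simp only: integral_neg)
qed

lemma ray_integral_outer:
  assumes "q C1_holomorphic_on outer_region \<phi>" "0 \<le> \<phi>" "\<phi> \<le> pi" "a \<le> b"
  shows "ray_integral \<phi> a b q =
    \<i> *\<^sub>C integral {\<phi>..2 * pi - \<phi>} (\<lambda>\<psi>. q (polar b \<psi>) - q (polar a \<psi>))"
proof -
  let ?Z = "{z. \<phi> \<le> Im z \<and> Im z \<le> 2 * pi - \<phi>}"
  have "exp ` ?Z \<subseteq> outer_region \<phi>"
  proof safe
    fix z assume "\<phi> \<le> Im z" "Im z \<le> 2 * pi - \<phi>"
    then show "exp z \<in> outer_region \<phi>"
      using polar_outer[of \<phi> "Im z" "Re z"] assms by (simp add: complex_eq_iff)
  qed
  from C1_holomorphic_compose_exp[OF assms(1) this]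
  have "integral {a..b} (\<lambda>s. q (polar s (2 * pi - \<phi>)) - q (polar s \<phi>)) =
         \<i> *\<^sub>C integral {\<phi>..2 * pi - \<phi>} (\<lambda>\<psi>. q (polar b \<psi>) - q (polar a \<psi>))"
    by (rule Cauchy_rectangle) (use assms in auto)
  moreover have "polar s (2 * pi - \<phi>) = polar s (- \<phi>)" for s
    by (simp add: exp_eq_polar cis_conv_exp[symmetric] complex_eq_iff cos_diff sin_diff)
  ultimately show ?thesis by (simp add: ray_diff_def[abs_def])
qed

lemma bounded_linear_ray_integral:
  assumes "bounded_linear J" "continuous_on (rays \<phi>) q" "0 \<le> \<phi>" "\<phi> \<le> pi"
  shows "J (ray_integral \<phi> a b q) = ray_integral \<phi> a b (\<lambda>z. J (q z))"
proof -
  interpret bounded_linear J by fact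
  show ?thesis
    using integral_linear[OF integrable_continuous_real[OF continuous_on_ray_diff[OF assms(2-4)]]
        assms(1), of a b]
    by (simp add: o_def ray_diff_def[abs_def] diff)
qed

lemma ray_integral_cong:
  assumes "\<And>z. z \<in> rays \<phi> \<Longrightarrow> q z = r z" "0 \<le> \<phi>" "\<phi> \<le> pi"
  shows "ray_integral \<phi> a b q = ray_integral \<phi> a b r"
  by (rule integral_cong) (use assms polar_rays in \<open>simp add: ray_diff_def\<close>)

lemma ray_integral_add:
  assumes "continuous_on (rays \<phi>) q" "continuous_on (rays \<phi>) r" "0 \<le> \<phi>" "\<phi> \<le> pi"
  shows "ray_integral \<phi> a b (\<lambda>z. q z + r z) = ray_integral \<phi> a b q + ray_integral \<phi> a b r"
proof -
  have "ray_diff \<phi> (\<lambda>z. q z + r z) = (\<lambda>s. ray_diff \<phi> q s + ray_diff \<phi> r s)"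
    by (simp add: ray_diff_def fun_eq_iff)
  then show ?thesis
    by (simp add: integral_add integrable_continuous_real continuous_on_ray_diff assms)
qed

lemma ray_integral_diff:
  assumes "continuous_on (rays \<phi>) q" "continuous_on (rays \<phi>) r" "0 \<le> \<phi>" "\<phi> \<le> pi"
  shows "ray_integral \<phi> a b (\<lambda>z. q z - r z) = ray_integral \<phi> a b q - ray_integral \<phi> a b r"
proof -
  have "ray_diff \<phi> (\<lambda>z. q z - r z) = (\<lambda>s. ray_diff \<phi> q s - ray_diff \<phi> r s)"
    by (simp add: ray_diff_def fun_eq_iff)
  then show ?thesis
    by (simp add: integral_diff integrable_continuous_real continuous_on_ray_diff assms)
qed

lemma norm_arc_integral_le:
  fixes q :: "complex \<Rightarrow> 'a::complex_banach"
  assumes "continuous_on S q" "\<And>\<psi>. \<psi> \<in> {\<alpha>..\<beta>} \<Longrightarrow> polar s \<psi> \<in> S" "\<alpha> \<le> \<beta>"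
    and "\<And>z. z \<in> S \<Longrightarrow> norm z = exp s \<Longrightarrow> norm (q z) \<le> c"
  shows "norm (integral {\<alpha>..\<beta>} (\<lambda>\<psi>. q (polar s \<psi>))) \<le> c * (\<beta> - \<alpha>)"
  by (rule integral_bound)
    (use assms in \<open>auto intro!: continuous_on_compose2[OF assms(1)] continuous_intros\<close>)

section \<open>Real interpolation spaces\<close>

lemma closed_operatorD:
  assumes "closed_operator C"
  shows "0 \<in> op_dom C"
    and "x \<in> op_dom C \<Longrightarrow> y \<in> op_dom C \<Longrightarrow> x + y \<in> op_dom C"
    and "x \<in> op_dom C \<Longrightarrow> c *\<^sub>C x \<in> op_dom C"
    and "x \<in> op_dom C \<Longrightarrow> y \<in> op_dom C \<Longrightarrow> op_app C (x + y) = op_app C x + op_app C y"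
    and "x \<in> op_dom C \<Longrightarrow> op_app C (c *\<^sub>C x) = c *\<^sub>C op_app C x"
  using assms unfolding closed_operator_def complex_vector.subspace_def by auto

lemma closed_operator_diff:
  assumes "closed_operator C" "x \<in> op_dom C" "y \<in> op_dom C"
  shows "x - y \<in> op_dom C" "op_app C (x - y) = op_app C x - op_app C y"
proof -
  have "x - y = x + (-1) *\<^sub>C y" by (simp add: scaleC_minus_left scaleC_one)
  moreover have "(-1) *\<^sub>C y \<in> op_dom C" "op_app C ((-1) *\<^sub>C y) = - op_app C y"
    using closed_operatorD(3,5)[OF assms(1,3), of "-1"]
    by (simp_all add: scaleC_minus_left scaleC_one)
  ultimately show "x - y \<in> op_dom C" "op_app C (x - y) = op_app C x - op_app C y"
    using closed_operatorD(2,4)[OF assms(1), of x "(-1) *\<^sub>C y"] assms(2) by simp_all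
qed

lemma closed_operator_zero: "closed_operator C \<Longrightarrow> op_app C 0 = 0"
  using closed_operator_diff(2)[of C 0 0] closed_operatorD(1)[of C] by simp

text \<open>How closedness is used throughout: the truncated contour integrals lie in the domain, and
the unbounded operator is carried over to their limit.\<close>

lemma closed_operator_limit:
  assumes "closed_operator C" "\<And>n. X n \<in> op_dom C" "X \<longlonglongrightarrow> x" "(\<lambda>n. op_app C (X n)) \<longlonglongrightarrow> y"
  shows "x \<in> op_dom C" "op_app C x = y"
proof -
  have graph: "closed {(x, op_app C x) |x. x \<in> op_dom C}"
    using assms(1) by (simp add: closed_operator_def)
  have lim: "(\<lambda>n. (X n, op_app C (X n))) \<longlonglongrightarrow> (x, y)"
    using assms(3,4) by (rule tendsto_Pair)
  have "(x, y) \<in> {(x, op_app C x) |x. x \<in> op_dom C}"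
    by (rule closed_sequentially[OF graph _ lim]) (use assms(2) in blast)
  then show "x \<in> op_dom C" "op_app C x = y" by auto
qed

lemma K_functional_le:
  assumes "0 \<le> t" "b \<in> op_dom C"
  shows "K_functional C t (a + b) \<le> norm a + t * (norm b + norm (op_app C b))"
  unfolding K_functional_def
  by (rule cInf_lower) (use assms in \<open>auto intro!: bdd_belowI[of _ 0]\<close>)

lemma K_functional_greatest:
  assumes "closed_operator C" "0 \<le> c"
    and "\<And>a b. b \<in> op_dom C \<Longrightarrow> x = a + b \<Longrightarrow> y \<le> c * (norm a + t * (norm b + norm (op_app C b)))"
  shows "y \<le> c * K_functional C t x"
proof (cases "c = 0")
  case True
  then show ?thesis using assms(3)[of 0 x] closed_operatorD(1)[OF assms(1)] by simp
next
  case False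
  have "y / c \<le> K_functional C t x"
    unfolding K_functional_def
  proof (rule cInf_greatest)
    show "{norm a + t * (norm b + norm (op_app C b)) |a b. b \<in> op_dom C \<and> x = a + b} \<noteq> {}"
    proof -
      have "\<exists>a b. b \<in> op_dom C \<and> x = a + b"
        by (intro exI[of _ x] exI[of _ 0]) (simp add: closed_operatorD(1)[OF assms(1)])
      then show ?thesis by auto
    qed
  qed (use assms False in \<open>auto simp: field_simps\<close>)
  then show ?thesis using False assms(2) by (simp add: field_simps)
qed

lemma K_functional_nonneg: "closed_operator C \<Longrightarrow> 0 \<le> t \<Longrightarrow> 0 \<le> K_functional C t x"
  using K_functional_greatest[of C 1 x 0 t] by simp

lemma K_functional_le_norm: "closed_operator C \<Longrightarrow> 0 \<le> t \<Longrightarrow> K_functional C t x \<le> norm x"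
  using K_functional_le[of t 0 C x] by (simp add: closed_operatorD(1) closed_operator_zero)

lemma K_functional_mono:
  assumes "closed_operator C" "0 \<le> s" "s \<le> t"
  shows "K_functional C s x \<le> K_functional C t x"
proof -
  have "K_functional C s x \<le> 1 * K_functional C t x"
  proof (rule K_functional_greatest[OF assms(1)])
    fix a b assume b: "b \<in> op_dom C" and x: "x = a + b"
    have "s * (norm b + norm (op_app C b)) \<le> t * (norm b + norm (op_app C b))"
      using assms by (intro mult_right_mono) auto
    with K_functional_le[OF assms(2) b, of a]
    show "K_functional C s x \<le> 1 * (norm a + t * (norm b + norm (op_app C b)))"
      by (simp add: x)
  qed simp
  then show ?thesis by simp
qed

lemma K_functional_add:
  assumes C: "closed_operator C" and t: "0 \<le> t"
  shows "K_functional C t (x + y) \<le> K_functional C t x + K_functional C t y"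
proof -
  have "K_functional C t (x + y) - K_functional C t y \<le> 1 * K_functional C t x"
  proof (rule K_functional_greatest[OF C])
    fix a b assume b: "b \<in> op_dom C" and x: "x = a + b"
    let ?r = "norm a + t * (norm b + norm (op_app C b))"
    have "K_functional C t (x + y) - ?r \<le> 1 * K_functional C t y"
    proof (rule K_functional_greatest[OF C])
      fix a' b' assume b': "b' \<in> op_dom C" and y: "y = a' + b'"
      have "x + y = (a + a') + (b + b')" by (simp add: x y)
      then have "K_functional C t (x + y) \<le>
          norm (a + a') + t * (norm (b + b') + norm (op_app C b + op_app C b'))"
        using K_functional_le[OF t closed_operatorD(2)[OF C b b'], of "a + a'"]
        by (simp add: closed_operatorD(4)[OF C b b'])
      also have "\<dots> \<le> (norm a + norm a') +
          t * ((norm b + norm b') + (norm (op_app C b) + norm (op_app C b')))"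
        by (intro add_mono mult_left_mono norm_triangle_ineq t)
      finally show "K_functional C t (x + y) - ?r \<le>
          1 * (norm a' + t * (norm b' + norm (op_app C b')))"
        by (simp add: algebra_simps)
    qed simp
    then show "K_functional C t (x + y) - K_functional C t y \<le> 1 * ?r" by simp
  qed simp
  then show ?thesis by simp
qed

text \<open>An operator that is bounded on \<open>X\<close> and commutes with \<open>C\<close> acts on both summands of every
decomposition of \<open>x\<close>.\<close>

lemma K_functional_bounded_map:
  assumes C: "closed_operator C" and t: "0 \<le> t" and c: "0 \<le> c"
    and add: "\<And>x y. J (x + y) = J x + J y"
    and bd: "\<And>x. norm (J x) \<le> c * norm x"
    and dom: "\<And>b. b \<in> op_dom C \<Longrightarrow> J b \<in> op_dom C \<and> op_app C (J b) = J (op_app C b)"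
  shows "K_functional C t (J x) \<le> c * K_functional C t x"
proof (rule K_functional_greatest[OF C c])
  fix a b assume b: "b \<in> op_dom C" and x: "x = a + b"
  have "K_functional C t (J x) \<le> norm (J a) + t * (norm (J b) + norm (J (op_app C b)))"
    using K_functional_le[OF t, of "J b" C "J a"] dom[OF b] by (simp add: x add)
  also have "\<dots> \<le> c * norm a + t * (c * norm b + c * norm (op_app C b))"
    by (intro add_mono mult_left_mono bd t)
  finally show "K_functional C t (J x) \<le> c * (norm a + t * (norm b + norm (op_app C b)))"
    by (simp add: algebra_simps)
qed

abbreviation weighted_K :: "'a::complex_banach operator \<Rightarrow> real \<Rightarrow> 'a \<Rightarrow> real \<Rightarrow> real" where
  "weighted_K C \<theta> x t \<equiv> t powr (- \<theta>) * K_functional C t x"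

abbreviation interp_integrand ::
    "'a::complex_banach operator \<Rightarrow> real \<Rightarrow> real \<Rightarrow> 'a \<Rightarrow> real \<Rightarrow> ennreal" where
  "interp_integrand C \<theta> q x t \<equiv> ennreal (weighted_K C \<theta> x t powr q / t) * indicator {0<..} t"

lemma interp_space_top:
  "x \<in> interp_space C \<theta> \<infinity> \<longleftrightarrow> (\<exists>c. \<forall>t>0. weighted_K C \<theta> x t \<le> c)"
  by (auto simp: interp_space_def bdd_above_def)

lemma interp_space_finite:
  "p \<noteq> \<infinity> \<Longrightarrow> x \<in> interp_space C \<theta> p \<longleftrightarrow>
    (\<integral>\<^sup>+t. interp_integrand C \<theta> (enn2real p) x t \<partial>lborel) < \<infinity>"
  by (simp add: interp_space_def)

text \<open>The K-functional is monotone in \<open>t\<close>, hence Borel measurable.\<close>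

lemma borel_measurable_interp_integrand [measurable]:
  assumes "closed_operator C"
  shows "interp_integrand C \<theta> q x \<in> borel_measurable borel"
proof -
  have [measurable]: "(\<lambda>t. K_functional C (max t 0) x) \<in> borel_measurable borel"
    by (rule borel_measurable_mono) (auto intro!: monoI K_functional_mono[OF assms])
  have "interp_integrand C \<theta> q x = (\<lambda>t. ennreal ((t powr (- \<theta>) * K_functional C (max t 0) x) powr q / t)
      * indicator {0<..} t)"
    by (auto simp: fun_eq_iff indicator_def)
  then show ?thesis by simp
qed

lemma enn2real_ge_1: "1 \<le> p \<Longrightarrow> p \<noteq> \<infinity> \<Longrightarrow> 1 \<le> enn2real p"
  by (metis enn2real_1 enn2real_mono infinity_ennreal_def top.not_eq_extremum)

text \<open>The embedding of the interpolation space with exponent \<open>p\<close> into the one with exponent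
infinity: by monotonicity of \<open>K\<close>, the integral over \<open>[t, 2 t]\<close> alone controls the value at
\<open>t\<close>. This pointwise decay is what makes the contour integrals converge.\<close>

lemma weighted_K_bounded:
  assumes C: "closed_operator C" and "0 < \<theta>" "1 \<le> p" "x \<in> interp_space C \<theta> p"
  shows "\<exists>c\<ge>0. \<forall>t>0. weighted_K C \<theta> x t \<le> c"
proof (cases "p = \<infinity>")
  case True
  then obtain c where "\<forall>t>0. weighted_K C \<theta> x t \<le> c" using assms interp_space_top by blast
  then show ?thesis by (intro exI[of _ "max c 0"]) (auto simp: max_def intro: order_trans)
next
  case False
  define q where "q = enn2real p"
  have q: "1 \<le> q" using enn2real_ge_1 False assms by (simp add: q_def)
  let ?I = "\<integral>\<^sup>+t. interp_integrand C \<theta> q x t \<partial>lborel"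
  define I where "I = enn2real ?I"
  have I: "?I = ennreal I" "0 \<le> I"
    using assms False by (simp_all add: I_def interp_space_finite q_def less_top)
  have bound: "weighted_K C \<theta> x t \<le> 2 powr \<theta> * (2 * I) powr (1 / q)" if t: "0 < t" for t
  proof -
    define m where "m = (2 * t) powr (- \<theta>) * K_functional C t x"
    have m0: "0 \<le> m" unfolding m_def using K_functional_nonneg[OF C, of t x] t by simp
    have "ennreal (m powr q / (2 * t)) * indicator {t..2*t} s \<le> interp_integrand C \<theta> q x s" for s
    proof (cases "s \<in> {t..2*t}")
      case True
      then have "(2 * t) powr (- \<theta>) \<le> s powr (- \<theta>)"
        using t \<open>0 < \<theta>\<close> by (intro powr_mono2') auto
      then have "m \<le> weighted_K C \<theta> x s"
        unfolding m_def using True t K_functional_mono[OF C, of t s x] K_functional_nonneg[OF C, of t x]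
        by (intro mult_mono) auto
      then have "m powr q / (2 * t) \<le> weighted_K C \<theta> x s powr q / s"
        using True t m0 q by (intro frac_le powr_mono2) auto
      then show ?thesis using True t by (simp add: ennreal_leI)
    qed simp
    then have "(\<integral>\<^sup>+s. ennreal (m powr q / (2 * t)) * indicator {t..2*t} s \<partial>lborel) \<le> ?I"
      by (intro nn_integral_mono)
    then have "ennreal (m powr q / (2 * t)) * ennreal t \<le> ennreal I"
      using t by (simp add: nn_integral_cmult_indicator I)
    then have "m powr q \<le> 2 * I"
      using t I by (simp add: ennreal_mult[symmetric] field_simps)
    then have "(m powr q) powr (1 / q) \<le> (2 * I) powr (1 / q)"
      using q by (intro powr_mono2) auto
    then have "m \<le> (2 * I) powr (1 / q)"
      using m0 q by (simp add: powr_powr)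
    then have "2 powr \<theta> * m \<le> 2 powr \<theta> * (2 * I) powr (1 / q)" by simp
    moreover have "2 powr \<theta> * m = weighted_K C \<theta> x t"
      using t by (simp add: m_def powr_mult powr_minus)
    ultimately show ?thesis by simp
  qed
  then show ?thesis by (intro exI[of _ "2 powr \<theta> * (2 * I) powr (1 / q)"]) auto
qed

lemma interp_space_K_le:
  assumes C: "closed_operator C" and "0 < \<theta>" "1 \<le> p" "x \<in> interp_space C \<theta> p"
  obtains c where "0 \<le> c" "\<And>t. 0 < t \<Longrightarrow> K_functional C t x \<le> c * t powr \<theta>"
proof -
  obtain c where c: "c \<ge> 0" "\<forall>t>0. weighted_K C \<theta> x t \<le> c"
    using weighted_K_bounded[OF assms] by blast
  have "K_functional C t x \<le> c * t powr \<theta>" if "0 < t" for t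
    using c(2) that by (simp add: powr_minus field_simps)
  with c(1) that show thesis by blast
qed

text \<open>The measure \<open>dt / t\<close> is invariant under dilations.\<close>

lemma nn_integral_interp_dilation:
  assumes C: "closed_operator C" and a: "0 < a"
  shows "(\<integral>\<^sup>+t. ennreal (weighted_K C \<theta> x (a * t) powr q / t) * indicator {0<..} t \<partial>lborel) =
    (\<integral>\<^sup>+t. interp_integrand C \<theta> q x t \<partial>lborel)"
proof -
  have "(\<integral>\<^sup>+t. interp_integrand C \<theta> q x t \<partial>lborel) =
      ennreal a * (\<integral>\<^sup>+t. interp_integrand C \<theta> q x (a * t) \<partial>lborel)"
    using nn_integral_real_affine[of "interp_integrand C \<theta> q x" a 0] a C by simp
  also have "\<dots> = (\<integral>\<^sup>+t. ennreal a * interp_integrand C \<theta> q x (a * t) \<partial>lborel)"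
    by (rule nn_integral_cmult[symmetric])
      (use borel_measurable_interp_integrand[OF C] in \<open>measurable\<close>)
  also have "\<dots> = (\<integral>\<^sup>+t. ennreal (weighted_K C \<theta> x (a * t) powr q / t) * indicator {0<..} t \<partial>lborel)"
    by (intro nn_integral_cong)
      (use a in \<open>auto simp: indicator_def zero_less_mult_iff ennreal_mult[symmetric]\<close>)
  finally show ?thesis ..
qed

lemma powr_add_le:
  fixes x y :: real
  assumes "0 \<le> x" "0 \<le> y" "0 \<le> q"
  shows "(x + y) powr q \<le> 2 powr q * (x powr q + y powr q)"
proof -
  have "(x + y) powr q \<le> (2 * max x y) powr q"
    using assms by (intro powr_mono2) auto
  also have "\<dots> = 2 powr q * max x y powr q" using assms by (simp add: powr_mult)
  also have "\<dots> \<le> 2 powr q * (x powr q + y powr q)"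
    by (intro mult_left_mono) (auto simp: max_def)
  finally show ?thesis .
qed

lemma interp_space_add:
  assumes C: "closed_operator C" and p: "1 \<le> p"
    and x: "x \<in> interp_space C \<theta> p" and y: "y \<in> interp_space C \<theta> p"
  shows "x + y \<in> interp_space C \<theta> p"
proof -
  have le: "weighted_K C \<theta> (x + y) t \<le> weighted_K C \<theta> x t + weighted_K C \<theta> y t" if "0 < t" for t
    using mult_left_mono[OF K_functional_add[OF C, of t x y], of "t powr - \<theta>"] that
    by (simp add: algebra_simps)
  show ?thesis
  proof (cases "p = \<infinity>")
    case True
    then obtain c d where "\<forall>t>0. weighted_K C \<theta> x t \<le> c" "\<forall>t>0. weighted_K C \<theta> y t \<le> d"
      using x y interp_space_top by metis
    with le show ?thesis unfolding True interp_space_top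
      by (meson add_mono order_trans)
  next
    case False
    define q where "q = enn2real p"
    have q: "1 \<le> q" using enn2real_ge_1 False p by (simp add: q_def)
    have "interp_integrand C \<theta> q (x + y) t \<le>
        ennreal (2 powr q) * (interp_integrand C \<theta> q x t + interp_integrand C \<theta> q y t)" for t
    proof (cases "0 < t")
      case True
      have "weighted_K C \<theta> (x + y) t powr q \<le> (weighted_K C \<theta> x t + weighted_K C \<theta> y t) powr q"
        using le True q K_functional_nonneg[OF C] by (intro powr_mono2) auto
      also have "\<dots> \<le> 2 powr q * (weighted_K C \<theta> x t powr q + weighted_K C \<theta> y t powr q)"
        using True q K_functional_nonneg[OF C] by (intro powr_add_le) auto
      finally have "weighted_K C \<theta> (x + y) t powr q / t \<le>
          2 powr q * (weighted_K C \<theta> x t powr q / t + weighted_K C \<theta> y t powr q / t)"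
        using True by (simp add: field_simps)
      then show ?thesis
        using True by (simp add: ennreal_mult[symmetric] ennreal_plus[symmetric] ennreal_leI
            del: ennreal_plus)
    qed simp
    then have "(\<integral>\<^sup>+t. interp_integrand C \<theta> q (x + y) t \<partial>lborel) \<le>
        (\<integral>\<^sup>+t. ennreal (2 powr q) * (interp_integrand C \<theta> q x t + interp_integrand C \<theta> q y t) \<partial>lborel)"
      by (rule nn_integral_mono)
    also have "\<dots> = ennreal (2 powr q) * ((\<integral>\<^sup>+t. interp_integrand C \<theta> q x t \<partial>lborel) +
        (\<integral>\<^sup>+t. interp_integrand C \<theta> q y t \<partial>lborel))"
      using borel_measurable_interp_integrand[OF C]
      by (simp add: nn_integral_cmult nn_integral_add)
    also have "\<dots> < \<infinity>"
      using x y False by (simp add: interp_space_finite q_def ennreal_mult_less_top)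
    finally show ?thesis using False by (simp add: interp_space_finite q_def)
  qed
qed

text \<open>A discrete Hardy inequality. The weight \<open>t powr (- \<theta>)\<close> turns the two halves of the sum into
geometric series with ratios \<open>exp (- \<theta>)\<close> and \<open>exp (- (1 - \<theta>))\<close>. Half of the geometric
decay is spent on summing over \<open>j\<close> after taking a supremum, so that the \<open>p\<close>-th power of the
sum is dominated by a sum of \<open>p\<close>-th powers; the other half makes the latter summable.\<close>

lemma interp_space_Hardy:
  assumes C: "closed_operator C" and C': "closed_operator C'"
    and \<theta>: "0 < \<theta>" "\<theta> < 1" and p: "1 \<le> p" and c: "0 \<le> c"
    and x: "x \<in> interp_space C \<theta> p"
    and dom: "\<And>t S. 0 < t \<Longrightarrow> (\<And>N. (\<Sum>j<N. K_functional C (exp (- real j) * t) x +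
        exp (- real j) * K_functional C (exp (real j) * t) x) \<le> S) \<Longrightarrow> K_functional C' t v \<le> c * S"
  shows "v \<in> interp_space C' \<theta> p"
proof -
  let ?\<kappa> = "weighted_K C \<theta> x"
  have k0: "0 \<le> ?\<kappa> t" if "0 < t" for t using K_functional_nonneg[OF C, of t] that by simp
  obtain B where B: "0 \<le> B" "\<forall>t>0. ?\<kappa> t \<le> B" using weighted_K_bounded[OF C \<theta>(1) p x] by blast
  \<comment> \<open>the square root of the slower of the two geometric ratios\<close>
  define r where "r = exp (- min \<theta> (1 - \<theta>) / 2)"
  have r: "0 < r" "r < 1" using \<theta> by (auto simp: r_def)
  define e where "e j t = r ^ j * (?\<kappa> (exp (- real j) * t) + ?\<kappa> (exp (real j) * t))" for j t
  have e0: "0 \<le> e j t" if "0 < t" for j t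
    using k0[of "exp (- real j) * t"] k0[of "exp (real j) * t"] that r by (simp add: e_def)
  have key: "weighted_K C' \<theta> v t \<le> c / (1 - r) * Z" if t: "0 < t" and Z: "\<And>j. e j t \<le> Z" for t Z
  proof -
    have Z0: "0 \<le> Z" using Z[of 0] e0[OF t, of 0] by simp
    have summand: "K_functional C (exp (- real j) * t) x + exp (- real j) * K_functional C (exp (real j) * t) x
        \<le> t powr \<theta> * (r ^ j * Z)" for j
    proof -
      have rj: "r ^ j * r ^ j = exp (- (min \<theta> (1 - \<theta>) * real j))"
        by (simp add: r_def exp_of_nat_mult[symmetric] exp_add[symmetric] algebra_simps)
      have A: "K_functional C (exp (- real j) * t) x \<le> t powr \<theta> * (r ^ j * r ^ j * ?\<kappa> (exp (- real j) * t))"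
      proof -
        have "K_functional C (exp (- real j) * t) x =
            t powr \<theta> * (exp (- (\<theta> * real j)) * ?\<kappa> (exp (- real j) * t))"
          using t by (simp add: powr_mult powr_minus powr_def ln_mult exp_minus[symmetric] mult_exp_exp algebra_simps)
        also have "\<dots> \<le> t powr \<theta> * (r ^ j * r ^ j * ?\<kappa> (exp (- real j) * t))"
          unfolding rj using k0[of "exp (- real j) * t"] t
          by (intro mult_left_mono mult_right_mono) (auto intro: mult_right_mono)
        finally show ?thesis .
      qed
      have B': "exp (- real j) * K_functional C (exp (real j) * t) x
          \<le> t powr \<theta> * (r ^ j * r ^ j * ?\<kappa> (exp (real j) * t))"
      proof -
        have "exp (- real j) * K_functional C (exp (real j) * t) x =
            t powr \<theta> * (exp (- ((1 - \<theta>) * real j)) * ?\<kappa> (exp (real j) * t))"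
          using t by (simp add: powr_mult powr_minus powr_def ln_mult exp_minus[symmetric] mult_exp_exp algebra_simps)
        also have "\<dots> \<le> t powr \<theta> * (r ^ j * r ^ j * ?\<kappa> (exp (real j) * t))"
          unfolding rj using k0[of "exp (real j) * t"] t
          by (intro mult_left_mono mult_right_mono) (auto intro: mult_right_mono)
        finally show ?thesis .
      qed
      have "K_functional C (exp (- real j) * t) x + exp (- real j) * K_functional C (exp (real j) * t) x
          \<le> t powr \<theta> * (r ^ j * e j t)"
        using add_mono[OF A B'] by (simp add: e_def algebra_simps)
      also have "\<dots> \<le> t powr \<theta> * (r ^ j * Z)"
        using Z[of j] r by (intro mult_left_mono) auto
      finally show ?thesis .
    qed
    have "(\<Sum>j<N. K_functional C (exp (- real j) * t) x +
        exp (- real j) * K_functional C (exp (real j) * t) x) \<le> t powr \<theta> * Z / (1 - r)" for N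
    proof -
      have "(\<Sum>j<N. K_functional C (exp (- real j) * t) x +
        exp (- real j) * K_functional C (exp (real j) * t) x) \<le> (\<Sum>j<N. t powr \<theta> * (r ^ j * Z))"
        by (intro sum_mono summand)
      also have "\<dots> = t powr \<theta> * Z * (\<Sum>j<N. r ^ j)"
        by (simp add: sum_distrib_left algebra_simps)
      also have "\<dots> \<le> t powr \<theta> * Z * (1 / (1 - r))"
        using r Z0 sum_le_suminf[OF summable_geometric[of r], of "{..<N}"] suminf_geometric[of r]
        by (intro mult_left_mono) auto
      finally show ?thesis by simp
    qed
    from dom[OF t this] have "K_functional C' t v \<le> c * (t powr \<theta> * Z / (1 - r))" .
    then show ?thesis using t by (simp add: powr_minus field_simps)
  qed
  have e_le: "e j t \<le> 2 * B" if "0 < t" for j t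
  proof -
    have "r ^ j \<le> 1" using r by (simp add: power_le_one)
    moreover have "?\<kappa> (exp (- real j) * t) \<le> B" "?\<kappa> (exp (real j) * t) \<le> B"
      using B(2) that by (auto simp del: mult_le_cancel_left)
    ultimately have "e j t \<le> 1 * (B + B)"
      unfolding e_def using B(1) k0[of "exp (- real j) * t"] k0[of "exp (real j) * t"] that r
      by (intro mult_mono add_mono) auto
    then show ?thesis by simp
  qed
  show ?thesis
  proof (cases "p = \<infinity>")
    case True
    show ?thesis unfolding True interp_space_top using key e_le by blast
  next
    case False
    define q where "q = enn2real p"
    have q: "1 \<le> q" using enn2real_ge_1 False p by (simp add: q_def)
    define k where "k = c / (1 - r)"
    have k: "0 \<le> k" using c r by (simp add: k_def)
    define A where "A j = k powr q * ((r powr q) ^ j * 2 powr q)" for j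
    let ?I = "\<integral>\<^sup>+t. interp_integrand C \<theta> q x t \<partial>lborel"
    let ?f = "\<lambda>a t. ennreal (?\<kappa> (a * t) powr q / t) * indicator {0<..} t"
    have meas: "?f a \<in> borel_measurable borel" if "0 < a" for a
    proof -
      have "?f a = (\<lambda>t. ennreal a * interp_integrand C \<theta> q x (a * t))"
        using that by (auto simp: fun_eq_iff indicator_def zero_less_mult_iff ennreal_mult[symmetric])
      then show ?thesis using borel_measurable_interp_integrand[OF C] by simp
    qed
    have pw: "interp_integrand C' \<theta> q v t \<le>
        (\<Sum>j. ennreal (A j) * (?f (exp (- real j)) t + ?f (exp (real j)) t))" for t
    proof (cases "0 < t")
      case t: True
      define S where "S = (\<Sum>j. ennreal (e j t powr q))"
      have le: "ennreal (weighted_K C' \<theta> v t powr q) \<le> ennreal (k powr q) * S"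
      proof (cases "S = \<infinity>")
        case True
        show ?thesis
        proof (cases "k = 0")
          case False
          then show ?thesis using True k by (simp add: ennreal_mult_top)
        next
          case True
          from key[OF t e_le[OF t]] have "weighted_K C' \<theta> v t = 0"
            using True K_functional_nonneg[OF C', of t v] t
            by (auto simp: k_def[symmetric] mult_le_0_iff)
          then show ?thesis by auto
        qed
      next
        case fin: False
        \<comment> \<open>the supremum of the e j t is at most the q-norm of the sequence\<close>
        define Z where "Z = enn2real S powr (1 / q)"
        have S: "S = ennreal (enn2real S)" using fin by (metis ennreal_enn2real infinity_ennreal_def less_top)
        have "e j t \<le> Z" for j
        proof -
          have "ennreal (e j t powr q) \<le> S"
          proof -
            have "(\<Sum>i\<in>{j}. ennreal (e i t powr q)) \<le> S"
              unfolding S_def by (rule sum_le_suminf) auto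
            then show ?thesis by simp
          qed
          then have "e j t powr q \<le> enn2real S"
            by (metis S ennreal_le_iff enn2real_nonneg)
          then have "(e j t powr q) powr (1 / q) \<le> Z"
            unfolding Z_def using q by (intro powr_mono2) auto
          then show ?thesis using q e0[OF t] by (simp add: powr_powr)
        qed
        from key[OF t this] have "weighted_K C' \<theta> v t powr q \<le> (k * Z) powr q"
          using t q K_functional_nonneg[OF C', of t v] by (intro powr_mono2) (auto simp: k_def)
        also have "\<dots> = k powr q * enn2real S"
          using q k by (simp add: Z_def powr_mult powr_powr)
        finally have "ennreal (weighted_K C' \<theta> v t powr q) \<le> ennreal (k powr q * enn2real S)"
          by (rule ennreal_leI)
        then show ?thesis by (subst S) (simp add: ennreal_mult)
      qed
      have "interp_integrand C' \<theta> q v t = ennreal (1 / t) * ennreal (weighted_K C' \<theta> v t powr q)"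
        using t by (simp add: ennreal_mult[symmetric])
      also have "\<dots> \<le> ennreal (1 / t) * (ennreal (k powr q) * S)"
        by (intro mult_left_mono le) simp
      also have "\<dots> = (\<Sum>j. ennreal (1 / t) * (ennreal (k powr q) * ennreal (e j t powr q)))"
        by (simp add: S_def)
      also have "\<dots> \<le> (\<Sum>j. ennreal (A j) * (?f (exp (- real j)) t + ?f (exp (real j)) t))"
      proof (intro suminf_le)
        fix j
        have kk: "0 \<le> ?\<kappa> (exp (- real j) * t)" "0 \<le> ?\<kappa> (exp (real j) * t)"
          using k0 t by auto
        have "e j t powr q = (r powr q) ^ j * (?\<kappa> (exp (- real j) * t) + ?\<kappa> (exp (real j) * t)) powr q"
          unfolding e_def using kk r
          by (subst powr_mult) (auto simp: powr_realpow[symmetric] powr_powr mult.commute)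
        also have "\<dots> \<le> (r powr q) ^ j *
            (2 powr q * (?\<kappa> (exp (- real j) * t) powr q + ?\<kappa> (exp (real j) * t) powr q))"
          using kk q by (intro mult_left_mono powr_add_le) auto
        finally have "k powr q * e j t powr q \<le> k powr q * ((r powr q) ^ j *
            (2 powr q * (?\<kappa> (exp (- real j) * t) powr q + ?\<kappa> (exp (real j) * t) powr q)))"
          by (intro mult_left_mono) auto
        then have "1 / t * (k powr q * e j t powr q) \<le>
            A j * (?\<kappa> (exp (- real j) * t) powr q / t + ?\<kappa> (exp (real j) * t) powr q / t)"
          using t unfolding A_def by (simp add: field_simps)
        then have "ennreal (1 / t * (k powr q * e j t powr q)) \<le>
            ennreal (A j * (?\<kappa> (exp (- real j) * t) powr q / t + ?\<kappa> (exp (real j) * t) powr q / t))"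
          by (rule ennreal_leI)
        moreover have "0 \<le> A j" by (simp add: A_def)
        moreover have "ennreal (1 / t) * (ennreal (k powr q) * ennreal (e j t powr q)) =
            ennreal (1 / t * (k powr q * e j t powr q))"
          using t by (simp only: ennreal_mult[symmetric] powr_ge_zero mult_nonneg_nonneg
              zero_le_divide_1_iff less_imp_le)
        ultimately show "ennreal (1 / t) * (ennreal (k powr q) * ennreal (e j t powr q)) \<le>
            ennreal (A j) * (?f (exp (- real j)) t + ?f (exp (real j)) t)"
          using t by (simp add: ennreal_mult ennreal_plus)
      qed auto
      finally show ?thesis .
    qed simp
    have "(\<integral>\<^sup>+t. interp_integrand C' \<theta> q v t \<partial>lborel) \<le>
        (\<integral>\<^sup>+t. (\<Sum>j. ennreal (A j) * (?f (exp (- real j)) t + ?f (exp (real j)) t)) \<partial>lborel)"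
      by (intro nn_integral_mono pw)
    also have "\<dots> = (\<Sum>j. \<integral>\<^sup>+t. ennreal (A j) * (?f (exp (- real j)) t + ?f (exp (real j)) t) \<partial>lborel)"
      by (rule nn_integral_suminf) (use meas[OF exp_gt_zero] in simp)
    also have "\<dots> = (\<Sum>j. ennreal (A j) * (?I + ?I))"
    proof (rule arg_cong[where f = suminf], rule ext)
      fix j
      show "(\<integral>\<^sup>+t. ennreal (A j) * (?f (exp (- real j)) t + ?f (exp (real j)) t) \<partial>lborel) =
          ennreal (A j) * (?I + ?I)"
        using meas[of "exp (- real j)"] meas[of "exp (real j)"]
        by (simp add: nn_integral_cmult nn_integral_add nn_integral_interp_dilation[OF C])
    qed
    also have "\<dots> = (\<Sum>j. ennreal (A j)) * (?I + ?I)"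
      by simp
    also have "\<dots> < \<infinity>"
    proof -
      have rq: "r powr q < 1" using r q powr_less_mono2[of q r 1] by simp
      have "summable A"
        unfolding A_def using rq by (intro summable_mult summable_mult2 summable_geometric) simp
      then have "(\<Sum>j. ennreal (A j)) < \<infinity>"
        by (subst suminf_ennreal2) (auto simp: A_def)
      moreover have "?I + ?I < \<infinity>" using x False by (simp add: interp_space_finite q_def)
      ultimately show ?thesis by (simp add: ennreal_mult_less_top)
    qed
    finally show ?thesis using False by (simp add: interp_space_finite q_def)
  qed
qed

lemma interp_space_dominated:
  assumes C: "closed_operator C" and C': "closed_operator C'"
    and \<theta>: "0 < \<theta>" "\<theta> < 1" and p: "1 \<le> p" and c: "0 \<le> c"
    and x: "x \<in> interp_space C \<theta> p"
    and dom: "\<And>t. 0 < t \<Longrightarrow> K_functional C' t v \<le> c * K_functional C t x"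
  shows "v \<in> interp_space C' \<theta> p"
proof (rule interp_space_Hardy[OF C C' \<theta> p c x])
  fix t S :: real
  assume t: "0 < t" and S: "\<And>N. (\<Sum>j<N. K_functional C (exp (- real j) * t) x +
        exp (- real j) * K_functional C (exp (real j) * t) x) \<le> S"
  have "K_functional C t x \<le> S" using S[of 1] K_functional_nonneg[OF C, of t x] t by simp
  then show "K_functional C' t v \<le> c * S"
    using dom[OF t] mult_left_mono[OF _ c] by fastforce
qed

lemma interp_space_scaleC:
  assumes C: "closed_operator C" and \<theta>: "0 < \<theta>" "\<theta> < 1" and p: "1 \<le> p"
    and x: "x \<in> interp_space C \<theta> p"
  shows "a *\<^sub>C x \<in> interp_space C \<theta> p"
proof (rule interp_space_dominated[OF C C \<theta> p _ x, of "cmod a"])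
  fix t :: real assume "0 < t"
  then show "K_functional C t (a *\<^sub>C x) \<le> cmod a * K_functional C t x"
    by (intro K_functional_bounded_map[OF C])
      (auto simp: scaleC_add_right norm_scaleC closed_operatorD[OF C])
qed simp

lemma interp_space_diff:
  assumes C: "closed_operator C" and \<theta>: "0 < \<theta>" "\<theta> < 1" and p: "1 \<le> p"
    and x: "x \<in> interp_space C \<theta> p" and y: "y \<in> interp_space C \<theta> p"
  shows "x - y \<in> interp_space C \<theta> p"
  using interp_space_add[OF C p x interp_space_scaleC[OF C \<theta> p y, of "-1"]]
  by (simp add: scaleC_minus_left scaleC_one)

text \<open>A larger operator admits more decompositions, which can only lower the K-functional.\<close>

lemma interp_space_op_extends:
  assumes C: "closed_operator C" and C': "closed_operator C'" and ext: "C \<subseteq>\<^sub>o\<^sub>p C'"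
    and \<theta>: "0 < \<theta>" "\<theta> < 1" and p: "1 \<le> p"
  shows "interp_space C \<theta> p \<subseteq> interp_space C' \<theta> p"
proof
  fix x assume x: "x \<in> interp_space C \<theta> p"
  show "x \<in> interp_space C' \<theta> p"
  proof (rule interp_space_dominated[OF C C' \<theta> p _ x, of 1])
    fix t :: real assume "0 < t"
    show "K_functional C' t x \<le> 1 * K_functional C t x"
    proof (rule K_functional_greatest[OF C])
      fix a b assume "b \<in> op_dom C" "x = a + b"
      then show "K_functional C' t x \<le> 1 * (norm a + t * (norm b + norm (op_app C b)))"
        using K_functional_le[of t b C' a] ext \<open>0 < t\<close> by (auto simp: op_extends_def)
    qed simp
  qed simp
qed

section \<open>Absolutely convergent improper integrals\<close>

lemma tendsto_exp_decay: "0 < \<delta> \<Longrightarrow> ((\<lambda>s. c * exp (- \<delta> * s)) \<longlongrightarrow> (0::real)) at_top"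
  by (rule tendsto_mult_right_zero)
    (intro filterlim_compose[OF exp_at_bot]
      filterlim_tendsto_neg_mult_at_bot[OF tendsto_const _ filterlim_ident]; simp)

lemma tendsto_exp_decay_nat: "0 < \<delta> \<Longrightarrow> (\<lambda>n. c * exp (- \<delta> * real n) * d) \<longlonglongrightarrow> (0::real)"
  by (rule tendsto_mult_left_zero) (rule filterlim_compose[OF tendsto_exp_decay filterlim_real_sequentially])

lemma exp_decay_tail:
  fixes f :: "real \<Rightarrow> 'a::banach"
  assumes f: "continuous_on UNIV f" and \<delta>: "0 < \<delta>"
    and bd: "\<And>s. 0 \<le> s \<Longrightarrow> norm (f s) \<le> c * exp (- \<delta> * s)"
    and ab: "0 \<le> a" "a \<le> b"
  shows "norm (integral {a..b} f) \<le> c / \<delta> * exp (- \<delta> * a)"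
proof -
  have "((\<lambda>s. c * exp (- \<delta> * s)) has_integral
      (- (c / \<delta>) * exp (- \<delta> * b) - (- (c / \<delta>) * exp (- \<delta> * a)))) {a..b}"
    by (rule fundamental_theorem_of_calculus[OF ab(2)])
      (use \<delta> in \<open>auto simp: has_real_derivative_iff_has_vector_derivative[symmetric]
        intro!: derivative_eq_intros\<close>)
  note I = this
  have "norm (integral {a..b} f) \<le> integral {a..b} (\<lambda>s. c * exp (- \<delta> * s))"
    by (rule integral_norm_bound_integral)
      (use I bd ab f in \<open>auto intro: integrable_continuous_real continuous_on_subset simp: has_integral_integrable\<close>)
  also have "\<dots> = c / \<delta> * exp (- \<delta> * a) - c / \<delta> * exp (- \<delta> * b)"
    using integral_unique[OF I] by simp
  also have "\<dots> \<le> c / \<delta> * exp (- \<delta> * a)"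
  proof -
    have "0 \<le> c" using bd[of 0] norm_ge_zero[of "f 0"] by (simp del: norm_ge_zero)
    then show ?thesis using \<delta> by simp
  qed
  finally show ?thesis .
qed

lemma exp_decay_improper_integral_half_line:
  fixes f :: "real \<Rightarrow> 'a::banach"
  assumes f: "continuous_on UNIV f" and \<delta>: "0 < \<delta>"
    and bd: "\<And>s. 0 \<le> s \<Longrightarrow> norm (f s) \<le> c * exp (- \<delta> * s)"
  shows "\<exists>L. ((\<lambda>b. integral {0..b} f) \<longlongrightarrow> L) at_top"
proof -
  define F where "F b = integral {0..b} f" for b
  have tail: "norm (F b - F a) \<le> c / \<delta> * exp (- \<delta> * a)" if "0 \<le> a" "a \<le> b" for a b
  proof -
    have "F b - F a = integral {a..b} f"
    proof -
      have "integral {0..a} f + integral {a..b} f = integral {0..b} f"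
        using that f by (intro Henstock_Kurzweil_Integration.integral_combine)
          (auto intro: integrable_continuous_real continuous_on_subset)
      then show ?thesis unfolding F_def by (simp add: algebra_simps)
    qed
    with exp_decay_tail[OF assms that] show ?thesis by simp
  qed
  have lim0: "((\<lambda>b. c / \<delta> * exp (- \<delta> * b)) \<longlongrightarrow> 0) at_top"
    by (rule tendsto_exp_decay[OF \<delta>])
  have "Cauchy (\<lambda>n. F (real n))"
  proof (rule CauchyI')
    fix e :: real assume "0 < e"
    with order_tendstoD(2)[OF lim0] have "\<forall>\<^sub>F b in at_top. c / \<delta> * exp (- \<delta> * b) < e" by blast
    then obtain N where N: "\<And>b. N \<le> b \<Longrightarrow> c / \<delta> * exp (- \<delta> * b) < e"
      by (auto simp: eventually_at_top_linorder)
    obtain m0 where m0: "N \<le> real m0" using real_arch_simple by blast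
    show "\<exists>M. \<forall>m\<ge>M. \<forall>n>m. dist (F (real m)) (F (real n)) < e"
    proof (intro exI allI impI)
      fix m n assume "m0 \<le> m" "m < n"
      then have "norm (F (real n) - F (real m)) < e"
        using tail[of "real m" "real n"] N[of "real m"] m0 by force
      then show "dist (F (real m)) (F (real n)) < e" by (simp add: dist_norm norm_minus_commute)
    qed
  qed
  then obtain L where L: "(\<lambda>n. F (real n)) \<longlonglongrightarrow> L"
    using Cauchy_convergent convergent_def by blast
  have "norm (F b - L) \<le> c / \<delta> * exp (- \<delta> * b)" if "0 \<le> b" for b
  proof (rule tendsto_upperbound)
    show "(\<lambda>n. norm (F b - F (real n))) \<longlonglongrightarrow> norm (F b - L)"
      by (intro tendsto_intros L)
    show "\<forall>\<^sub>F n in sequentially. norm (F b - F (real n)) \<le> c / \<delta> * exp (- \<delta> * b)"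
      using eventually_ge_at_top[of "nat \<lceil>b\<rceil>"]
    proof eventually_elim
      case (elim n)
      then have "b \<le> real n" by linarith
      with tail[OF that] show ?case by (metis norm_minus_commute)
    qed
  qed simp
  then have "((\<lambda>b. F b - L) \<longlongrightarrow> 0) at_top"
    by (intro Lim_null_comparison[OF _ lim0] eventually_at_top_linorderI[of 0]) auto
  then have "(F \<longlongrightarrow> L) at_top" by (simp add: LIM_zero_iff)
  then show ?thesis unfolding F_def by blast
qed

text \<open>The centre \<open>\<sigma>\<close> of the truncations is free, because the K-functional estimate cuts the rays
at an arbitrary point.\<close>

lemma exp_decay_improper_integral:
  fixes f :: "real \<Rightarrow> 'a::banach"
  assumes f: "continuous_on UNIV f" and \<delta>: "0 < \<delta>"
    and bd: "\<And>s. norm (f s) \<le> c * exp (- \<delta> * \<bar>s\<bar>)"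
  shows "\<exists>v. \<forall>\<sigma>. (\<lambda>n. integral {\<sigma> - real n..\<sigma> + real n} f) \<longlonglongrightarrow> v"
proof -
  have f': "continuous_on UNIV (\<lambda>s. f (- s))"
    using f by (intro continuous_on_compose2[OF f] continuous_intros) auto
  obtain L1 where L1: "((\<lambda>b. integral {0..b} f) \<longlongrightarrow> L1) at_top"
    using exp_decay_improper_integral_half_line[OF f \<delta>, of c] bd by (metis abs_of_nonneg)
  obtain L2 where L2: "((\<lambda>b. integral {0..b} (\<lambda>s. f (- s))) \<longlongrightarrow> L2) at_top"
    using exp_decay_improper_integral_half_line[OF f' \<delta>, of c] bd by (metis abs_of_nonneg abs_minus_cancel)
  have "(\<lambda>n. integral {\<sigma> - real n..\<sigma> + real n} f) \<longlonglongrightarrow> L2 + L1" for \<sigma>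
  proof -
    have "filterlim (\<lambda>n. real n - \<sigma>) at_top sequentially" "filterlim (\<lambda>n. \<sigma> + real n) at_top sequentially"
      using filterlim_tendsto_add_at_top[OF tendsto_const[of "- \<sigma>"] filterlim_real_sequentially]
        filterlim_tendsto_add_at_top[OF tendsto_const[of \<sigma>] filterlim_real_sequentially]
      by simp_all
    then have "(\<lambda>n. integral {0..real n - \<sigma>} (\<lambda>s. f (- s)) + integral {0..\<sigma> + real n} f) \<longlonglongrightarrow> L2 + L1"
      by (intro tendsto_add filterlim_compose[OF L1] filterlim_compose[OF L2])
    moreover have "\<forall>\<^sub>F n in sequentially. integral {0..real n - \<sigma>} (\<lambda>s. f (- s)) + integral {0..\<sigma> + real n} f
        = integral {\<sigma> - real n..\<sigma> + real n} f"
      using eventually_ge_at_top[of "nat \<lceil>\<bar>\<sigma>\<bar>\<rceil>"]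
    proof eventually_elim
      case (elim n)
      then have n: "\<bar>\<sigma>\<bar> \<le> real n" by linarith
      have "integral {0..real n - \<sigma>} (\<lambda>s. f (- s)) = integral {\<sigma> - real n..0} f"
        using Henstock_Kurzweil_Integration.integral_reflect_real[of "real n - \<sigma>" 0 "\<lambda>s. f (- s)"] by simp
      moreover have "integral {\<sigma> - real n..0} f + integral {0..\<sigma> + real n} f =
          integral {\<sigma> - real n..\<sigma> + real n} f"
        using n f by (intro Henstock_Kurzweil_Integration.integral_combine) (auto intro: integrable_continuous_real continuous_on_subset)
      ultimately show ?case by simp
    qed
    ultimately show ?thesis by (rule Lim_transform_eventually)
  qed
  then show ?thesis by blast
qed

text \<open>Unit steps in \<open>s\<close> are dilations by \<open>e\<close> in the variable of the K-functional; these two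
lemmas produce the sums to which the Hardy inequality applies.\<close>

lemma norm_integral_le_sum_right:
  fixes f :: "real \<Rightarrow> 'a::banach"
  assumes f: "continuous_on UNIV f"
    and bd: "\<And>j s. \<sigma> + real j \<le> s \<Longrightarrow> s \<le> \<sigma> + real j + 1 \<Longrightarrow> norm (f s) \<le> m j"
  shows "norm (integral {\<sigma>..\<sigma> + real N} f) \<le> (\<Sum>j<N. m j)"
proof (induction N)
  case (Suc N)
  have "integral {\<sigma>..\<sigma> + real N} f + integral {\<sigma> + real N..\<sigma> + real (Suc N)} f =
      integral {\<sigma>..\<sigma> + real (Suc N)} f"
    by (rule Henstock_Kurzweil_Integration.integral_combine)
      (use f in \<open>auto intro: integrable_continuous_real continuous_on_subset\<close>)
  moreover have "norm (integral {\<sigma> + real N..\<sigma> + real (Suc N)} f) \<le>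
      m N * ((\<sigma> + real (Suc N)) - (\<sigma> + real N))"
    by (rule integral_bound) (use f bd in \<open>auto intro: continuous_on_subset\<close>)
  ultimately show ?case
    using Suc norm_triangle_ineq[of "integral {\<sigma>..\<sigma> + real N} f"
        "integral {\<sigma> + real N..\<sigma> + real (Suc N)} f"] by simp
qed simp

lemma norm_integral_le_sum_left:
  fixes f :: "real \<Rightarrow> 'a::banach"
  assumes f: "continuous_on UNIV f"
    and bd: "\<And>j s. \<sigma> - real j - 1 \<le> s \<Longrightarrow> s \<le> \<sigma> - real j \<Longrightarrow> norm (f s) \<le> m j"
  shows "norm (integral {\<sigma> - real N..\<sigma>} f) \<le> (\<Sum>j<N. m j)"
proof -
  have "norm (integral {- \<sigma>..- \<sigma> + real N} (\<lambda>s. f (- s))) \<le> (\<Sum>j<N. m j)"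
    by (rule norm_integral_le_sum_right)
      (use bd in \<open>auto intro!: continuous_on_compose2[OF f] continuous_intros\<close>)
  moreover have "integral {- \<sigma>..- \<sigma> + real N} (\<lambda>s. f (- s)) = integral {\<sigma> - real N..\<sigma>} f"
    using Henstock_Kurzweil_Integration.integral_reflect_real[of "\<sigma>" "\<sigma> - real N" f] by simp
  ultimately show ?thesis by simp
qed

lemma arc_tendsto_0:
  fixes q :: "complex \<Rightarrow> 'a::complex_banach"
  assumes cont: "continuous_on S q" and le: "\<alpha> \<le> \<beta>" and \<delta>: "0 < \<delta>"
    and S: "\<And>s \<psi>. \<psi> \<in> {\<alpha>..\<beta>} \<Longrightarrow> polar s \<psi> \<in> S"
    and bd: "\<And>z n. z \<in> S \<Longrightarrow> cmod z = exp (r n) \<Longrightarrow> norm (q z) \<le> c * exp (- \<delta> * real n)"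
  shows "(\<lambda>n. integral {\<alpha>..\<beta>} (\<lambda>\<psi>. q (polar (r n) \<psi>))) \<longlonglongrightarrow> 0"
proof (rule Lim_null_comparison)
  show "\<forall>\<^sub>F n in sequentially. norm (integral {\<alpha>..\<beta>} (\<lambda>\<psi>. q (polar (r n) \<psi>)))
      \<le> c * exp (- \<delta> * real n) * (\<beta> - \<alpha>)"
    by (rule always_eventually, rule allI, rule norm_arc_integral_le[OF cont S le bd])
  show "(\<lambda>n. c * exp (- \<delta> * real n) * (\<beta> - \<alpha>)) \<longlonglongrightarrow> 0"
    by (rule tendsto_exp_decay_nat[OF \<delta>])
qed

section \<open>The resolvent outside the sector\<close>

lemma bounded_clinearD:
  assumes "bounded_clinear f"
  shows "bounded_linear f" "f (c *\<^sub>C x) = c *\<^sub>C f x"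
proof -
  show "bounded_linear f" using assms by (simp add: bounded_clinear_def)
  have "Vector_Spaces.linear scaleC scaleC f" using assms by (simp add: bounded_clinear_def)
  then show "f (c *\<^sub>C x) = c *\<^sub>C f x"
    unfolding Vector_Spaces.linear_def module_hom_def module_hom_axioms_def by blast
qed

text \<open>The part of the hypotheses that concerns \<open>D\<close>: \<open>G\<close> is its inverse, and \<open>R\<close> its resolvent on
the outer region, with the sectorial estimate.\<close>

locale sectorial_inverse =
  fixes D :: "'a::complex_banach operator" and G :: "'a \<Rightarrow>\<^sub>L 'a"
    and R :: "complex \<Rightarrow> 'a \<Rightarrow>\<^sub>L 'a" and \<phi> M :: real
  assumes closed_D: "closed_operator D"
    and inverse_D: "is_bounded_inverse D G"
    and resolvent_R: "z \<in> outer_region \<phi> \<Longrightarrow> is_bounded_inverse (op_shift z D) (R z)"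
    and resolvent_bound: "z \<in> outer_region \<phi> \<Longrightarrow> norm (z *\<^sub>C R z x) \<le> M * norm x"
    and M_nonneg: "0 \<le> M"
    and angle: "0 < \<phi>" "\<phi> < pi"
begin

lemma angle_le: "0 \<le> \<phi>" "\<phi> \<le> pi"
  using angle by simp_all

lemma D_G [simp]: "G y \<in> op_dom D" "op_app D (G y) = y"
  and G_D: "x \<in> op_dom D \<Longrightarrow> G (op_app D x) = x"
  using inverse_D by (auto simp: is_bounded_inverse_def)

lemma R_clinear: "z \<in> outer_region \<phi> \<Longrightarrow> bounded_clinear (R z)"
  using resolvent_R by (auto simp: is_bounded_inverse_def bounded_clinear_ops_def)

lemma R_scaleC: "z \<in> outer_region \<phi> \<Longrightarrow> R z (c *\<^sub>C x) = c *\<^sub>C R z x"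
  using R_clinear bounded_clinearD by blast

text \<open>The bounded operator \<open>D R(z,D)\<close>, written without the unbounded operator.\<close>

definition D_R :: "complex \<Rightarrow> 'a \<Rightarrow> 'a" where
  "D_R z g = z *\<^sub>C R z g - g"

lemma
  assumes z: "z \<in> outer_region \<phi>"
  shows R_in_dom: "R z y \<in> op_dom D"
    and D_R: "op_app D (R z y) = D_R z y"
    and R_D: "x \<in> op_dom D \<Longrightarrow> R z (op_app D x) = D_R z x"
proof -
  have inv: "is_bounded_inverse (op_shift z D) (R z)" by (rule resolvent_R[OF z])
  then have "R z y \<in> op_dom (op_shift z D)" "op_app (op_shift z D) (R z y) = y"
    by (auto simp: is_bounded_inverse_def)
  then show "R z y \<in> op_dom D" "op_app D (R z y) = D_R z y"
    by (auto simp: op_add_def op_scale_def op_id_def D_R_def scaleC_minus_left scaleC_one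
        algebra_simps)
  assume "x \<in> op_dom D"
  then have "x \<in> op_dom (op_shift z D)" by (simp add: op_add_def op_scale_def op_id_def)
  then have "R z (op_app (op_shift z D) x) = x"
    using inv by (auto simp: is_bounded_inverse_def)
  then show "R z (op_app D x) = D_R z x"
    by (simp add: op_add_def op_scale_def op_id_def D_R_def scaleC_minus_left scaleC_one
        blinfun.diff_right R_scaleC[OF z] algebra_simps)
qed

lemma G_D_R: "z \<in> outer_region \<phi> \<Longrightarrow> G (D_R z y) = R z y"
  using G_D[OF R_in_dom] D_R by simp

text \<open>Commuting with the unbounded \<open>D\<close>, or with its resolvents, is reduced to commuting with the
single bounded operator \<open>G\<close>.\<close>

lemma commute_G_imp_commute_D:
  assumes "\<And>x. T (G x) = G (T x)" "x \<in> op_dom D"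
  shows "T x \<in> op_dom D" "op_app D (T x) = T (op_app D x)"
proof -
  have "T x = G (T (op_app D x))"
    using assms(1)[of "op_app D x"] G_D[OF assms(2)] by simp
  then show "T x \<in> op_dom D" "op_app D (T x) = T (op_app D x)" by simp_all
qed

lemma commute_G_imp_commute_R:
  assumes T: "bounded_clinear T" and TG: "\<And>x. T (G x) = G (T x)" and z: "z \<in> outer_region \<phi>"
  shows "T (R z y) = R z (T y)"
proof -
  interpret T: bounded_linear T by (rule bounded_clinearD[OF T])
  let ?w = "R z y"
  have "y = z *\<^sub>C ?w - op_app D ?w" using D_R[OF z, of y] by (simp add: D_R_def)
  then have "T y = z *\<^sub>C T ?w - op_app D (T ?w)"
    using commute_G_imp_commute_D[of T, OF TG R_in_dom[OF z]]
    by (metis T.diff bounded_clinearD(2)[OF T])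
  then show ?thesis
    using R_D[OF z commute_G_imp_commute_D(1)[of T, OF TG R_in_dom[OF z, of y]]]
    by (simp add: blinfun.diff_right R_scaleC[OF z] D_R_def)
qed

lemma G_clinear: "bounded_clinear G"
  using inverse_D by (simp add: is_bounded_inverse_def bounded_clinear_ops_def)

lemma norm_D_R_le: "z \<in> outer_region \<phi> \<Longrightarrow> norm (D_R z g) \<le> (M + 1) * norm g"
  using resolvent_bound[of z g] norm_triangle_ineq4[of "z *\<^sub>C R z g" g]
  by (simp add: D_R_def algebra_simps)

text \<open>Invertibility of \<open>D\<close> improves the sectorial bound near the origin: since \<open>R(z,D) = D R(z,D) G\<close>,
the resolvent stays bounded as \<open>z\<close> tends to \<open>0\<close> in the outer region. This is why the contour
can run into the origin.\<close>

lemma norm_R_le: "z \<in> outer_region \<phi> \<Longrightarrow> norm (R z y) \<le> (M + 1) * norm G * norm y"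
proof -
  assume z: "z \<in> outer_region \<phi>"
  have "norm (R z y) = norm (D_R z (G y))" using R_D[OF z, of "G y"] by simp
  also have "\<dots> \<le> (M + 1) * norm (G y)" by (rule norm_D_R_le[OF z])
  also have "\<dots> \<le> (M + 1) * (norm G * norm y)"
    using M_nonneg by (intro mult_left_mono norm_blinfun) auto
  finally show ?thesis by simp
qed

text \<open>For \<open>g = a + b\<close> the operator \<open>D R(z,D)\<close> is applied to \<open>a\<close> as a bounded operator and to \<open>b\<close> as
\<open>R(z,D) D b\<close>, which gains the factor \<open>1 / |z|\<close>.\<close>

lemma norm_D_R_le_K:
  assumes z: "z \<in> outer_region \<phi>"
  shows "norm (D_R z g) \<le> (M + 1) * K_functional D (1 / cmod z) g"
proof (rule K_functional_greatest[OF closed_D])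
  have z0: "0 < cmod z" using z by (auto simp: outer_region_def)
  fix a b assume b: "b \<in> op_dom D" and g: "g = a + b"
  have "cmod z * norm (R z (op_app D b)) \<le> M * norm (op_app D b)"
    using resolvent_bound[OF z, of "op_app D b"] by (simp add: norm_scaleC)
  then have "norm (D_R z b) \<le> M * norm (op_app D b) / cmod z"
    using z0 R_D[OF z b] by (simp add: field_simps)
  moreover have "D_R z g = D_R z a + D_R z b"
    by (simp add: g D_R_def blinfun.add_right scaleC_add_right)
  ultimately have "norm (D_R z g) \<le> (M + 1) * norm a + M * norm (op_app D b) / cmod z"
    using norm_triangle_ineq[of "D_R z a" "D_R z b"] norm_D_R_le[OF z, of a] by simp
  also have "\<dots> \<le> (M + 1) * norm a + (M + 1) * (norm b + norm (op_app D b)) / cmod z"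
    using M_nonneg z0 by (intro add_left_mono divide_right_mono mult_mono) auto
  finally show "norm (D_R z g) \<le>
      (M + 1) * (norm a + 1 / cmod z * (norm b + norm (op_app D b)))"
    by (simp add: distrib_left add_divide_distrib)
qed (use M_nonneg in simp)

lemma resolvent_identity:
  assumes z: "z \<in> outer_region \<phi>" and w: "w \<in> outer_region \<phi>"
  shows "R w y - R z y = (w - z) *\<^sub>C (- R w (R z y))"
proof -
  let ?u = "R z y"
  have "y = z *\<^sub>C ?u - op_app D ?u" using D_R[OF z, of y] by (simp add: D_R_def)
  then have "R w y = z *\<^sub>C R w ?u - R w (op_app D ?u)"
    by (metis blinfun.diff_right R_scaleC[OF w])
  also have "R w (op_app D ?u) = w *\<^sub>C R w ?u - ?u"
    using R_D[OF w R_in_dom[OF z, of y]] by (simp add: D_R_def)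
  finally show ?thesis by (simp add: scaleC_diff_left scaleC_minus_right algebra_simps)
qed

lemma R_continuous: "continuous_on (outer_region \<phi>) (\<lambda>z. R z y)"
  unfolding continuous_on_def
proof
  fix z assume z: "z \<in> outer_region \<phi>"
  let ?c = "(M + 1) * norm G * norm (R z y)"
  have "((\<lambda>w. R w y - R z y) \<longlongrightarrow> 0) (at z within outer_region \<phi>)"
  proof (rule Lim_null_comparison)
    show "\<forall>\<^sub>F w in at z within outer_region \<phi>. norm (R w y - R z y) \<le> cmod (w - z) * ?c"
      unfolding eventually_at_filter
      by (rule always_eventually)
        (auto simp: resolvent_identity[OF z] norm_scaleC mult.assoc[symmetric]
          intro!: mult_left_mono norm_R_le)
    show "((\<lambda>w. cmod (w - z) * ?c) \<longlongrightarrow> 0) (at z within outer_region \<phi>)"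
      by (auto intro!: tendsto_eq_intros tendsto_mult_left_zero LIM_zero tendsto_norm_zero)
  qed
  then show "((\<lambda>w. R w y) \<longlongrightarrow> R z y) (at z within outer_region \<phi>)"
    by (simp add: LIM_zero_iff)
qed

lemma R_continuous_compose:
  assumes "continuous_on S w" "S \<subseteq> outer_region \<phi>"
  shows "continuous_on S (\<lambda>z. R z (w z))"
  by (rule continuous_on_bounded_family[where T = "\<lambda>z. R z" and C = "(M + 1) * norm G"])
    (use assms norm_R_le in \<open>auto simp: blinfun.diff_right
      intro: continuous_on_subset[OF R_continuous]\<close>)

lemma R_holomorphic: "(\<lambda>z. R z y) C1_holomorphic_on outer_region \<phi>"
proof (rule C1_holomorphic_from_difference)
  show "R w y - R z y = (w - z) *\<^sub>C (- R w (R z y))"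
    if "z \<in> outer_region \<phi>" "w \<in> outer_region \<phi>" for z w
    using that by (rule resolvent_identity)
  show "continuous_on (outer_region \<phi>) (\<lambda>w. - R w (R z y))" for z
    by (intro continuous_intros R_continuous)
  show "continuous_on (outer_region \<phi>) (\<lambda>z. - R z (R z y))"
    by (intro continuous_intros R_continuous_compose R_continuous) auto
qed

lemma D_R_continuous: "continuous_on (outer_region \<phi>) (\<lambda>z. D_R z g)"
  unfolding D_R_def
  by (intro continuous_intros continuous_on_scaleC R_continuous)

lemma outer_arc_cont: "continuous_on (outer_region \<phi>) q \<Longrightarrow>
    continuous_on {\<phi>..2 * pi - \<phi>} (\<lambda>\<psi>. q (polar s \<psi>))"
  by (erule continuous_on_compose2) (use angle in \<open>auto intro!: continuous_intros polar_outer\<close>)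

lemma inner_arc_cont: "continuous_on (inner_region \<phi>) q \<Longrightarrow>
    continuous_on {- \<phi>..\<phi>} (\<lambda>\<psi>. q (polar s \<psi>))"
  by (erule continuous_on_compose2) (use angle in \<open>auto intro!: continuous_intros polar_inner\<close>)

text \<open>Here the rays are closed outside the sector: on the large arc \<open>z R(z,D) g = g + D R(z,D) g\<close> tends
to \<open>g\<close>, and the arc has opening \<open>2 \<pi> - 2 \<phi>\<close>; on the small arc the integrand vanishes.\<close>

lemma ray_integral_resolvent_tendsto:
  assumes \<delta>: "0 < \<delta>"
    and decay: "\<And>z s. z \<in> outer_region \<phi> \<Longrightarrow> cmod z = exp s \<Longrightarrow> 0 \<le> s \<Longrightarrow>
      norm (D_R z g) \<le> c * exp (- \<delta> * s)"
  shows "(\<lambda>n. ray_integral \<phi> (- real n) (real n) (\<lambda>z. z *\<^sub>C R z g))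
    \<longlonglongrightarrow> (\<i> * of_real (2 * pi - 2 * \<phi>)) *\<^sub>C g"
proof -
  let ?q = "\<lambda>z. z *\<^sub>C R z g"
  let ?arc = "\<lambda>q s. integral {\<phi>..2 * pi - \<phi>} (\<lambda>\<psi>. q (polar s \<psi>))"
  have hol: "?q C1_holomorphic_on outer_region \<phi>"
    by (rule C1_holomorphic_scaleC_ident[OF R_holomorphic])
  have qcont: "continuous_on (outer_region \<phi>) ?q"
    by (rule C1_holomorphic_imp_continuous[OF hol])
  have le: "\<phi> \<le> 2 * pi - \<phi>" using angle by simp
  have S: "polar s \<psi> \<in> outer_region \<phi>" if "\<psi> \<in> {\<phi>..2 * pi - \<phi>}" for s \<psi>
    using that angle by (intro polar_outer) auto
  have far: "(\<lambda>n. ?arc (\<lambda>z. D_R z g) (real n)) \<longlonglongrightarrow> 0"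
  proof (rule arc_tendsto_0[OF D_R_continuous le \<delta> S])
    show "norm (D_R z g) \<le> c * exp (- \<delta> * real n)"
      if "z \<in> outer_region \<phi>" "cmod z = exp (real n)" for z n
      using decay[OF that] by simp
  qed simp_all
  have near: "(\<lambda>n. ?arc ?q (- real n)) \<longlonglongrightarrow> 0"
  proof (rule arc_tendsto_0[OF qcont le _ S])
    fix z n assume z: "z \<in> outer_region \<phi>" "cmod z = exp (- real n)"
    show "norm (?q z) \<le> (M + 1) * norm G * norm g * exp (- 1 * real n)"
      using mult_right_mono[OF norm_R_le[OF z(1), of g], of "exp (- real n)"] z(2)
      by (simp add: norm_scaleC mult.commute)
  qed simp_all
  have eq: "ray_integral \<phi> (- real n) (real n) ?q =
      \<i> *\<^sub>C (?arc (\<lambda>z. D_R z g) (real n) + (2 * pi - 2 * \<phi>) *\<^sub>R g - ?arc ?q (- real n))" for n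
  proof -
    have "ray_integral \<phi> (- real n) (real n) ?q =
        \<i> *\<^sub>C integral {\<phi>..2 * pi - \<phi>} (\<lambda>\<psi>. ?q (polar (real n) \<psi>) - ?q (polar (- real n) \<psi>))"
      by (rule ray_integral_outer[OF hol angle_le]) simp
    also have "integral {\<phi>..2 * pi - \<phi>} (\<lambda>\<psi>. ?q (polar (real n) \<psi>) - ?q (polar (- real n) \<psi>)) =
        ?arc ?q (real n) - ?arc ?q (- real n)"
      by (intro integral_diff integrable_continuous_real outer_arc_cont[OF qcont])
    also have "?arc ?q (real n) = integral {\<phi>..2 * pi - \<phi>} (\<lambda>\<psi>. D_R (polar (real n) \<psi>) g + g)"
      by (simp add: D_R_def)
    also have "\<dots> = ?arc (\<lambda>z. D_R z g) (real n) + (2 * pi - 2 * \<phi>) *\<^sub>R g"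
      using le by (subst integral_add)
        (auto intro: integrable_continuous_real outer_arc_cont[OF D_R_continuous])
    finally show ?thesis .
  qed
  have "(\<lambda>n. ray_integral \<phi> (- real n) (real n) ?q) \<longlonglongrightarrow>
      \<i> *\<^sub>C (0 + (2 * pi - 2 * \<phi>) *\<^sub>R g - 0)"
    unfolding eq by (intro tendsto_scaleC tendsto_intros far near)
  then show ?thesis
    by (simp add: scaleC_of_real[symmetric] scaleC_scaleC del: of_real_diff of_real_mult)
qed

end

section \<open>Contour integrals of operator-valued symbols\<close>

text \<open>The common features of the families \<open>\<lambda>\<^sup>2 H(\<lambda>)\<close> and \<open>\<lambda> B H(\<lambda>)\<close>, which yield \<open>D\<^sup>2 u\<close> and
\<open>B D u\<close>. In the vanishing at the origin the constant depends on the vector, because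
\<open>\<lambda> B H(\<lambda>)\<close> is controlled there by comparison with the vector \<open>B H(0) x\<close>.\<close>

locale sectorial_symbol = sectorial_inverse +
  fixes T :: "complex \<Rightarrow> 'a \<Rightarrow> 'a" and C :: real
  assumes T_clinear: "z \<in> inner_region \<phi> \<Longrightarrow> bounded_clinear (T z)"
    and T_bound: "z \<in> inner_region \<phi> \<Longrightarrow> norm (T z x) \<le> C * norm x"
    and C_nonneg: "0 \<le> C"
    and T_G: "z \<in> inner_region \<phi> \<Longrightarrow> T z (G x) = G (T z x)"
    and T_holomorphic: "(\<lambda>z. T z x) C1_holomorphic_on inner_region \<phi>"
    and T_vanishes_at_0: "\<exists>c. \<forall>z\<in>inner_region \<phi>. cmod z \<le> 1 \<longrightarrow> norm (T z x) \<le> c * cmod z"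
begin

lemma T_diff: "z \<in> inner_region \<phi> \<Longrightarrow> T z (x - y) = T z x - T z y"
  and T_add: "z \<in> inner_region \<phi> \<Longrightarrow> T z (x + y) = T z x + T z y"
  using linear_diff linear_add bounded_linear.linear bounded_clinearD(1)[OF T_clinear] by blast+

lemma T_continuous_compose:
  assumes "continuous_on S w" "S \<subseteq> inner_region \<phi>"
  shows "continuous_on S (\<lambda>z. T z (w z))"
  by (rule continuous_on_bounded_family[where T = T and C = C])
    (use assms T_bound T_diff in
      \<open>auto intro: continuous_on_subset[OF C1_holomorphic_imp_continuous[OF T_holomorphic]]\<close>)

definition symbol_integrand :: "'a \<Rightarrow> complex \<Rightarrow> 'a" where
  "symbol_integrand g z = T z (D_R z g)"

lemma symbol_integrand_continuous: "continuous_on (rays \<phi>) (symbol_integrand g)"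
  unfolding symbol_integrand_def
  by (intro T_continuous_compose continuous_on_subset[OF D_R_continuous]) auto

lemma norm_symbol_integrand_le_K:
  assumes "z \<in> rays \<phi>"
  shows "norm (symbol_integrand g z) \<le> C * (M + 1) * K_functional D (1 / cmod z) g"
proof -
  have "norm (symbol_integrand g z) \<le> C * norm (D_R z g)"
    unfolding symbol_integrand_def using assms T_bound by blast
  also have "\<dots> \<le> C * ((M + 1) * K_functional D (1 / cmod z) g)"
    using assms by (intro mult_left_mono norm_D_R_le_K C_nonneg) auto
  finally show ?thesis by simp
qed

text \<open>The first summand lies in the domain of \<open>D\<close> (it is in the range of \<open>G\<close>); the second is
holomorphic in the whole sector, so its contour can be moved.\<close>

lemma symbol_integrand_split:
  assumes "z \<in> rays \<phi>"
  shows "symbol_integrand g z = G (z *\<^sub>C symbol_integrand g z) - T z g"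
proof -
  have "symbol_integrand g z = T z (z *\<^sub>C R z g) - T z g"
    unfolding symbol_integrand_def D_R_def using T_diff assms by auto
  also have "T z (z *\<^sub>C R z g) = z *\<^sub>C T z (G (D_R z g))"
    using assms G_D_R bounded_clinearD(2)[OF T_clinear] by auto
  also have "\<dots> = G (z *\<^sub>C symbol_integrand g z)"
    using assms T_G bounded_clinearD(2)[OF G_clinear] by (auto simp: symbol_integrand_def)
  finally show ?thesis .
qed

text \<open>Outwards the decay comes from the K-functional of \<open>g\<close>, inwards from the two summands of
\<open>symbol_integrand_split\<close>, each of which carries a factor \<open>|z|\<close>.\<close>

lemma symbol_integrand_decay:
  assumes \<theta>: "0 < \<theta>" "\<theta> < 1" and c: "0 \<le> c" "\<And>t. 0 < t \<Longrightarrow> K_functional D t g \<le> c * t powr \<theta>"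
  obtains b where "\<And>z s. z \<in> rays \<phi> \<Longrightarrow> cmod z = exp s \<Longrightarrow>
      norm (symbol_integrand g z) \<le> b * exp (- \<theta> * \<bar>s\<bar>)"
proof -
  obtain d where d: "\<And>z. z \<in> inner_region \<phi> \<Longrightarrow> cmod z \<le> 1 \<Longrightarrow> norm (T z g) \<le> d * cmod z"
    using T_vanishes_at_0 by blast
  let ?e = "norm G * (C * ((M + 1) * norm g))"
  let ?b = "max (?e + max d 0) (C * (M + 1) * c)"
  show thesis
  proof (rule that[of ?b])
    fix z s assume z: "z \<in> rays \<phi>" and zs: "cmod z = exp s"
    show "norm (symbol_integrand g z) \<le> ?b * exp (- \<theta> * \<bar>s\<bar>)"
    proof (cases "0 \<le> s")
      case True
      have "norm (symbol_integrand g z) \<le> C * (M + 1) * K_functional D (1 / cmod z) g"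
        by (rule norm_symbol_integrand_le_K[OF z])
      also have "\<dots> \<le> C * (M + 1) * (c * (1 / cmod z) powr \<theta>)"
        using C_nonneg M_nonneg zs by (intro mult_left_mono c) auto
      also have "(1 / cmod z) powr \<theta> = exp (- \<theta> * \<bar>s\<bar>)"
        using True by (simp add: zs powr_def ln_div)
      also have "C * (M + 1) * (c * exp (- \<theta> * \<bar>s\<bar>)) = C * (M + 1) * c * exp (- \<theta> * \<bar>s\<bar>)" by simp
      also have "\<dots> \<le> ?b * exp (- \<theta> * \<bar>s\<bar>)"
        by (intro mult_right_mono) auto
      finally show ?thesis .
    next
      case False
      then have z1: "cmod z \<le> 1" by (simp add: zs)
      have "norm (symbol_integrand g z) \<le> norm (G (z *\<^sub>C symbol_integrand g z)) + norm (T z g)"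
        using symbol_integrand_split[OF z, of g] norm_triangle_ineq4 by metis
      also have "norm (G (z *\<^sub>C symbol_integrand g z)) \<le> norm G * (cmod z * norm (symbol_integrand g z))"
        using norm_blinfun[of G "z *\<^sub>C symbol_integrand g z"] by (simp add: norm_scaleC)
      also have "\<dots> \<le> norm G * (cmod z * (C * ((M + 1) * norm g)))"
      proof -
        have "norm (symbol_integrand g z) \<le> C * norm (D_R z g)"
          unfolding symbol_integrand_def using z T_bound by blast
        also have "\<dots> \<le> C * ((M + 1) * norm g)"
          using z C_nonneg by (intro mult_left_mono norm_D_R_le) auto
        finally show ?thesis by (intro mult_left_mono) auto
      qed
      also have "norm (T z g) \<le> max d 0 * cmod z"
        by (rule order_trans[OF d mult_right_mono]) (use z z1 in auto)
      also have "norm G * (cmod z * (C * ((M + 1) * norm g))) + max d 0 * cmod z =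
          (?e + max d 0) * exp s" by (simp add: zs algebra_simps)
      also have "\<dots> \<le> ?b * exp (- \<theta> * \<bar>s\<bar>)"
      proof (rule mult_mono)
        have "\<theta> * (- s) \<le> - s" using False \<theta> mult_right_mono[of \<theta> 1 "- s"] by simp
        then show "exp s \<le> exp (- \<theta> * \<bar>s\<bar>)" using False by simp
        show "0 \<le> ?b" using C_nonneg M_nonneg c by (intro max.coboundedI2) auto
      qed auto
      finally show ?thesis by simp
    qed
  qed
qed

lemma symbol_integral_converges:
  assumes "0 < \<theta>" "\<theta> < 1" "0 \<le> c" "\<And>t. 0 < t \<Longrightarrow> K_functional D t g \<le> c * t powr \<theta>"
  shows "\<exists>v. \<forall>\<sigma>. (\<lambda>n. ray_integral \<phi> (\<sigma> - real n) (\<sigma> + real n) (symbol_integrand g)) \<longlonglongrightarrow> v"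
proof -
  obtain b where b: "\<And>z s. z \<in> rays \<phi> \<Longrightarrow> cmod z = exp s \<Longrightarrow>
      norm (symbol_integrand g z) \<le> b * exp (- \<theta> * \<bar>s\<bar>)"
    using symbol_integrand_decay[OF assms] by blast
  show ?thesis
  proof (rule exp_decay_improper_integral)
    show "continuous_on UNIV (ray_diff \<phi> (symbol_integrand g))"
      by (rule continuous_on_ray_diff[OF symbol_integrand_continuous angle_le])
    show "norm (ray_diff \<phi> (symbol_integrand g) s) \<le> 2 * b * exp (- \<theta> * \<bar>s\<bar>)" for s
    proof -
      have "norm (ray_diff \<phi> (symbol_integrand g) s) \<le> 2 * (b * exp (- \<theta> * \<bar>s\<bar>))"
        by (rule norm_ray_diff_le[OF b angle_le])
      then show ?thesis by simp
    qed
  qed (use assms in simp)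
qed

lemma symbol_arc_tendsto_0:
  "(\<lambda>n. integral {- \<phi>..\<phi>} (\<lambda>\<psi>. T (polar (\<sigma> - real n) \<psi>) g)) \<longlonglongrightarrow> 0"
proof -
  obtain d where d: "\<And>z. z \<in> inner_region \<phi> \<Longrightarrow> cmod z \<le> 1 \<Longrightarrow> norm (T z g) \<le> d * cmod z"
    using T_vanishes_at_0 by blast
  show ?thesis
  proof (rule Lim_null_comparison)
    show "(\<lambda>n. d * exp (\<sigma> - real n) * (\<phi> - - \<phi>)) \<longlonglongrightarrow> 0"
      using tendsto_exp_decay_nat[of 1 "d * exp \<sigma>" "\<phi> - - \<phi>"]
      by (simp add: exp_diff exp_minus divide_inverse mult_ac)
    show "\<forall>\<^sub>F n in sequentially. norm (integral {- \<phi>..\<phi>} (\<lambda>\<psi>. T (polar (\<sigma> - real n) \<psi>) g))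
        \<le> d * exp (\<sigma> - real n) * (\<phi> - - \<phi>)"
      using eventually_ge_at_top[of "nat \<lceil>\<sigma>\<rceil>"]
    proof eventually_elim
      case (elim n)
      then have "\<sigma> \<le> real n" by linarith
      then have "norm (T z g) \<le> d * exp (\<sigma> - real n)"
        if "z \<in> inner_region \<phi>" "cmod z = exp (\<sigma> - real n)" for z
        using d[OF that(1)] that(2) by simp
      then show ?case
        by (intro norm_arc_integral_le[OF C1_holomorphic_imp_continuous[OF T_holomorphic]])
          (use angle in \<open>auto intro!: polar_inner\<close>)
    qed
  qed
qed

text \<open>The arc integral is a bounded operator that commutes with \<open>D\<close>, uniformly in the radius.\<close>

lemma symbol_arc_K_bound:
  assumes "0 \<le> t"
  shows "K_functional D t (\<i> *\<^sub>C integral {- \<phi>..\<phi>} (\<lambda>\<psi>. T (polar \<sigma> \<psi>) g))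
    \<le> (C * (2 * \<phi>)) * K_functional D t g"
proof (rule K_functional_bounded_map[OF closed_D assms])
  have inner: "polar \<sigma> \<psi> \<in> inner_region \<phi>" if "\<psi> \<in> {- \<phi>..\<phi>}" for \<psi>
    using that angle by (intro polar_inner) auto
  have cont: "continuous_on {- \<phi>..\<phi>} (\<lambda>\<psi>. T (polar \<sigma> \<psi>) x)" for x
    by (rule continuous_on_compose2[OF C1_holomorphic_imp_continuous[OF T_holomorphic]])
      (use inner in \<open>auto intro!: continuous_intros\<close>)
  let ?J = "\<lambda>x. \<i> *\<^sub>C integral {- \<phi>..\<phi>} (\<lambda>\<psi>. T (polar \<sigma> \<psi>) x)"
  show "?J (x + y) = ?J x + ?J y" for x y
  proof -
    have "integral {- \<phi>..\<phi>} (\<lambda>\<psi>. T (polar \<sigma> \<psi>) (x + y)) =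
        integral {- \<phi>..\<phi>} (\<lambda>\<psi>. T (polar \<sigma> \<psi>) x + T (polar \<sigma> \<psi>) y)"
      by (rule integral_cong) (rule T_add[OF inner])
    then show ?thesis
      by (simp add: integral_add integrable_continuous_real cont scaleC_add_right)
  qed
  show "norm (?J x) \<le> C * (2 * \<phi>) * norm x" for x
  proof -
    have "norm (integral {- \<phi>..\<phi>} (\<lambda>\<psi>. T (polar \<sigma> \<psi>) x)) \<le> (C * norm x) * (\<phi> - - \<phi>)"
      by (rule norm_arc_integral_le[OF C1_holomorphic_imp_continuous[OF T_holomorphic] inner])
        (use angle T_bound in auto)
    then show ?thesis by (simp add: norm_scaleC algebra_simps)
  qed
  have "?J (G x) = G (?J x)" for x
  proof -
    have "integral {- \<phi>..\<phi>} (\<lambda>\<psi>. T (polar \<sigma> \<psi>) (G x)) =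
        integral {- \<phi>..\<phi>} (\<lambda>\<psi>. G (T (polar \<sigma> \<psi>) x))"
      by (rule integral_cong) (rule T_G[OF inner])
    also have "\<dots> = G (integral {- \<phi>..\<phi>} (\<lambda>\<psi>. T (polar \<sigma> \<psi>) x))"
      using integral_linear[OF integrable_continuous_real[OF cont] blinfun.bounded_linear_right]
      by (simp add: o_def)
    finally show ?thesis by (simp add: bounded_clinearD(2)[OF G_clinear])
  qed
  then show "?J b \<in> op_dom D \<and> op_app D (?J b) = ?J (op_app D b)" if "b \<in> op_dom D" for b
    using commute_G_imp_commute_D[of ?J, OF _ that] by blast
qed (use C_nonneg angle in simp)

text \<open>With \<open>t = exp (- \<sigma>)\<close> the contour is cut at \<open>\<sigma>\<close>. The part \<open>a\<close> beyond the cut is estimated in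
\<open>X\<close>; below it, \<open>G d\<close> is estimated in the domain of \<open>D\<close>, and the difference of the arcs \<open>J\<close>
replaces the integral of \<open>T(z) g\<close>. Estimated directly, this last integral would cost a
logarithm of \<open>t\<close>.\<close>

theorem symbol_integral_in_interp_space:
  assumes \<theta>: "0 < \<theta>" "\<theta> < 1" and p: "1 \<le> p" and g: "g \<in> interp_space D \<theta> p"
    and lim: "\<And>\<sigma>. (\<lambda>n. ray_integral \<phi> (\<sigma> - real n) (\<sigma> + real n) (symbol_integrand g)) \<longlonglongrightarrow> v"
  shows "v \<in> interp_space D \<theta> p"
proof -
  let ?q = "symbol_integrand g" and ?K = "\<lambda>t. K_functional D t g"
  define k where "k = 2 * (C * (M + 1))"
  have k0: "0 \<le> k" using C_nonneg M_nonneg by (simp add: k_def)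
  note qcont = symbol_integrand_continuous[of g]
  have rcont: "continuous_on (rays \<phi>) (\<lambda>z. z *\<^sub>C ?q z)"
    by (intro continuous_on_scaleC continuous_intros qcont)
  note dcont = continuous_on_ray_diff[OF _ angle_le]
  define c where "c = k + (norm G + 1) * (k * exp 1) + C * (2 * \<phi>)"
  have c0: "0 \<le> c" unfolding c_def using k0 C_nonneg angle by simp
  show ?thesis
  proof (rule interp_space_Hardy[OF closed_D closed_D \<theta> p c0 g])
    fix t S :: real
    assume t: "0 < t" and S: "\<And>N. (\<Sum>j<N. ?K (exp (- real j) * t) + exp (- real j) * ?K (exp (real j) * t)) \<le> S"
    have Knn: "0 \<le> ?K (a * t)" if "0 \<le> a" for a
      using K_functional_nonneg[OF closed_D] that t by simp
    define \<sigma> where "\<sigma> = - ln t"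
    have t\<sigma>: "t = exp (- \<sigma>)" using t by (simp add: \<sigma>_def)
    have ray_bound: "norm (ray_diff \<phi> ?q s) \<le> k * ?K (exp (- s))" for s
      using norm_ray_diff_le[of \<phi> s ?q "C * (M + 1) * ?K (exp (- s))", OF _ angle_le]
        norm_symbol_integrand_le_K[of _ g] by (force simp: k_def exp_minus inverse_eq_divide)
    define a where "a N = ray_integral \<phi> \<sigma> (\<sigma> + real N) ?q" for N
    define d where "d N = ray_integral \<phi> (\<sigma> - real N) \<sigma> (\<lambda>z. z *\<^sub>C ?q z)" for N
    define J where "J s = \<i> *\<^sub>C integral {- \<phi>..\<phi>} (\<lambda>\<psi>. T (polar s \<psi>) g)" for s
    have a_bound: "norm (a N) \<le> k * S" for N
    proof -
      have "norm (a N) \<le> (\<Sum>j<N. k * ?K (exp (- real j) * t))"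
        unfolding a_def
      proof (rule norm_integral_le_sum_right[OF dcont[OF qcont]])
        fix j s assume "\<sigma> + real j \<le> s"
        then have "?K (exp (- s)) \<le> ?K (exp (- real j) * t)"
          by (intro K_functional_mono[OF closed_D]) (auto simp: t\<sigma> mult_exp_exp)
        then show "norm (ray_diff \<phi> ?q s) \<le> k * ?K (exp (- real j) * t)"
          using ray_bound[of s] mult_left_mono[OF _ k0] order_trans by blast
      qed
      also have "\<dots> = k * (\<Sum>j<N. ?K (exp (- real j) * t))" by (simp add: sum_distrib_left)
      also have "\<dots> \<le> k * S"
        by (intro mult_left_mono[OF order_trans[OF sum_mono S] k0]) (simp add: Knn)
      finally show ?thesis .
    qed
    have d_bound: "t * norm (d N) \<le> k * exp 1 * S" for N
    proof -
      have "norm (d N) \<le> (\<Sum>j<N. k * (exp (\<sigma> - real j) * ?K (exp (real (Suc j)) * t)))"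
        unfolding d_def
      proof (rule norm_integral_le_sum_left[OF dcont[OF rcont]])
        fix j s assume s: "\<sigma> - real j - 1 \<le> s" "s \<le> \<sigma> - real j"
        have "norm (z *\<^sub>C ?q z) \<le> exp s * (C * (M + 1) * ?K (exp (- s)))"
          if "z \<in> rays \<phi>" "cmod z = exp s" for z
          using norm_symbol_integrand_le_K[OF that(1), of g] that(2)
          by (simp add: norm_scaleC exp_minus inverse_eq_divide)
        from norm_ray_diff_le[of \<phi> s "\<lambda>z. z *\<^sub>C ?q z", OF this angle_le]
        have "norm (ray_diff \<phi> (\<lambda>z. z *\<^sub>C ?q z) s) \<le> k * (exp s * ?K (exp (- s)))"
          by (simp only: k_def mult_ac)
        also have "exp s * ?K (exp (- s)) \<le> exp (\<sigma> - real j) * ?K (exp (real (Suc j)) * t)"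
          using s K_functional_nonneg[OF closed_D, of "exp (- s)" g]
          by (intro mult_mono K_functional_mono[OF closed_D]) (auto simp: t\<sigma> mult_exp_exp)
        finally show "norm (ray_diff \<phi> (\<lambda>z. z *\<^sub>C ?q z) s) \<le>
            k * (exp (\<sigma> - real j) * ?K (exp (real (Suc j)) * t))"
          using k0 by (simp add: mult_left_mono)
      qed
      then have "t * norm (d N) \<le> t * (\<Sum>j<N. k * (exp (\<sigma> - real j) * ?K (exp (real (Suc j)) * t)))"
        using t by (intro mult_left_mono) auto
      also have "\<dots> = k * exp 1 * (\<Sum>j<N. exp (- real (Suc j)) * ?K (exp (real (Suc j)) * t))"
      proof -
        have "t * (k * (exp (\<sigma> - real j) * ?K (exp (real (Suc j)) * t))) =
            k * exp 1 * (exp (- real (Suc j)) * ?K (exp (real (Suc j)) * t))" for j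
        proof -
          have "t * exp (\<sigma> - real j) = exp 1 * exp (- real (Suc j))"
            by (simp add: t\<sigma> mult_exp_exp)
          then show ?thesis by (metis (no_types, opaque_lifting) mult.assoc mult.left_commute)
        qed
        then show ?thesis by (simp only: sum_distrib_left)
      qed
      also have "\<dots> \<le> k * exp 1 * S"
      proof (rule mult_left_mono)
        have "(\<Sum>j<N. exp (- real (Suc j)) * ?K (exp (real (Suc j)) * t)) \<le>
            (\<Sum>j<Suc N. ?K (exp (- real j) * t) + exp (- real j) * ?K (exp (real j) * t))"
        proof -
          have "(\<Sum>j<N. exp (- real (Suc j)) * ?K (exp (real (Suc j)) * t)) \<le>
              (\<Sum>j<N. ?K (exp (- real (Suc j)) * t) + exp (- real (Suc j)) * ?K (exp (real (Suc j)) * t))"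
            by (intro sum_mono) (simp only: le_add_same_cancel2 Knn exp_ge_zero)
          moreover have "0 \<le> ?K (exp (- real 0) * t) + exp (- real 0) * ?K (exp (real 0) * t)"
            using Knn[of 1] by simp
          ultimately show ?thesis unfolding sum.lessThan_Suc_shift by linarith
        qed
        then show "(\<Sum>j<N. exp (- real (Suc j)) * ?K (exp (real (Suc j)) * t)) \<le> S"
          using S order_trans by blast
      qed (use k0 in simp)
      finally show ?thesis .
    qed
    have split: "ray_integral \<phi> (\<sigma> - real N) (\<sigma> + real N) ?q = a N + G (d N) + J \<sigma> - J (\<sigma> - real N)" for N
    proof -
      have "ray_integral \<phi> (\<sigma> - real N) (\<sigma> + real N) ?q = ray_integral \<phi> (\<sigma> - real N) \<sigma> ?q + a N"
        unfolding a_def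
        by (rule Henstock_Kurzweil_Integration.integral_combine[symmetric]) (auto intro: integrable_continuous_real dcont[OF qcont])
      also have "ray_integral \<phi> (\<sigma> - real N) \<sigma> ?q =
          ray_integral \<phi> (\<sigma> - real N) \<sigma> (\<lambda>z. G (z *\<^sub>C ?q z) - T z g)"
        by (rule ray_integral_cong[OF symbol_integrand_split angle_le])
      also have "\<dots> = ray_integral \<phi> (\<sigma> - real N) \<sigma> (\<lambda>z. G (z *\<^sub>C ?q z)) - ray_integral \<phi> (\<sigma> - real N) \<sigma> (\<lambda>z. T z g)"
        by (rule ray_integral_diff[OF _ _ angle_le])
          (auto intro: continuous_on_subset[OF C1_holomorphic_imp_continuous[OF T_holomorphic]]
            bounded_linear.continuous_on[OF blinfun.bounded_linear_right rcont])
      also have "ray_integral \<phi> (\<sigma> - real N) \<sigma> (\<lambda>z. G (z *\<^sub>C ?q z)) = G (d N)"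
        unfolding d_def
        by (rule bounded_linear_ray_integral[symmetric, OF blinfun.bounded_linear_right rcont angle_le])
      also have "ray_integral \<phi> (\<sigma> - real N) \<sigma> (\<lambda>z. T z g) = J (\<sigma> - real N) - J \<sigma>"
      proof -
        have "continuous_on {- \<phi>..\<phi>} (\<lambda>\<psi>. T (polar s \<psi>) g)" for s
          by (rule continuous_on_compose2[OF C1_holomorphic_imp_continuous[OF T_holomorphic]])
            (use angle in \<open>auto intro!: continuous_intros polar_inner\<close>)
        then have "integral {- \<phi>..\<phi>} (\<lambda>\<psi>. T (polar \<sigma> \<psi>) g - T (polar (\<sigma> - real N) \<psi>) g) =
            integral {- \<phi>..\<phi>} (\<lambda>\<psi>. T (polar \<sigma> \<psi>) g) - integral {- \<phi>..\<phi>} (\<lambda>\<psi>. T (polar (\<sigma> - real N) \<psi>) g)"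
          by (intro integral_diff integrable_continuous_real)
        with ray_integral_inner[OF T_holomorphic angle_le, of "\<sigma> - real N" \<sigma> g] show ?thesis
          by (simp add: J_def scaleC_diff_right)
      qed
      finally show ?thesis by simp
    qed
    have K_approx: "K_functional D t v \<le> c * S +
        (norm (v - ray_integral \<phi> (\<sigma> - real N) (\<sigma> + real N) ?q) + norm (J (\<sigma> - real N)))" for N
    proof -
      let ?e = "v - ray_integral \<phi> (\<sigma> - real N) (\<sigma> + real N) ?q"
      have v: "v = ((?e - J (\<sigma> - real N)) + a N) + (G (d N) + J \<sigma>)"
        by (simp add: split)
      have t0: "0 \<le> t" using t by simp
      have "K_functional D t v \<le> K_functional D t ((?e - J (\<sigma> - real N)) + a N)
          + (K_functional D t (G (d N)) + K_functional D t (J \<sigma>))"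
        by (subst v) (intro order_trans[OF K_functional_add[OF closed_D t0]] add_left_mono
            K_functional_add[OF closed_D t0])
      moreover have "K_functional D t ((?e - J (\<sigma> - real N)) + a N) \<le> norm ?e + norm (J (\<sigma> - real N)) + k * S"
        using K_functional_le_norm[OF closed_D t0, of "(?e - J (\<sigma> - real N)) + a N"]
          norm_triangle_ineq[of "?e - J (\<sigma> - real N)" "a N"]
          norm_triangle_ineq4[of ?e "J (\<sigma> - real N)"] a_bound[of N] by linarith
      moreover have "K_functional D t (G (d N)) \<le> (norm G + 1) * (k * exp 1 * S)"
      proof -
        have "K_functional D t (G (d N)) \<le> t * (norm (G (d N)) + norm (d N))"
          using K_functional_le[OF t0, of "G (d N)" D 0] by simp
        also have "\<dots> \<le> t * (norm G * norm (d N) + norm (d N))"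
          using t0 by (intro mult_left_mono add_right_mono norm_blinfun)
        also have "\<dots> = (norm G + 1) * (t * norm (d N))" by (simp add: algebra_simps)
        also have "\<dots> \<le> (norm G + 1) * (k * exp 1 * S)"
          by (intro mult_left_mono d_bound) simp
        finally show ?thesis .
      qed
      moreover have "K_functional D t (J \<sigma>) \<le> C * (2 * \<phi>) * S"
      proof -
        have "?K t \<le> S" using S[of 1] Knn[of 1] by simp
        then have "C * (2 * \<phi>) * ?K t \<le> C * (2 * \<phi>) * S"
          using C_nonneg angle by (intro mult_left_mono) auto
        with symbol_arc_K_bound[OF t0, of \<sigma> g] show ?thesis
          unfolding J_def by (rule order_trans)
      qed
      ultimately show ?thesis by (simp add: c_def algebra_simps)
    qed
    have "(\<lambda>N. norm (J (\<sigma> - real N))) \<longlonglongrightarrow> 0"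
      unfolding J_def norm_scaleC
      using tendsto_norm_zero[OF symbol_arc_tendsto_0[of \<sigma> g]] by simp
    moreover have "(\<lambda>N. norm (v - ray_integral \<phi> (\<sigma> - real N) (\<sigma> + real N) ?q)) \<longlonglongrightarrow> 0"
      using tendsto_norm[OF tendsto_diff[OF tendsto_const[of v] lim[of \<sigma>]]] by simp
    ultimately have "(\<lambda>N. c * S + (norm (v - ray_integral \<phi> (\<sigma> - real N) (\<sigma> + real N) ?q)
        + norm (J (\<sigma> - real N)))) \<longlonglongrightarrow> c * S + (0 + 0)"
      by (intro tendsto_add tendsto_const)
    then have "K_functional D t v \<le> c * S + (0 + 0)"
      by (rule tendsto_lowerbound) (use K_approx in auto)
    then show "K_functional D t v \<le> c * S" by simp
  qed
qed

end

section \<open>The quadratic operator pencil\<close>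

lemma full_circle_scaleC:
  "(\<i> * of_real (2 * pi - 2 * \<phi>)) *\<^sub>C x + \<i> *\<^sub>C ((2 * \<phi>) *\<^sub>R x) = (of_real (2 * pi) * \<i>) *\<^sub>C x"
proof -
  have "\<i> *\<^sub>C ((2 * \<phi>) *\<^sub>R x) = (\<i> * of_real (2 * \<phi>)) *\<^sub>C x"
    by (metis scaleC_of_real scaleC_scaleC)
  moreover have "\<i> * of_real (2 * pi - 2 * \<phi>) + \<i> * of_real (2 * \<phi>) = of_real (2 * pi) * \<i>"
    by (simp add: algebra_simps)
  ultimately show ?thesis by (metis scaleC_add_left)
qed

text \<open>The hypotheses on the pencil. The origin belongs to the set where the pencil is inverted, since
\<open>H(0)\<close> is the reference for the behaviour of \<open>H\<close> and \<open>B H\<close> near it.\<close>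

locale quadratic_pencil = sectorial_inverse +
  fixes A B :: "'a operator" and H :: "complex \<Rightarrow> 'a \<Rightarrow>\<^sub>L 'a" and C :: real
  assumes closed_A: "closed_operator A" and closed_B: "closed_operator B"
    and A_commutes: "commutes_with A D" and B_commutes: "commutes_with B D"
    and pencil_inverse: "z \<in> insert 0 (inner_region \<phi>) \<Longrightarrow>
      is_bounded_inverse (z\<^sup>2 \<cdot>\<^sub>o\<^sub>p op_id +\<^sub>o\<^sub>p z \<cdot>\<^sub>o\<^sub>p B +\<^sub>o\<^sub>p A) (H z)"
    and H_bound: "z \<in> inner_region \<phi> \<Longrightarrow> norm (H z x) \<le> C * norm x"
    and zzH_bound: "z \<in> inner_region \<phi> \<Longrightarrow> norm (z\<^sup>2 *\<^sub>C H z x) \<le> C * norm x"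
    and zBH_clinear: "z \<in> inner_region \<phi> \<Longrightarrow> bounded_clinear (\<lambda>x. z *\<^sub>C op_app B (H z x))"
    and zBH_bound: "z \<in> inner_region \<phi> \<Longrightarrow> norm (z *\<^sub>C op_app B (H z x)) \<le> C * norm x"
    and C_nonneg: "0 \<le> C"
begin

definition BH :: "complex \<Rightarrow> 'a \<Rightarrow> 'a" where
  "BH z x = op_app B (H z x)"

lemma
  assumes z: "z \<in> insert 0 (inner_region \<phi>)"
  shows H_in_dom: "H z y \<in> op_dom A" "H z y \<in> op_dom B"
    and pencil_H: "z\<^sup>2 *\<^sub>C H z y + z *\<^sub>C BH z y + op_app A (H z y) = y"
    and H_pencil: "x \<in> op_dom A \<Longrightarrow> x \<in> op_dom B \<Longrightarrow>
      H z (z\<^sup>2 *\<^sub>C x + z *\<^sub>C op_app B x + op_app A x) = x"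
  using pencil_inverse[OF z]
  by (simp_all add: is_bounded_inverse_def op_add_def op_scale_def op_id_def BH_def)

lemma H_clinear: "z \<in> insert 0 (inner_region \<phi>) \<Longrightarrow> bounded_clinear (H z)"
  using pencil_inverse by (auto simp: is_bounded_inverse_def bounded_clinear_ops_def)

lemmas H_scaleC = bounded_clinearD(2)[OF H_clinear]

lemma commutes_with_D_imp_G:
  assumes "commutes_with E D" "x \<in> op_dom E"
  shows "G x \<in> op_dom E" "op_app E (G x) = G (op_app E x)"
proof -
  have "G x \<in> op_dom (E \<circ>\<^sub>o\<^sub>p D)" using assms(2) by (simp add: op_comp_def)
  then have "G x \<in> op_dom (D \<circ>\<^sub>o\<^sub>p E)" "op_app (D \<circ>\<^sub>o\<^sub>p E) (G x) = op_app (E \<circ>\<^sub>o\<^sub>p D) (G x)"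
    using assms(1) by (auto simp: commutes_with_def op_extends_def)
  then have *: "G x \<in> op_dom E" "op_app E (G x) \<in> op_dom D" "op_app D (op_app E (G x)) = op_app E x"
    by (auto simp: op_comp_def)
  then show "G x \<in> op_dom E" by simp
  show "op_app E (G x) = G (op_app E x)" using G_D[OF *(2)] *(3) by simp
qed

lemma H_G:
  assumes z: "z \<in> insert 0 (inner_region \<phi>)"
  shows "H z (G y) = G (H z y)"
proof -
  let ?x = "H z y"
  note dA = commutes_with_D_imp_G[OF A_commutes H_in_dom(1)[OF z, of y]]
  note dB = commutes_with_D_imp_G[OF B_commutes H_in_dom(2)[OF z, of y]]
  have "G y = G (z\<^sup>2 *\<^sub>C ?x + z *\<^sub>C BH z y + op_app A ?x)" by (simp add: pencil_H[OF z])
  also have "\<dots> = z\<^sup>2 *\<^sub>C G ?x + z *\<^sub>C op_app B (G ?x) + op_app A (G ?x)"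
    by (simp add: blinfun.add_right bounded_clinearD(2)[OF G_clinear] dA(2) dB(2) BH_def)
  finally have "H z (G y) = H z (z\<^sup>2 *\<^sub>C G ?x + z *\<^sub>C op_app B (G ?x) + op_app A (G ?x))" by simp
  also have "\<dots> = G ?x" by (rule H_pencil[OF z dA(1) dB(1)])
  finally show ?thesis .
qed

lemma BH_G: "z \<in> insert 0 (inner_region \<phi>) \<Longrightarrow> BH z (G y) = G (BH z y)"
  unfolding BH_def by (simp add: H_G commutes_with_D_imp_G[OF B_commutes H_in_dom(2)])

lemma BH_diff: "z \<in> insert 0 (inner_region \<phi>) \<Longrightarrow> BH z (x - y) = BH z x - BH z y"
  by (simp add: BH_def blinfun.diff_right closed_operator_diff[OF closed_B] H_in_dom)

lemma BH_scaleC: "z \<in> insert 0 (inner_region \<phi>) \<Longrightarrow> BH z (c *\<^sub>C x) = c *\<^sub>C BH z x"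
  by (simp add: BH_def H_scaleC closed_operatorD[OF closed_B] H_in_dom)

text \<open>The analogue of the resolvent identity,
\<open>H(w) - H(z) = H(w) (P(z) - P(w)) H(z)\<close>, valid up to the origin.\<close>

lemma H_difference:
  assumes z: "z \<in> insert 0 (inner_region \<phi>)" and w: "w \<in> insert 0 (inner_region \<phi>)"
  shows "H w y - H z y = (w - z) *\<^sub>C (- H w ((z + w) *\<^sub>C H z y + BH z y))"
proof -
  let ?u = "H z y"
  have u: "H w (w\<^sup>2 *\<^sub>C ?u + w *\<^sub>C BH z y + op_app A ?u) = ?u"
    unfolding BH_def by (rule H_pencil[OF w H_in_dom[OF z]])
  have "y - (w\<^sup>2 *\<^sub>C ?u + w *\<^sub>C BH z y + op_app A ?u) =
      (z\<^sup>2 *\<^sub>C ?u + z *\<^sub>C BH z y + op_app A ?u) - (w\<^sup>2 *\<^sub>C ?u + w *\<^sub>C BH z y + op_app A ?u)"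
    by (simp only: pencil_H[OF z])
  also have "\<dots> = (z\<^sup>2 - w\<^sup>2) *\<^sub>C ?u + (z - w) *\<^sub>C BH z y"
    by (simp add: scaleC_diff_left)
  also have "\<dots> = (z - w) *\<^sub>C ((z + w) *\<^sub>C ?u + BH z y)"
  proof -
    have "z\<^sup>2 - w\<^sup>2 = (z - w) * (z + w)" by (simp add: power2_eq_square algebra_simps)
    then show ?thesis by (simp only: scaleC_add_right scaleC_scaleC)
  qed
  also have "\<dots> = (w - z) *\<^sub>C (- ((z + w) *\<^sub>C ?u + BH z y))"
    by (metis minus_diff_eq scaleC_minus_left scaleC_minus_right)
  finally have "H w (y - (w\<^sup>2 *\<^sub>C ?u + w *\<^sub>C BH z y + op_app A ?u)) =
      (w - z) *\<^sub>C (- H w ((z + w) *\<^sub>C ?u + BH z y))"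
    by (simp only: H_scaleC[OF w] blinfun.minus_right)
  then show ?thesis by (simp only: blinfun.diff_right u)
qed

lemma BH_difference:
  assumes z: "z \<in> insert 0 (inner_region \<phi>)" and w: "w \<in> insert 0 (inner_region \<phi>)"
  shows "BH w y - BH z y = (w - z) *\<^sub>C (- BH w ((z + w) *\<^sub>C H z y + BH z y))"
proof -
  let ?m = "(z + w) *\<^sub>C H z y + BH z y"
  have "BH w y - BH z y = op_app B (H w y - H z y)"
    by (simp add: BH_def closed_operator_diff(2)[OF closed_B H_in_dom(2)[OF w] H_in_dom(2)[OF z]])
  also have "H w y - H z y = (- (w - z)) *\<^sub>C H w ?m"
    using H_difference[OF z w, of y] by (simp only: scaleC_minus_left scaleC_minus_right)
  also have "op_app B \<dots> = (- (w - z)) *\<^sub>C BH w ?m"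
    by (simp only: closed_operatorD(5)[OF closed_B H_in_dom(2)[OF w]] BH_def)
  finally show ?thesis by (simp only: scaleC_minus_left scaleC_minus_right)
qed

lemma cmod_BH_bound: "z \<in> inner_region \<phi> \<Longrightarrow> cmod z * norm (BH z x) \<le> C * norm x"
  using zBH_bound[of z x] by (simp add: BH_def norm_scaleC)

lemma H_continuous: "continuous_on (inner_region \<phi>) (\<lambda>z. H z y)"
  unfolding continuous_on_def
proof
  fix z assume z: "z \<in> inner_region \<phi>"
  have "((\<lambda>w. H w y - H z y) \<longlongrightarrow> 0) (at z within inner_region \<phi>)"
  proof (rule Lim_null_comparison)
    show "\<forall>\<^sub>F w in at z within inner_region \<phi>. norm (H w y - H z y) \<le>
        cmod (w - z) * (C * norm ((z + w) *\<^sub>C H z y + BH z y))"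
      unfolding eventually_at_filter
      by (rule always_eventually)
        (auto simp: H_difference z norm_scaleC intro!: mult_left_mono H_bound)
    show "((\<lambda>w. cmod (w - z) * (C * norm ((z + w) *\<^sub>C H z y + BH z y))) \<longlongrightarrow> 0)
        (at z within inner_region \<phi>)"
      by (auto intro!: tendsto_eq_intros tendsto_scaleC tendsto_norm_zero LIM_zero)
  qed
  then show "((\<lambda>w. H w y) \<longlongrightarrow> H z y) (at z within inner_region \<phi>)"
    by (simp add: LIM_zero_iff)
qed

lemma BH_continuous: "continuous_on (inner_region \<phi>) (\<lambda>z. BH z y)"
  unfolding continuous_on_def
proof
  fix z assume z: "z \<in> inner_region \<phi>"
  let ?m = "\<lambda>w. (z + w) *\<^sub>C H z y + BH z y"
  have z0: "z \<noteq> 0" using z by (simp add: inner_region_def)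
  have "((\<lambda>w. BH w y - BH z y) \<longlongrightarrow> 0) (at z within inner_region \<phi>)"
  proof (rule Lim_null_comparison)
    have "norm (BH w y - BH z y) \<le> cmod (w - z) * (C * norm (?m w) / cmod w)"
      if w: "w \<in> inner_region \<phi>" for w
    proof -
      have "0 < cmod w" using w by (simp add: inner_region_def)
      then have "norm (BH w (?m w)) \<le> C * norm (?m w) / cmod w"
        using cmod_BH_bound[OF w, of "?m w"] by (simp add: field_simps)
      then have "cmod (w - z) * norm (BH w (?m w)) \<le> cmod (w - z) * (C * norm (?m w) / cmod w)"
        by (intro mult_left_mono) auto
      moreover have "norm (BH w y - BH z y) = cmod (w - z) * norm (BH w (?m w))"
        by (subst BH_difference) (use z w in \<open>simp_all add: norm_scaleC\<close>)
      ultimately show ?thesis by simp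
    qed
    then show "\<forall>\<^sub>F w in at z within inner_region \<phi>. norm (BH w y - BH z y) \<le>
        cmod (w - z) * (C * norm (?m w) / cmod w)"
      unfolding eventually_at_filter by (intro always_eventually) auto
    show "((\<lambda>w. cmod (w - z) * (C * norm (?m w) / cmod w)) \<longlongrightarrow> 0) (at z within inner_region \<phi>)"
      using z0 by (auto intro!: tendsto_eq_intros tendsto_scaleC tendsto_norm_zero LIM_zero)
  qed
  then show "((\<lambda>w. BH w y) \<longlongrightarrow> BH z y) (at z within inner_region \<phi>)"
    by (simp add: LIM_zero_iff)
qed

lemma H_continuous_compose:
  assumes "continuous_on S w" "S \<subseteq> inner_region \<phi>"
  shows "continuous_on S (\<lambda>z. H z (w z))"
  by (rule continuous_on_bounded_family[where T = "\<lambda>z. H z" and C = C])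
    (use assms H_bound in \<open>auto simp: blinfun.diff_right intro: continuous_on_subset[OF H_continuous]\<close>)

text \<open>For \<open>B H\<close> itself a uniform bound is at hand only away from the origin, but \<open>\<lambda> B H(\<lambda>)\<close> is a uniformly bounded
family, and \<open>1 / \<lambda>\<close> is continuous on the region.\<close>

lemma BH_continuous_compose:
  assumes w: "continuous_on S w" and S: "S \<subseteq> inner_region \<phi>"
  shows "continuous_on S (\<lambda>z. BH z (w z))"
proof -
  have "continuous_on S (\<lambda>z. z *\<^sub>C BH z (w z))"
  proof (rule continuous_on_bounded_family[where T = "\<lambda>z x. z *\<^sub>C BH z x" and C = C, OF _ _ _ w])
    show "z *\<^sub>C BH z (x - y) = z *\<^sub>C BH z x - z *\<^sub>C BH z y" if "z \<in> S" for z x y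
      using that S by (subst BH_diff) (auto simp: scaleC_diff_right)
    show "norm (z *\<^sub>C BH z x) \<le> C * norm x" if "z \<in> S" for z x
      using that S cmod_BH_bound by (auto simp: norm_scaleC)
    show "continuous_on S (\<lambda>z. z *\<^sub>C BH z x)" for x
      by (intro continuous_on_scaleC continuous_intros continuous_on_subset[OF BH_continuous S])
  qed
  moreover have nz: "z \<noteq> 0" if "z \<in> S" for z
    using that S by (auto simp: inner_region_def)
  then have "continuous_on S inverse"
    by (intro continuous_on_inverse continuous_on_id) auto
  ultimately have "continuous_on S (\<lambda>z. inverse z *\<^sub>C z *\<^sub>C BH z (w z))"
    by (rule continuous_on_scaleC[rotated])
  then show ?thesis
    by (rule continuous_on_eq) (simp add: scaleC_scaleC scaleC_one nz)
qed

lemma H_holomorphic: "(\<lambda>z. H z y) C1_holomorphic_on inner_region \<phi>"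
proof (rule C1_holomorphic_from_difference)
  show "H w y - H z y = (w - z) *\<^sub>C (- H w ((z + w) *\<^sub>C H z y + BH z y))"
    if "z \<in> inner_region \<phi>" "w \<in> inner_region \<phi>" for z w
    using that by (intro H_difference) auto
  show "continuous_on (inner_region \<phi>) (\<lambda>w. - H w ((z + w) *\<^sub>C H z y + BH z y))" for z
    by (intro continuous_intros H_continuous_compose continuous_on_scaleC order_refl)
  show "continuous_on (inner_region \<phi>) (\<lambda>z. - H z ((z + z) *\<^sub>C H z y + BH z y))"
    by (intro continuous_intros H_continuous_compose continuous_on_scaleC H_continuous
        BH_continuous order_refl)
qed

lemma BH_holomorphic: "(\<lambda>z. BH z y) C1_holomorphic_on inner_region \<phi>"
proof (rule C1_holomorphic_from_difference)
  show "BH w y - BH z y = (w - z) *\<^sub>C (- BH w ((z + w) *\<^sub>C H z y + BH z y))"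
    if "z \<in> inner_region \<phi>" "w \<in> inner_region \<phi>" for z w
    using that by (intro BH_difference) auto
  show "continuous_on (inner_region \<phi>) (\<lambda>w. - BH w ((z + w) *\<^sub>C H z y + BH z y))" for z
    by (intro continuous_intros BH_continuous_compose continuous_on_scaleC order_refl)
  show "continuous_on (inner_region \<phi>) (\<lambda>z. - BH z ((z + z) *\<^sub>C H z y + BH z y))"
    by (intro continuous_intros BH_continuous_compose continuous_on_scaleC H_continuous
        BH_continuous order_refl)
qed

lemma zH_holomorphic: "(\<lambda>z. z *\<^sub>C H z y) C1_holomorphic_on inner_region \<phi>"
  by (rule C1_holomorphic_scaleC_ident[OF H_holomorphic])

lemma zzH_symbol: "sectorial_symbol D G R \<phi> M (\<lambda>z x. z\<^sup>2 *\<^sub>C H z x) C"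
proof
  fix z x assume z: "z \<in> inner_region \<phi>"
  then have z': "z \<in> insert 0 (inner_region \<phi>)" by simp
  show "bounded_clinear (\<lambda>x. z\<^sup>2 *\<^sub>C H z x)"
    unfolding bounded_clinear_def
  proof
    show "bounded_linear (\<lambda>x. z\<^sup>2 *\<^sub>C H z x)"
      by (rule bounded_linear_compose[OF bounded_linear_scaleC blinfun.bounded_linear_right])
    show "Vector_Spaces.linear scaleC scaleC (\<lambda>x. z\<^sup>2 *\<^sub>C H z x)"
      by unfold_locales
        (simp_all add: blinfun.add_right scaleC_add_right H_scaleC[OF z'] scaleC_scaleC mult.commute)
  qed
  show "norm (z\<^sup>2 *\<^sub>C H z x) \<le> C * norm x" by (rule zzH_bound[OF z])
  show "z\<^sup>2 *\<^sub>C H z (G x) = G (z\<^sup>2 *\<^sub>C H z x)"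
    by (simp add: H_G[OF z'] bounded_clinearD(2)[OF G_clinear])
next
  fix x
  have "(\<lambda>z. z *\<^sub>C z *\<^sub>C H z x) C1_holomorphic_on inner_region \<phi>"
    by (intro C1_holomorphic_scaleC_ident H_holomorphic)
  then show "(\<lambda>z. z\<^sup>2 *\<^sub>C H z x) C1_holomorphic_on inner_region \<phi>"
    by (simp add: scaleC_scaleC power2_eq_square)
  show "\<exists>c. \<forall>z\<in>inner_region \<phi>. cmod z \<le> 1 \<longrightarrow> norm (z\<^sup>2 *\<^sub>C H z x) \<le> c * cmod z"
  proof (intro exI ballI impI)
    fix z assume z: "z \<in> inner_region \<phi>" "cmod z \<le> 1"
    have "norm (z\<^sup>2 *\<^sub>C H z x) = cmod z * (cmod z * norm (H z x))"
      by (simp add: norm_scaleC norm_mult power2_eq_square)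
    also have "\<dots> \<le> cmod z * (1 * (C * norm x))"
      using z C_nonneg by (intro mult_left_mono mult_mono H_bound) auto
    finally show "norm (z\<^sup>2 *\<^sub>C H z x) \<le> C * norm x * cmod z" by (simp add: mult.commute)
  qed
qed (rule C_nonneg)

text \<open>For the behaviour at the origin, compare with \<open>B H(0) x\<close> through \<open>BH_difference\<close>: the error is
\<open>\<lambda> B H(\<lambda>)\<close> applied to a bounded vector. Thus \<open>B H(\<lambda>) x\<close> stays bounded for each \<open>x\<close>.\<close>

lemma zBH_symbol: "sectorial_symbol D G R \<phi> M (\<lambda>z x. z *\<^sub>C BH z x) C"
proof
  fix z x assume z: "z \<in> inner_region \<phi>"
  then have z': "z \<in> insert 0 (inner_region \<phi>)" by simp
  show "bounded_clinear (\<lambda>x. z *\<^sub>C BH z x)" unfolding BH_def by (rule zBH_clinear[OF z])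
  show "norm (z *\<^sub>C BH z x) \<le> C * norm x" unfolding BH_def by (rule zBH_bound[OF z])
  show "z *\<^sub>C BH z (G x) = G (z *\<^sub>C BH z x)"
    by (simp add: BH_G[OF z'] bounded_clinearD(2)[OF G_clinear])
next
  fix x
  show "(\<lambda>z. z *\<^sub>C BH z x) C1_holomorphic_on inner_region \<phi>"
    by (intro C1_holomorphic_scaleC_ident BH_holomorphic)
  let ?d = "norm (BH 0 x) + C * (norm (H 0 x) + norm (BH 0 x))"
  show "\<exists>c. \<forall>z\<in>inner_region \<phi>. cmod z \<le> 1 \<longrightarrow> norm (z *\<^sub>C BH z x) \<le> c * cmod z"
  proof (intro exI ballI impI)
    fix z assume z: "z \<in> inner_region \<phi>" "cmod z \<le> 1"
    let ?m = "z *\<^sub>C H 0 x + BH 0 x"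
    have "BH z x = BH 0 x - z *\<^sub>C BH z ?m"
      using BH_difference[of 0 z x] z by (simp add: scaleC_minus_right algebra_simps)
    then have "norm (BH z x) \<le> norm (BH 0 x) + norm (z *\<^sub>C BH z ?m)"
      using norm_triangle_ineq4 by metis
    also have "norm (z *\<^sub>C BH z ?m) \<le> C * norm ?m"
      using cmod_BH_bound[OF z(1)] by (simp add: norm_scaleC)
    also have "\<dots> \<le> C * (norm (H 0 x) + norm (BH 0 x))"
    proof (rule mult_left_mono[OF _ C_nonneg])
      have "cmod z * norm (H 0 x) \<le> 1 * norm (H 0 x)" using z by (intro mult_right_mono) auto
      then show "norm ?m \<le> norm (H 0 x) + norm (BH 0 x)"
        using norm_triangle_ineq[of "z *\<^sub>C H 0 x" "BH 0 x"] by (simp add: norm_scaleC)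
    qed
    finally show "norm (z *\<^sub>C BH z x) \<le> ?d * cmod z"
      by (simp add: norm_scaleC mult.commute mult_left_mono)
  qed
qed (rule C_nonneg)

lemma zH_decay:
  assumes z: "z \<in> inner_region \<phi>" "cmod z = exp s"
  shows "norm (z *\<^sub>C H z w) \<le> C * norm w * exp (- \<bar>s\<bar>)"
proof (cases "0 \<le> s")
  case True
  have "exp s * (exp s * norm (H z w)) \<le> C * norm w"
    using zzH_bound[OF z(1), of w] by (simp add: norm_scaleC norm_mult z(2) power2_eq_square)
  then have "exp (- s) * (exp s * (exp s * norm (H z w))) \<le> exp (- s) * (C * norm w)"
    by (intro mult_left_mono) auto
  also have "exp (- s) * (exp s * (exp s * norm (H z w))) = exp s * norm (H z w)"
    by (simp add: exp_minus)
  finally show ?thesis using True by (simp add: norm_scaleC z(2) mult.commute)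
next
  case False
  then show ?thesis
    using mult_left_mono[OF H_bound[OF z(1), of w], of "exp s"]
    by (simp add: norm_scaleC z(2) mult.commute)
qed

lemma inner_polar: "\<psi> \<in> {- \<phi>..\<phi>} \<Longrightarrow> polar s \<psi> \<in> inner_region \<phi>"
  using angle by (intro polar_inner) auto

lemma zH_arc_tendsto_0:
  assumes r: "\<And>n. \<bar>r n\<bar> = real n"
  shows "(\<lambda>n. integral {- \<phi>..\<phi>} (\<lambda>\<psi>. polar (r n) \<psi> *\<^sub>C H (polar (r n) \<psi>) w)) \<longlonglongrightarrow> 0"
proof (rule arc_tendsto_0[OF C1_holomorphic_imp_continuous[OF zH_holomorphic]])
  show "norm (z *\<^sub>C H z w) \<le> C * norm w * exp (- 1 * real n)"
    if "z \<in> inner_region \<phi>" "cmod z = exp (r n)" for z n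
    using zH_decay[OF that, of w] r[of n] by simp
qed (use angle inner_polar in auto)

lemma H_arc_tendsto_0:
  "(\<lambda>n. integral {- \<phi>..\<phi>} (\<lambda>\<psi>. H (polar (real n) \<psi>) w)) \<longlonglongrightarrow> 0"
proof (rule arc_tendsto_0[OF H_continuous, where \<delta> = 1 and c = "C * norm w" and r = "\<lambda>n. real n"])
  fix z n assume z: "z \<in> inner_region \<phi>" "cmod z = exp (real n)"
  have "norm (H z w) \<le> exp (real n) * norm (H z w)"
    using mult_right_mono[of 1 "exp (real n)" "norm (H z w)"] by simp
  also have "\<dots> \<le> C * norm w * exp (- \<bar>real n\<bar>)"
    using zH_decay[OF z, of w] by (simp add: norm_scaleC z(2))
  finally show "norm (H z w) \<le> C * norm w * exp (- 1 * real n)" by simp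
qed (use angle inner_polar in auto)

text \<open>In terms of \<open>d\<lambda>\<close>, the integral of \<open>H(\<lambda>) w\<close> over the contour is zero. It lets
\<open>H(\<lambda>) D R(\<lambda>,D) g\<close> be exchanged for \<open>\<lambda> H(\<lambda>) R(\<lambda>,D) g\<close>, to which \<open>D\<close> can be
applied once more.\<close>

lemma ray_integral_zH_tendsto_0:
  "(\<lambda>n. ray_integral \<phi> (- real n) (real n) (\<lambda>z. z *\<^sub>C H z w)) \<longlonglongrightarrow> 0"
proof -
  let ?arc = "\<lambda>s. integral {- \<phi>..\<phi>} (\<lambda>\<psi>. polar s \<psi> *\<^sub>C H (polar s \<psi>) w)"
  have eq: "ray_integral \<phi> (- real n) (real n) (\<lambda>z. z *\<^sub>C H z w) =
      - (\<i> *\<^sub>C (?arc (real n) - ?arc (- real n)))" for n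
    by (subst ray_integral_inner[OF zH_holomorphic angle_le])
      (simp_all add: integral_diff integrable_continuous_real
        inner_arc_cont[OF C1_holomorphic_imp_continuous[OF zH_holomorphic]])
  have "(\<lambda>n. - (\<i> *\<^sub>C (?arc (real n) - ?arc (- real n)))) \<longlonglongrightarrow> - (\<i> *\<^sub>C (0 - 0))"
    by (intro tendsto_intros tendsto_scaleC zH_arc_tendsto_0) simp_all
  then show ?thesis unfolding eq by (simp add: scaleC_zero_right)
qed

text \<open>On the common domain of \<open>A\<close> and \<open>B\<close>, the bounded operators \<open>H(0)\<close> and \<open>H(1)\<close> invert \<open>A\<close>
and \<open>1 + B + A\<close>. Bounded operators commute with the integral, hence so do these two, and \<open>B\<close>
is obtained by subtraction.\<close>

lemma pencil_integral:
  fixes h :: "real \<Rightarrow> 'a"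
  assumes dom: "\<And>s. s \<in> {a..b} \<Longrightarrow> h s \<in> op_dom A" "\<And>s. s \<in> {a..b} \<Longrightarrow> h s \<in> op_dom B"
    and cont: "continuous_on {a..b} h" "continuous_on {a..b} (\<lambda>s. op_app A (h s))"
      "continuous_on {a..b} (\<lambda>s. op_app B (h s))"
  shows "integral {a..b} h \<in> op_dom A" "integral {a..b} h \<in> op_dom B"
    "op_app A (integral {a..b} h) = integral {a..b} (\<lambda>s. op_app A (h s))"
    "op_app B (integral {a..b} h) = integral {a..b} (\<lambda>s. op_app B (h s))"
proof -
  let ?I = "\<lambda>f. integral {a..b} f"
  have one: "1 \<in> insert 0 (inner_region \<phi>)" by (simp add: inner_region_def)
  note int = integrable_continuous_real
  have lin: "?I (\<lambda>s. J (f s)) = J (?I f)" if "continuous_on {a..b} f" for f :: "real \<Rightarrow> 'a" and J :: "'a \<Rightarrow>\<^sub>L 'a"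
    using integral_linear[OF int[OF that] blinfun.bounded_linear_right[of J]] by (simp add: o_def)
  have h0: "h s = H 0 (op_app A (h s))" if "s \<in> {a..b}" for s
    using H_pencil[OF _ dom[OF that], of 0] by (simp add: scaleC_zero_left)
  have h1: "h s = H 1 (h s + op_app B (h s) + op_app A (h s))" if "s \<in> {a..b}" for s
    using H_pencil[OF one dom[OF that]] by (simp add: scaleC_one)
  have I0: "?I h = H 0 (?I (\<lambda>s. op_app A (h s)))"
    using integral_cong[of "{a..b}" h, OF h0] lin[OF cont(2)] by simp
  have I1: "?I h = H 1 (?I h + ?I (\<lambda>s. op_app B (h s)) + ?I (\<lambda>s. op_app A (h s)))"
  proof -
    have "?I h = H 1 (?I (\<lambda>s. h s + op_app B (h s) + op_app A (h s)))"
      using integral_cong[of "{a..b}" h, OF h1]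
        lin[OF continuous_on_add[OF continuous_on_add[OF cont(1,3)] cont(2)]] by simp
    also have "?I (\<lambda>s. h s + op_app B (h s) + op_app A (h s)) =
        ?I h + ?I (\<lambda>s. op_app B (h s)) + ?I (\<lambda>s. op_app A (h s))"
      by (simp add: integral_add int cont continuous_on_add)
    finally show ?thesis .
  qed
  show "?I h \<in> op_dom A" "?I h \<in> op_dom B" using H_in_dom[of 0] I0 by simp_all
  show A: "op_app A (?I h) = ?I (\<lambda>s. op_app A (h s))"
    using pencil_H[of 0 "?I (\<lambda>s. op_app A (h s))"] I0 by (simp add: scaleC_zero_left)
  have "?I h + op_app B (?I h) + op_app A (?I h) =
      ?I h + ?I (\<lambda>s. op_app B (h s)) + ?I (\<lambda>s. op_app A (h s))"
    using pencil_H[OF one, of "?I h + ?I (\<lambda>s. op_app B (h s)) + ?I (\<lambda>s. op_app A (h s))"] I1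
    by (simp add: BH_def scaleC_one)
  then show "op_app B (?I h) = ?I (\<lambda>s. op_app B (h s))" using A by simp
qed

text \<open>The value of \<open>A H(z) x\<close>, as \<open>A_H\<close> shows; in this form its continuity and its integrals
follow from those of \<open>\<lambda>\<^sup>2 H(\<lambda>)\<close> and \<open>\<lambda> B H(\<lambda>)\<close>.\<close>

definition AH :: "complex \<Rightarrow> 'a \<Rightarrow> 'a" where
  "AH z x = x - z\<^sup>2 *\<^sub>C H z x - z *\<^sub>C BH z x"

lemma A_H: "z \<in> inner_region \<phi> \<Longrightarrow> op_app A (H z x) = AH z x"
  using pencil_H[of z x] by (simp add: AH_def algebra_simps)

lemma AH_continuous_compose:
  assumes "continuous_on S w" "S \<subseteq> inner_region \<phi>"
  shows "continuous_on S (\<lambda>z. AH z (w z))"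
  unfolding AH_def
  by (intro continuous_intros continuous_on_scaleC H_continuous_compose BH_continuous_compose assms)

lemma pencil_ray_integral:
  assumes w: "continuous_on (rays \<phi>) w"
  shows "ray_integral \<phi> a b (\<lambda>z. H z (w z)) \<in> op_dom A"
    "ray_integral \<phi> a b (\<lambda>z. H z (w z)) \<in> op_dom B"
    "op_app A (ray_integral \<phi> a b (\<lambda>z. H z (w z))) = ray_integral \<phi> a b (\<lambda>z. AH z (w z))"
    "op_app B (ray_integral \<phi> a b (\<lambda>z. H z (w z))) = ray_integral \<phi> a b (\<lambda>z. BH z (w z))"
proof -
  let ?h = "ray_diff \<phi> (\<lambda>z. H z (w z))"
  have r: "polar s (- \<phi>) \<in> inner_region \<phi>" "polar s \<phi> \<in> inner_region \<phi>" for s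
    using polar_rays[OF angle_le] by auto
  then have r0: "polar s (- \<phi>) \<in> insert 0 (inner_region \<phi>)" "polar s \<phi> \<in> insert 0 (inner_region \<phi>)" for s
    by blast+
  have dom: "?h s \<in> op_dom A" "?h s \<in> op_dom B" for s
    unfolding ray_diff_def
    by (intro closed_operator_diff closed_A closed_B H_in_dom r0)+
  have A: "op_app A (?h s) = ray_diff \<phi> (\<lambda>z. AH z (w z)) s" for s
    unfolding ray_diff_def
    by (subst closed_operator_diff(2)[OF closed_A H_in_dom(1)[OF r0(1)] H_in_dom(1)[OF r0(2)]])
      (simp only: A_H[OF r(1)] A_H[OF r(2)])
  have B: "op_app B (?h s) = ray_diff \<phi> (\<lambda>z. BH z (w z)) s" for s
    unfolding ray_diff_def
    by (subst closed_operator_diff(2)[OF closed_B H_in_dom(2)[OF r0(1)] H_in_dom(2)[OF r0(2)]])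
      (simp only: BH_def)
  have cont: "continuous_on {a..b} ?h" "continuous_on {a..b} (ray_diff \<phi> (\<lambda>z. AH z (w z)))"
    "continuous_on {a..b} (ray_diff \<phi> (\<lambda>z. BH z (w z)))"
    by (intro continuous_on_ray_diff[OF _ angle_le] H_continuous_compose AH_continuous_compose
        BH_continuous_compose w; simp)+
  show "integral {a..b} ?h \<in> op_dom A" "integral {a..b} ?h \<in> op_dom B"
    "op_app A (integral {a..b} ?h) = ray_integral \<phi> a b (\<lambda>z. AH z (w z))"
    "op_app B (integral {a..b} ?h) = ray_integral \<phi> a b (\<lambda>z. BH z (w z))"
    using pencil_integral[where h = ?h and a = a and b = b, OF dom] cont by (simp_all add: A B)
qed

lemma A_arc_integral:
  "integral {- \<phi>..\<phi>} (\<lambda>\<psi>. H (polar s \<psi>) g) \<in> op_dom A"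
  "op_app A (integral {- \<phi>..\<phi>} (\<lambda>\<psi>. H (polar s \<psi>) g)) = (2 * \<phi>) *\<^sub>R g
    - integral {- \<phi>..\<phi>} (\<lambda>\<psi>. (polar s \<psi>)\<^sup>2 *\<^sub>C H (polar s \<psi>) g)
    - integral {- \<phi>..\<phi>} (\<lambda>\<psi>. polar s \<psi> *\<^sub>C BH (polar s \<psi>) g)"
proof -
  let ?h = "\<lambda>\<psi>. H (polar s \<psi>) g"
  have A: "op_app A (?h \<psi>) = AH (polar s \<psi>) g" if "\<psi> \<in> {- \<phi>..\<phi>}" for \<psi>
    by (rule A_H[OF inner_polar[OF that]])
  have cont: "continuous_on {- \<phi>..\<phi>} ?h" "continuous_on {- \<phi>..\<phi>} (\<lambda>\<psi>. op_app A (?h \<psi>))"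
    "continuous_on {- \<phi>..\<phi>} (\<lambda>\<psi>. op_app B (?h \<psi>))"
    using inner_arc_cont[OF H_continuous] inner_arc_cont[OF BH_continuous[unfolded BH_def]]
      inner_arc_cont[OF AH_continuous_compose[OF continuous_on_const order_refl]]
    by (auto simp: A cong: continuous_on_cong_simp)
  have dom: "?h \<psi> \<in> op_dom A" "?h \<psi> \<in> op_dom B" if "\<psi> \<in> {- \<phi>..\<phi>}" for \<psi>
    using inner_polar[OF that] by (auto intro: H_in_dom)
  show "integral {- \<phi>..\<phi>} ?h \<in> op_dom A"
    by (rule pencil_integral(1)[OF dom cont])
  have "op_app A (integral {- \<phi>..\<phi>} ?h) = integral {- \<phi>..\<phi>} (\<lambda>\<psi>. op_app A (?h \<psi>))"
    by (rule pencil_integral(3)[OF dom cont])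
  also have "\<dots> = integral {- \<phi>..\<phi>} (\<lambda>\<psi>. g - (polar s \<psi>)\<^sup>2 *\<^sub>C H (polar s \<psi>) g
      - polar s \<psi> *\<^sub>C BH (polar s \<psi>) g)"
    by (rule integral_cong) (simp only: A AH_def)
  also have "\<dots> = (2 * \<phi>) *\<^sub>R g
    - integral {- \<phi>..\<phi>} (\<lambda>\<psi>. (polar s \<psi>)\<^sup>2 *\<^sub>C H (polar s \<psi>) g)
    - integral {- \<phi>..\<phi>} (\<lambda>\<psi>. polar s \<psi> *\<^sub>C BH (polar s \<psi>) g)"
  proof -
    have 1: "(\<lambda>\<psi>. (polar s \<psi>)\<^sup>2 *\<^sub>C H (polar s \<psi>) g) integrable_on {- \<phi>..\<phi>}"
      "(\<lambda>\<psi>. polar s \<psi> *\<^sub>C BH (polar s \<psi>) g) integrable_on {- \<phi>..\<phi>}"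
      by (intro integrable_continuous_real inner_arc_cont[of "\<lambda>z. z\<^sup>2 *\<^sub>C H z g"]
          inner_arc_cont[of "\<lambda>z. z *\<^sub>C BH z g"] continuous_on_scaleC continuous_intros
          H_continuous BH_continuous)+
    have 2: "(\<lambda>\<psi>. g) integrable_on {- \<phi>..\<phi>}" by (intro integrable_continuous_real continuous_intros)
    show ?thesis
      using angle by (simp add: integral_diff 1 2 integrable_diff)
  qed
  finally show "op_app A (integral {- \<phi>..\<phi>} (\<lambda>\<psi>. H (polar s \<psi>) g)) = (2 * \<phi>) *\<^sub>R g
    - integral {- \<phi>..\<phi>} (\<lambda>\<psi>. (polar s \<psi>)\<^sup>2 *\<^sub>C H (polar s \<psi>) g)
    - integral {- \<phi>..\<phi>} (\<lambda>\<psi>. polar s \<psi> *\<^sub>C BH (polar s \<psi>) g)" .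
qed

text \<open>The limits \<open>v1\<close> and \<open>v2\<close> are \<open>2 \<pi> \<i>\<close> times \<open>D\<^sup>2 u\<close> and \<open>B D u\<close>; accordingly \<open>u\<close> is
\<open>G (G v1)\<close> up to this factor, and what remains is to recognise \<open>G v1\<close> and \<open>G (G v1)\<close> as
limits of truncated contour integrals to which \<open>B\<close> and \<open>A\<close> can be applied.\<close>

theorem pencil_solution_exists:
  assumes \<theta>: "0 < \<theta>" "\<theta> < 1" and p: "1 \<le> p" and g: "g \<in> interp_space D \<theta> p"
  shows "\<exists>u. u \<in> op_dom A \<and> u \<in> op_dom D \<and> op_app D u \<in> op_dom D \<and> op_app D u \<in> op_dom B \<and>
    op_app D (op_app D u) \<in> interp_space D \<theta> p \<and> op_app B (op_app D u) \<in> interp_space D \<theta> p \<and>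
    op_app D (op_app D u) + op_app B (op_app D u) + op_app A u = g"
proof -
  interpret T1: sectorial_symbol D G R \<phi> M "\<lambda>z x. z\<^sup>2 *\<^sub>C H z x" C by (rule zzH_symbol)
  interpret T2: sectorial_symbol D G R \<phi> M "\<lambda>z x. z *\<^sub>C BH z x" C by (rule zBH_symbol)
  let ?I = "\<lambda>n q. ray_integral \<phi> (- real n) (real n) q"
  obtain k where k: "0 \<le> k" "\<And>t. 0 < t \<Longrightarrow> K_functional D t g \<le> k * t powr \<theta>"
    using interp_space_K_le[OF closed_D \<theta>(1) p g] by blast
  obtain v1 where v1: "\<And>\<sigma>. (\<lambda>n. ray_integral \<phi> (\<sigma> - real n) (\<sigma> + real n) (T1.symbol_integrand g)) \<longlonglongrightarrow> v1"
    using T1.symbol_integral_converges[OF \<theta> k] by blast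
  obtain v2 where v2: "\<And>\<sigma>. (\<lambda>n. ray_integral \<phi> (\<sigma> - real n) (\<sigma> + real n) (T2.symbol_integrand g)) \<longlonglongrightarrow> v2"
    using T2.symbol_integral_converges[OF \<theta> k] by blast
  have v1_in: "v1 \<in> interp_space D \<theta> p" by (rule T1.symbol_integral_in_interp_space[OF \<theta> p g v1])
  have v2_in: "v2 \<in> interp_space D \<theta> p" by (rule T2.symbol_integral_in_interp_space[OF \<theta> p g v2])
  have lim1: "(\<lambda>n. ?I n (T1.symbol_integrand g)) \<longlonglongrightarrow> v1" using v1[of 0] by simp
  have lim2: "(\<lambda>n. ?I n (T2.symbol_integrand g)) \<longlonglongrightarrow> v2" using v2[of 0] by simp
  note contR = continuous_on_subset[OF R_continuous[of g] Int_lower2]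
  note contDR = continuous_on_subset[OF D_R_continuous[of g] Int_lower2]
  note contT1 = T1.symbol_integrand_continuous[of g]
  note contT2 = T2.symbol_integrand_continuous[of g]
  have contw: "continuous_on (rays \<phi>) (\<lambda>z. z *\<^sub>C D_R z g)"
    "continuous_on (rays \<phi>) (\<lambda>z. z *\<^sub>C R z g)"
    by (intro continuous_on_scaleC continuous_intros contDR contR)+
  let ?y = "\<lambda>n. ?I n (\<lambda>z. H z (z *\<^sub>C D_R z g))"
  let ?x = "\<lambda>n. ?I n (\<lambda>z. H z (z *\<^sub>C R z g))"
  have scal: "H z (z *\<^sub>C w) = z *\<^sub>C H z w" "BH z (z *\<^sub>C w) = z *\<^sub>C BH z w"
    if "z \<in> rays \<phi>" for z w
    using that H_scaleC BH_scaleC by auto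

  have y_eq: "?y n = G (?I n (T1.symbol_integrand g)) - ?I n (\<lambda>z. z *\<^sub>C H z g)" for n
  proof -
    have "?y n = ?I n (\<lambda>z. G (T1.symbol_integrand g z) - z *\<^sub>C H z g)"
    proof (rule ray_integral_cong[OF _ angle_le])
      fix z assume z: "z \<in> rays \<phi>"
      have "G (T1.symbol_integrand g z) = z\<^sup>2 *\<^sub>C H z (R z g)"
        unfolding T1.symbol_integrand_def
        using z by (simp add: bounded_clinearD(2)[OF G_clinear] H_G[symmetric] G_D_R)
      moreover have "H z (z *\<^sub>C D_R z g) = z\<^sup>2 *\<^sub>C H z (R z g) - z *\<^sub>C H z g"
        unfolding scal[OF z] D_R_def using z
        by (simp add: blinfun.diff_right scaleC_diff_right H_scaleC scaleC_scaleC power2_eq_square)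
      ultimately show "H z (z *\<^sub>C D_R z g) = G (T1.symbol_integrand g z) - z *\<^sub>C H z g" by simp
    qed
    also have "\<dots> = ?I n (\<lambda>z. G (T1.symbol_integrand g z)) - ?I n (\<lambda>z. z *\<^sub>C H z g)"
      by (rule ray_integral_diff[OF _ _ angle_le])
        (auto intro: bounded_linear.continuous_on[OF blinfun.bounded_linear_right contT1]
          continuous_on_subset[OF C1_holomorphic_imp_continuous[OF zH_holomorphic]])
    also have "?I n (\<lambda>z. G (T1.symbol_integrand g z)) = G (?I n (T1.symbol_integrand g))"
      by (rule bounded_linear_ray_integral[symmetric, OF blinfun.bounded_linear_right contT1 angle_le])
    finally show ?thesis .
  qed
  have lim_y: "?y \<longlonglongrightarrow> G v1"
    unfolding y_eq
    using tendsto_diff[OF bounded_linear.tendsto[OF blinfun.bounded_linear_right[of G] lim1]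
        ray_integral_zH_tendsto_0[of g]] by simp
  have x_eq: "?x n = G (?y n)" for n
  proof -
    have "G (?y n) = ?I n (\<lambda>z. G (H z (z *\<^sub>C D_R z g)))"
      by (intro bounded_linear_ray_integral[OF blinfun.bounded_linear_right _ angle_le]
          H_continuous_compose contw) simp
    also have "\<dots> = ?x n"
      by (rule ray_integral_cong[OF _ angle_le])
        (simp add: H_G[symmetric] bounded_clinearD(2)[OF G_clinear] G_D_R)
    finally show ?thesis ..
  qed
  have lim_x: "?x \<longlonglongrightarrow> G (G v1)"
    unfolding x_eq by (rule bounded_linear.tendsto[OF blinfun.bounded_linear_right lim_y])

  have B_y: "G v1 \<in> op_dom B \<and> op_app B (G v1) = v2"
  proof -
    have "op_app B (?y n) = ?I n (T2.symbol_integrand g)" for n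
      unfolding pencil_ray_integral(4)[OF contw(1)]
      by (rule ray_integral_cong[OF _ angle_le]) (simp add: T2.symbol_integrand_def scal)
    then have "(\<lambda>n. op_app B (?y n)) \<longlonglongrightarrow> v2" using lim2 by simp
    from closed_operator_limit[OF closed_B pencil_ray_integral(2)[OF contw(1)] lim_y this]
    show ?thesis by simp
  qed

  define arc where "arc n = integral {- \<phi>..\<phi>} (\<lambda>\<psi>. H (polar (real n) \<psi>) g)" for n
  define a1 where "a1 s = integral {- \<phi>..\<phi>} (\<lambda>\<psi>. (polar s \<psi>)\<^sup>2 *\<^sub>C H (polar s \<psi>) g)" for s
  define a2 where "a2 s = integral {- \<phi>..\<phi>} (\<lambda>\<psi>. polar s \<psi> *\<^sub>C BH (polar s \<psi>) g)" for s
  have A_x: "op_app A (?x n) = ?I n (\<lambda>z. z *\<^sub>C R z g) - ?I n (T1.symbol_integrand g)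
      - ?I n (T2.symbol_integrand g) + \<i> *\<^sub>C (a1 (real n) - a1 (- real n) + (a2 (real n) - a2 (- real n)))" for n
  proof -
    let ?q1 = "\<lambda>z. z\<^sup>2 *\<^sub>C H z g" and ?q2 = "\<lambda>z. z *\<^sub>C BH z g"
    have c1: "continuous_on (rays \<phi>) ?q1" "continuous_on (rays \<phi>) ?q2"
      by (rule continuous_on_subset[OF C1_holomorphic_imp_continuous[OF T1.T_holomorphic]], simp)
        (rule continuous_on_subset[OF C1_holomorphic_imp_continuous[OF T2.T_holomorphic]], simp)
    have "op_app A (?x n) = ?I n (\<lambda>z. AH z (z *\<^sub>C R z g))"
      by (rule pencil_ray_integral(3)[OF contw(2)])
    also have "\<dots> = ?I n (\<lambda>z. z *\<^sub>C R z g - T1.symbol_integrand g z - T2.symbol_integrand g z - ?q1 z - ?q2 z)"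
    proof (rule ray_integral_cong[OF _ angle_le])
      fix z assume z: "z \<in> rays \<phi>"
      have 0: "z *\<^sub>C R z g = D_R z g + g" by (simp add: D_R_def)
      have 1: "z\<^sup>2 *\<^sub>C H z (z *\<^sub>C R z g) = T1.symbol_integrand g z + ?q1 z"
        unfolding 0 T1.symbol_integrand_def using z by (intro T1.T_add) auto
      have 2: "z *\<^sub>C BH z (z *\<^sub>C R z g) = T2.symbol_integrand g z + ?q2 z"
        unfolding 0 T2.symbol_integrand_def using z by (intro T2.T_add) auto
      show "AH z (z *\<^sub>C R z g) =
          z *\<^sub>C R z g - T1.symbol_integrand g z - T2.symbol_integrand g z - ?q1 z - ?q2 z"
        unfolding AH_def 1 2 by simp
    qed
    also have "\<dots> = ?I n (\<lambda>z. z *\<^sub>C R z g) - ?I n (T1.symbol_integrand g)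
      - ?I n (T2.symbol_integrand g) - ?I n ?q1 - ?I n ?q2"
      by (simp only: ray_integral_diff[OF _ _ angle_le] contw contT1 contT2 c1 continuous_on_diff)
    also have "?I n ?q1 = - (\<i> *\<^sub>C (a1 (real n) - a1 (- real n)))"
      unfolding a1_def
      by (subst ray_integral_inner[OF T1.T_holomorphic angle_le])
        (simp_all add: integral_diff integrable_continuous_real
          inner_arc_cont[OF C1_holomorphic_imp_continuous[OF T1.T_holomorphic]])
    also have "?I n ?q2 = - (\<i> *\<^sub>C (a2 (real n) - a2 (- real n)))"
      unfolding a2_def
      by (subst ray_integral_inner[OF T2.T_holomorphic angle_le])
        (simp_all add: integral_diff integrable_continuous_real
          inner_arc_cont[OF C1_holomorphic_imp_continuous[OF T2.T_holomorphic]])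
    finally show ?thesis by (simp add: scaleC_add_right)
  qed
  have x_dom: "?x n \<in> op_dom A" for n by (rule pencil_ray_integral(1)[OF contw(2)])
  have arc_dom: "\<i> *\<^sub>C arc n \<in> op_dom A" for n
    unfolding arc_def by (intro closed_operatorD(3)[OF closed_A] A_arc_integral(1))
  have A_sum: "op_app A (?x n + \<i> *\<^sub>C arc n) = ?I n (\<lambda>z. z *\<^sub>C R z g) - ?I n (T1.symbol_integrand g)
      - ?I n (T2.symbol_integrand g) + \<i> *\<^sub>C ((2 * \<phi>) *\<^sub>R g - a1 (- real n) - a2 (- real n))" for n
  proof -
    have "op_app A (\<i> *\<^sub>C arc n) = \<i> *\<^sub>C ((2 * \<phi>) *\<^sub>R g - a1 (real n) - a2 (real n))"
      unfolding arc_def a1_def a2_def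
      by (simp only: closed_operatorD(5)[OF closed_A A_arc_integral(1)] A_arc_integral(2))
    then show ?thesis
      by (simp add: closed_operatorD(4)[OF closed_A x_dom arc_dom] A_x scaleC_add_right scaleC_diff_right)
  qed
  \<comment> \<open>Only with the arc added does the image under A converge: the arc itself tends to zero, but
    its image under A cancels the large arcs a1 and a2 and leaves the missing angle.\<close>
  have sum_dom: "?x n + \<i> *\<^sub>C arc n \<in> op_dom A" for n
    by (rule closed_operatorD(2)[OF closed_A x_dom arc_dom])
  have sum_lim: "(\<lambda>n. ?x n + \<i> *\<^sub>C arc n) \<longlonglongrightarrow> G (G v1) + \<i> *\<^sub>C 0"
    unfolding arc_def by (intro tendsto_add tendsto_scaleC tendsto_const lim_x H_arc_tendsto_0)
  have A_sum_lim: "(\<lambda>n. op_app A (?x n + \<i> *\<^sub>C arc n)) \<longlonglongrightarrow>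
      (\<i> * of_real (2 * pi - 2 * \<phi>)) *\<^sub>C g - v1 - v2 + \<i> *\<^sub>C ((2 * \<phi>) *\<^sub>R g - 0 - 0)"
    unfolding A_sum
  proof (intro tendsto_intros tendsto_scaleC lim1 lim2)
    show "(\<lambda>n. ?I n (\<lambda>z. z *\<^sub>C R z g)) \<longlonglongrightarrow> (\<i> * of_real (2 * pi - 2 * \<phi>)) *\<^sub>C g"
    proof (rule ray_integral_resolvent_tendsto[OF \<theta>(1)])
      fix z s assume z: "z \<in> outer_region \<phi>" "cmod z = exp s" "0 \<le> s"
      have "norm (D_R z g) \<le> (M + 1) * K_functional D (1 / cmod z) g" by (rule norm_D_R_le_K[OF z(1)])
      also have "\<dots> \<le> (M + 1) * (k * (1 / cmod z) powr \<theta>)"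
        using M_nonneg z(2) by (intro mult_left_mono k) auto
      also have "(1 / cmod z) powr \<theta> = exp (- \<theta> * s)" by (simp add: z(2) powr_def ln_div)
      finally show "norm (D_R z g) \<le> (M + 1) * k * exp (- \<theta> * s)" by simp
    qed
    show "(\<lambda>n. a1 (- real n)) \<longlonglongrightarrow> 0" "(\<lambda>n. a2 (- real n)) \<longlonglongrightarrow> 0"
      unfolding a1_def a2_def
      using T1.symbol_arc_tendsto_0[of 0 g] T2.symbol_arc_tendsto_0[of 0 g] by simp_all
  qed
  have "G (G v1) + \<i> *\<^sub>C 0 \<in> op_dom A"
    "op_app A (G (G v1) + \<i> *\<^sub>C 0) =
      (\<i> * of_real (2 * pi - 2 * \<phi>)) *\<^sub>C g - v1 - v2 + \<i> *\<^sub>C ((2 * \<phi>) *\<^sub>R g - 0 - 0)"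
    by (rule closed_operator_limit[OF closed_A sum_dom sum_lim A_sum_lim])+
  then have A_x: "G (G v1) \<in> op_dom A" "op_app A (G (G v1)) = (of_real (2 * pi) * \<i>) *\<^sub>C g - v1 - v2"
    using full_circle_scaleC[of \<phi> g] by (simp_all add: scaleC_zero_right algebra_simps)

  define c where "c = inverse (of_real (2 * pi) * \<i>)"
  have c: "c * (of_real (2 * pi) * \<i>) = 1" unfolding c_def by (rule left_inverse) simp
  let ?u = "c *\<^sub>C G (G v1)"
  have Du: "?u \<in> op_dom D" "op_app D ?u = c *\<^sub>C G v1"
    by (simp_all add: closed_operatorD[OF closed_D])
  have DDu: "c *\<^sub>C G v1 \<in> op_dom D" "op_app D (c *\<^sub>C G v1) = c *\<^sub>C v1"
    by (simp_all add: closed_operatorD[OF closed_D])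
  have BDu: "c *\<^sub>C G v1 \<in> op_dom B" "op_app B (c *\<^sub>C G v1) = c *\<^sub>C v2"
    using B_y by (simp_all add: closed_operatorD[OF closed_B])
  have Au: "?u \<in> op_dom A" "op_app A ?u = g - c *\<^sub>C v1 - c *\<^sub>C v2"
    using A_x by (simp_all add: closed_operatorD[OF closed_A] scaleC_diff_right scaleC_scaleC c scaleC_one
        del: of_real_mult)
  show ?thesis
    by (rule exI[of _ ?u])
      (simp add: Du DDu BDu Au interp_space_scaleC[OF closed_D \<theta> p] v1_in v2_in)
qed

text \<open>The factorisation \<open>P(\<lambda>) u = P(\<lambda>) u - P(D) u = (\<lambda> - D) (\<lambda> u + D u + B u)\<close> gives the
identity \<open>R_eq\<close> on the rays. The two ways of closing the contour then compute the same
integral as \<open>\<i> (2 \<pi> - 2 \<phi>) u\<close> and as \<open>- 2 \<i> \<phi> u\<close>.\<close>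

theorem pencil_solution_unique:
  assumes u: "u \<in> op_dom A" "u \<in> op_dom D" "op_app D u \<in> op_dom D" "op_app D u \<in> op_dom B"
    and eq: "op_app D (op_app D u) + op_app B (op_app D u) + op_app A u = 0"
  shows "u = 0"
proof -
  let ?I = "\<lambda>n q. ray_integral \<phi> (- real n) (real n) q"
  let ?Du = "op_app D u" and ?Bu = "op_app B u"
  have uG: "u = G ?Du" using G_D[OF u(2)] by simp
  have uB: "u \<in> op_dom B" "?Bu = G (op_app B ?Du)"
    using commutes_with_D_imp_G[OF B_commutes u(4)] uG by simp_all
  have DBu: "?Bu \<in> op_dom D" "op_app D ?Bu = op_app B ?Du" by (simp_all add: uB(2))
  let ?m = "?Du + ?Bu"
  have R_eq: "R z u = H z (z *\<^sub>C u + ?m)" if z: "z \<in> rays \<phi>" for z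
  proof -
    have zo: "z \<in> outer_region \<phi>" and zi: "z \<in> insert 0 (inner_region \<phi>)" using z by auto
    have A: "op_app A u = - op_app D ?Du - op_app D ?Bu"
      using eq by (simp add: DBu(2) algebra_simps eq_neg_iff_add_eq_0)
    have "u = H z (z\<^sup>2 *\<^sub>C u + z *\<^sub>C ?Bu + op_app A u)"
      by (rule H_pencil[OF zi u(1) uB(1), symmetric])
    then have "R z u = H z (R z (z\<^sup>2 *\<^sub>C u + z *\<^sub>C ?Bu + op_app A u))"
      using commute_G_imp_commute_R[OF H_clinear[OF zi] H_G[OF zi] zo] by simp
    also have "R z (z\<^sup>2 *\<^sub>C u + z *\<^sub>C ?Bu + op_app A u) = z *\<^sub>C u + ?m"
    proof -
      have "R z (z\<^sup>2 *\<^sub>C u + z *\<^sub>C ?Bu + op_app A u) = z\<^sup>2 *\<^sub>C R z u + z *\<^sub>C R z ?Bu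
          - R z (op_app D ?Du) - R z (op_app D ?Bu)"
        by (simp add: A blinfun.add_right blinfun.diff_right blinfun.minus_right R_scaleC[OF zo])
      also have "R z (op_app D ?Bu) = z *\<^sub>C R z ?Bu - ?Bu"
        using R_D[OF zo DBu(1)] by (simp add: D_R_def)
      also have "R z (op_app D ?Du) = z *\<^sub>C (z *\<^sub>C R z u - u) - ?Du"
        using R_D[OF zo u(3)] R_D[OF zo u(2)] by (simp add: D_R_def)
      finally show ?thesis by (simp add: scaleC_diff_right scaleC_scaleC power2_eq_square)
    qed
    finally show ?thesis .
  qed
  let ?q1 = "\<lambda>z. z\<^sup>2 *\<^sub>C H z u" and ?q2 = "\<lambda>z. z *\<^sub>C H z ?m"
  interpret T1: sectorial_symbol D G R \<phi> M "\<lambda>z x. z\<^sup>2 *\<^sub>C H z x" C by (rule zzH_symbol)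
  note hol1 = T1.T_holomorphic[of u]
  note cont1 = C1_holomorphic_imp_continuous[OF hol1]
  have cont2: "continuous_on (inner_region \<phi>) ?q2"
    by (rule C1_holomorphic_imp_continuous[OF zH_holomorphic])
  have outer: "(\<lambda>n. ?I n (\<lambda>z. z *\<^sub>C R z u)) \<longlonglongrightarrow> (\<i> * of_real (2 * pi - 2 * \<phi>)) *\<^sub>C u"
  proof (rule ray_integral_resolvent_tendsto[of 1])
    fix z s assume z: "z \<in> outer_region \<phi>" "cmod z = exp s"
    have "exp s * norm (D_R z u) \<le> M * norm ?Du"
      using resolvent_bound[OF z(1), of ?Du] z(2) R_D[OF z(1) u(2)] by (simp add: norm_scaleC)
    then show "norm (D_R z u) \<le> M * norm ?Du * exp (- 1 * s)"
      by (simp add: exp_minus field_simps)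
  qed simp
  let ?arc = "\<lambda>q s. integral {- \<phi>..\<phi>} (\<lambda>\<psi>. q (polar s \<psi>))"
  have inner: "(\<lambda>n. ?I n ?q1) \<longlonglongrightarrow> - (\<i> *\<^sub>C ((2 * \<phi>) *\<^sub>R u))"
  proof -
    have eq1: "?I n ?q1 = - (\<i> *\<^sub>C (?arc ?q1 (real n) - ?arc ?q1 (- real n)))" for n
      by (subst ray_integral_inner[OF hol1 angle_le])
        (simp_all add: integral_diff integrable_continuous_real inner_arc_cont[OF cont1])
    have "?arc ?q1 (real n) = (2 * \<phi>) *\<^sub>R u - ?arc (\<lambda>z. z *\<^sub>C H z ?Bu) (real n)
        - ?arc (\<lambda>z. H z (op_app A u)) (real n)" for n
    proof -
      have "?arc ?q1 (real n) = ?arc (\<lambda>z. u - z *\<^sub>C H z ?Bu - H z (op_app A u)) (real n)"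
      proof (rule integral_cong)
        fix \<psi> assume "\<psi> \<in> {- \<phi>..\<phi>}"
        then have z: "polar (real n) \<psi> \<in> insert 0 (inner_region \<phi>)" using inner_polar by blast
        show "?q1 (polar (real n) \<psi>) = u - polar (real n) \<psi> *\<^sub>C H (polar (real n) \<psi>) ?Bu
            - H (polar (real n) \<psi>) (op_app A u)"
          using H_pencil[OF z u(1) uB(1)]
          by (simp add: blinfun.add_right H_scaleC[OF z] algebra_simps)
      qed
      also have "\<dots> = (2 * \<phi>) *\<^sub>R u - ?arc (\<lambda>z. z *\<^sub>C H z ?Bu) (real n)
          - ?arc (\<lambda>z. H z (op_app A u)) (real n)"
        using angle
        by (simp add: integral_diff integrable_diff integrable_continuous_real
            inner_arc_cont[OF H_continuous]
            inner_arc_cont[OF C1_holomorphic_imp_continuous[OF zH_holomorphic]])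
      finally show ?thesis .
    qed
    moreover have "(\<lambda>n. (2 * \<phi>) *\<^sub>R u - ?arc (\<lambda>z. z *\<^sub>C H z ?Bu) (real n)
          - ?arc (\<lambda>z. H z (op_app A u)) (real n)) \<longlonglongrightarrow> (2 * \<phi>) *\<^sub>R u - 0 - 0"
      by (intro tendsto_intros zH_arc_tendsto_0 H_arc_tendsto_0) simp
    ultimately have "(\<lambda>n. ?arc ?q1 (real n)) \<longlonglongrightarrow> (2 * \<phi>) *\<^sub>R u" by simp
    moreover have "(\<lambda>n. ?arc ?q1 (- real n)) \<longlonglongrightarrow> 0"
      using T1.symbol_arc_tendsto_0[of 0 u] by simp
    ultimately have "(\<lambda>n. - (\<i> *\<^sub>C (?arc ?q1 (real n) - ?arc ?q1 (- real n)))) \<longlonglongrightarrow>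
        - (\<i> *\<^sub>C ((2 * \<phi>) *\<^sub>R u - 0))"
      by (intro tendsto_minus tendsto_scaleC tendsto_const tendsto_diff)
    then show ?thesis unfolding eq1 by simp
  qed
  have "?I n (\<lambda>z. z *\<^sub>C R z u) = ?I n ?q1 + ?I n ?q2" for n
  proof -
    have "?I n (\<lambda>z. z *\<^sub>C R z u) = ?I n (\<lambda>z. ?q1 z + ?q2 z)"
      by (rule ray_integral_cong[OF _ angle_le])
        (simp add: R_eq blinfun.add_right H_scaleC scaleC_add_right scaleC_scaleC power2_eq_square)
    also have "\<dots> = ?I n ?q1 + ?I n ?q2"
      by (rule ray_integral_add[OF _ _ angle_le]) (use cont1 cont2 in \<open>auto intro: continuous_on_subset\<close>)
    finally show ?thesis .
  qed
  then have "(\<lambda>n. ?I n (\<lambda>z. z *\<^sub>C R z u)) \<longlonglongrightarrow> - (\<i> *\<^sub>C ((2 * \<phi>) *\<^sub>R u)) + 0"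
    using tendsto_add[OF inner ray_integral_zH_tendsto_0[of ?m]] by simp
  then have "(\<i> * of_real (2 * pi - 2 * \<phi>)) *\<^sub>C u = - (\<i> *\<^sub>C ((2 * \<phi>) *\<^sub>R u)) + 0"
    by (rule LIMSEQ_unique[OF outer])
  then have "(of_real (2 * pi) * \<i>) *\<^sub>C u = 0"
    using full_circle_scaleC[of \<phi> u] by simp
  then have "inverse (of_real (2 * pi) * \<i>) *\<^sub>C (of_real (2 * pi) * \<i>) *\<^sub>C u = 0" by (simp only: scaleC_zero_right)
  moreover have "inverse (of_real (2 * pi) * \<i>) * (of_real (2 * pi) * \<i>) = 1"
    by (rule left_inverse) simp
  ultimately show "u = 0" by (simp only: scaleC_scaleC scaleC_one)
qed

end

section \<open>Sectors and the hypotheses on the operators\<close>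

lemma cos_Arg: "z \<noteq> 0 \<Longrightarrow> cmod z * cos (Arg z) = Re z"
  using Re_exp[of "Ln z"] by (simp add: Arg_def)

lemma inner_region_subset_sector:
  assumes "0 \<le> \<phi>" "\<phi> \<le> \<phi>'" "\<phi>' < pi"
  shows "insert 0 (inner_region \<phi>) \<subseteq> sector \<phi>'"
proof -
  have "\<bar>Arg z\<bar> \<le> \<phi>'" if "z \<noteq> 0" "cmod z * cos \<phi> \<le> Re z" for z
  proof (rule ccontr)
    assume "\<not> \<bar>Arg z\<bar> \<le> \<phi>'"
    then have "cos \<bar>Arg z\<bar> < cos \<phi>"
      using assms mpi_less_Arg[of z] Arg_le_pi[of z] by (intro cos_monotone_0_pi) auto
    then have "cmod z * cos (Arg z) < cmod z * cos \<phi>" using that by simp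
    with that cos_Arg[of z] show False by simp
  qed
  then show ?thesis by (auto simp: inner_region_def sector_def)
qed

text \<open>To be used with an angle \<open>\<phi>'\<close> strictly between \<open>\<phi>1\<close> and \<open>\<phi>\<close>, as the sectorial estimate is
given outside sectors that are larger than the spectral one.\<close>

lemma outer_region_disjoint_sector:
  assumes "0 \<le> \<phi>'" "\<phi>' < \<phi>" "\<phi> \<le> pi" "z \<in> outer_region \<phi>"
  shows "z \<notin> sector \<phi>'"
proof
  assume "z \<in> sector \<phi>'"
  moreover have z: "z \<noteq> 0" "Re z \<le> cmod z * cos \<phi>" using assms by (auto simp: outer_region_def)
  ultimately have "\<bar>Arg z\<bar> < \<phi>" using assms by (auto simp: sector_def)
  then have "cos \<phi> < cos \<bar>Arg z\<bar>" using assms by (intro cos_monotone_0_pi) auto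
  then have "cmod z * cos \<phi> < cmod z * cos (Arg z)" using z by simp
  with z cos_Arg[of z] show False by simp
qed

lemma sectorial_resolvent_bound:
  assumes "sectorial D \<phi>1" "0 \<le> \<phi>1" "\<phi>1 < \<phi>" "\<phi> < pi"
  obtains M where "0 \<le> M"
    "\<And>z x. z \<in> outer_region \<phi> \<Longrightarrow> norm (z *\<^sub>C resolvent z D x) \<le> M * norm x"
    "\<And>z. z \<in> outer_region \<phi> \<Longrightarrow> z \<notin> op_spectrum D"
proof -
  define \<phi>' where "\<phi>' = (\<phi>1 + \<phi>) / 2"
  have \<phi>': "\<phi>1 < \<phi>'" "\<phi>' < \<phi>" "\<phi>' \<in> {\<phi>1<..<pi}" using assms by (auto simp: \<phi>'_def)
  then obtain M where M: "\<And>z. z \<in> - sector \<phi>' \<Longrightarrow> norm (z *\<^sub>C resolvent z D) \<le> M"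
    using assms(1) unfolding sectorial_def bdd_above_def by blast
  have out: "z \<notin> sector \<phi>'" "z \<notin> sector \<phi>1" if "z \<in> outer_region \<phi>" for z
    using outer_region_disjoint_sector[of _ \<phi> z] that assms \<phi>' by auto
  show thesis
  proof (rule that[of "max M 0"])
    show "z \<notin> op_spectrum D" if "z \<in> outer_region \<phi>" for z
      using out(2)[OF that] assms(1) by (auto simp: sectorial_def)
    show "norm (z *\<^sub>C resolvent z D x) \<le> max M 0 * norm x" if "z \<in> outer_region \<phi>" for z x
    proof -
      have "norm (z *\<^sub>C resolvent z D x) \<le> norm (z *\<^sub>C resolvent z D) * norm x"
        using norm_blinfun[of "z *\<^sub>C resolvent z D" x] by (simp add: blinfun_apply_scaleC)
      also have "\<dots> \<le> max M 0 * norm x"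
        using M[of z] out(1)[OF that] by (intro mult_right_mono) auto
      finally show ?thesis .
    qed
  qed simp
qed

lemma uniformly_bounded_opsD:
  assumes "uniformly_bounded_ops S F"
  obtains C where "0 \<le> C" "\<And>z x. z \<in> S \<Longrightarrow> norm (F z x) \<le> C * norm x"
proof -
  obtain C where C: "\<And>z. z \<in> S \<Longrightarrow> onorm (F z) \<le> C"
    using assms unfolding uniformly_bounded_ops_def bdd_above_def by blast
  have "norm (F z x) \<le> max C 0 * norm x" if "z \<in> S" for z x
  proof -
    have "bounded_linear (F z)"
      using assms that by (auto simp: uniformly_bounded_ops_def bounded_clinear_def)
    then have "norm (F z x) \<le> onorm (F z) * norm x" by (rule onorm)
    also have "\<dots> \<le> max C 0 * norm x" using C[OF that] by (intro mult_right_mono) auto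
    finally show ?thesis .
  qed
  then show thesis using that[of "max C 0"] by simp
qed

lemma H_inftyD:
  assumes "F \<in> H_infty S (Y :: ('a::complex_banach \<Rightarrow>\<^sub>L 'a) set)"
  obtains C where "0 \<le> C" "\<And>z x. z \<in> S \<Longrightarrow> norm (F z x) \<le> C * norm x"
proof -
  obtain C where C: "\<And>z. z \<in> S \<Longrightarrow> norm (F z) \<le> C"
    using assms by (auto simp: H_infty_def bounded_iff)
  have "norm (F z x) \<le> max C 0 * norm x" if "z \<in> S" for z x
    by (rule order_trans[OF norm_blinfun mult_right_mono]) (use C[OF that] in auto)
  then show thesis using that[of "max C 0"] by simp
qed

section \<open>The problem in the interpolation spaces\<close>

lemma L_op_dom_iff:
  "x \<in> op_dom (L_op A B D \<theta> p) \<longleftrightarrow> x \<in> op_dom A \<and> x \<in> op_dom D \<and> op_app D x \<in> op_dom D \<and>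
    op_app D x \<in> op_dom B \<and> op_app D (op_app D x) \<in> interp_space D \<theta> p \<and>
    op_app B (op_app D x) \<in> interp_space D \<theta> p \<and> op_app A x \<in> interp_space D \<theta> p"
  by (auto simp: L_op_def op_comp_def)

lemma L_op_app:
  "op_app (L_op A B D \<theta> p) x = op_app D (op_app D x) + op_app B (op_app D x) + op_app A x"
  by (simp add: L_op_def op_comp_def)

lemma L_op_linear:
  assumes A: "closed_operator A" and B: "closed_operator B" and D: "closed_operator D"
    and \<theta>: "0 < \<theta>" "\<theta> < 1" and p: "1 \<le> p"
    and x: "x \<in> op_dom (L_op A B D \<theta> p)" and y: "y \<in> op_dom (L_op A B D \<theta> p)"
  shows "x + y \<in> op_dom (L_op A B D \<theta> p)" "x - y \<in> op_dom (L_op A B D \<theta> p)"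
    "op_app (L_op A B D \<theta> p) (x + y) = op_app (L_op A B D \<theta> p) x + op_app (L_op A B D \<theta> p) y"
    "op_app (L_op A B D \<theta> p) (x - y) = op_app (L_op A B D \<theta> p) x - op_app (L_op A B D \<theta> p) y"
  using x y
  by (simp_all add: L_op_dom_iff L_op_app closed_operatorD[OF A] closed_operatorD[OF B]
      closed_operatorD[OF D] closed_operator_diff[OF A] closed_operator_diff[OF B]
      closed_operator_diff[OF D] interp_space_add[OF D p] interp_space_diff[OF D \<theta> p])

lemma L_op_extends:
  assumes D: "closed_operator D" and D': "closed_operator D'" and ext: "D \<subseteq>\<^sub>o\<^sub>p D'"
    and \<theta>: "0 < \<theta>" "\<theta> < 1" and p: "1 \<le> p"
    and x: "x \<in> op_dom (L_op A B D \<theta> p)"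
  shows "x \<in> op_dom (L_op A B D' \<theta> p)"
    "op_app (L_op A B D' \<theta> p) x = op_app (L_op A B D \<theta> p) x"
  using x ext interp_space_op_extends[OF D D' ext \<theta> p]
  by (auto simp: L_op_dom_iff L_op_app op_extends_def subset_iff)

theorem theorem5p1:
  fixes A B D D' :: "'a::complex_banach operator"
    and H :: "complex \<Rightarrow> 'a \<Rightarrow>\<^sub>L 'a"
    and \<phi>1 \<phi>2 \<theta> :: real and p :: ennreal
    and f x0 :: 'a
  assumes "closed_operator A" "closed_operator B" "closed_operator D"
    and "invertible_operator D"
    and "commutes_with A D" "commutes_with B D"
    and "\<phi>1 \<in> {0<..<pi}" "sectorial D \<phi>1"
    and "\<phi>2 \<in> {\<phi>1<..<pi}"
    and "\<And>z. z \<in> sector \<phi>2 \<Longrightarrow>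
           is_bounded_inverse (z\<^sup>2 \<cdot>\<^sub>o\<^sub>p op_id +\<^sub>o\<^sub>p z \<cdot>\<^sub>o\<^sub>p B +\<^sub>o\<^sub>p A) (H z)"
    and "H \<in> H_infty (sector \<phi>2) bounded_clinear_ops"
    and "uniformly_bounded_ops (sector \<phi>2) (\<lambda>z x. z\<^sup>2 *\<^sub>C H z x)"
    and "uniformly_bounded_ops (sector \<phi>2) (\<lambda>z x. z *\<^sub>C op_app B (H z x))"
    and "uniformly_bounded_ops (sector \<phi>2) (\<lambda>z x. op_app A (H z x))"
    and "\<theta> \<in> {0<..<1}" "1 \<le> p"
    and "closed_operator D'" "D \<subseteq>\<^sub>o\<^sub>p D'"
    and "f \<in> interp_space D' \<theta> p"
    and "x0 \<in> op_dom (L_op A B D' \<theta> p)"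
    and "f - op_app (L_op A B D' \<theta> p) x0 \<in> interp_space D \<theta> p"
  shows "\<exists>!x. x \<in> op_dom (L_op A B D' \<theta> p) \<and>
           op_app (D' \<circ>\<^sub>o\<^sub>p D') x + op_app (B \<circ>\<^sub>o\<^sub>p D') x + op_app A x = f \<and>
           x - x0 \<in> op_dom (L_op A B D \<theta> p)"
proof -
  define \<phi> where "\<phi> = (\<phi>1 + \<phi>2) / 2"
  have \<phi>: "0 < \<phi>1" "\<phi>1 < \<phi>" "\<phi> < \<phi>2" "\<phi>2 < pi" "0 < \<phi>" "\<phi> < pi"
    using assms(7,9) by (auto simp: \<phi>_def)
  have \<theta>: "0 < \<theta>" "\<theta> < 1" using assms(15) by auto
  note p = \<open>1 \<le> p\<close>
  obtain G where G: "is_bounded_inverse D G"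
    using assms(4) by (auto simp: invertible_operator_def)
  obtain M where M: "0 \<le> M"
    "\<And>z x. z \<in> outer_region \<phi> \<Longrightarrow> norm (z *\<^sub>C resolvent z D x) \<le> M * norm x"
    "\<And>z. z \<in> outer_region \<phi> \<Longrightarrow> z \<notin> op_spectrum D"
    using sectorial_resolvent_bound[OF assms(8) less_imp_le[OF \<phi>(1)] \<phi>(2,6)] by blast
  obtain C1 where C1: "0 \<le> C1" "\<And>z x. z \<in> sector \<phi>2 \<Longrightarrow> norm (H z x) \<le> C1 * norm x"
    using H_inftyD[OF assms(11)] by blast
  obtain C2 where C2: "0 \<le> C2" "\<And>z x. z \<in> sector \<phi>2 \<Longrightarrow> norm (z\<^sup>2 *\<^sub>C H z x) \<le> C2 * norm x"
    using uniformly_bounded_opsD[OF assms(12)] by blast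
  obtain C3 where C3: "0 \<le> C3"
    "\<And>z x. z \<in> sector \<phi>2 \<Longrightarrow> norm (z *\<^sub>C op_app B (H z x)) \<le> C3 * norm x"
    using uniformly_bounded_opsD[OF assms(13)] by blast
  define C where "C = max C1 (max C2 C3)"
  have le_C: "C1 \<le> C" "C2 \<le> C" "C3 \<le> C" by (auto simp: C_def)
  have sub: "z \<in> sector \<phi>2" if "z \<in> insert 0 (inner_region \<phi>)" for z
    using inner_region_subset_sector[of \<phi> \<phi>2] \<phi> that by auto
  interpret quadratic_pencil D G "\<lambda>z. resolvent z D" \<phi> M A B H C
  proof
    fix z x
    show "z \<in> outer_region \<phi> \<Longrightarrow> is_bounded_inverse (op_shift z D) (resolvent z D)"
      using M(3) by (rule is_bounded_inverse_resolvent)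
    show "z \<in> insert 0 (inner_region \<phi>) \<Longrightarrow>
        is_bounded_inverse (z\<^sup>2 \<cdot>\<^sub>o\<^sub>p op_id +\<^sub>o\<^sub>p z \<cdot>\<^sub>o\<^sub>p B +\<^sub>o\<^sub>p A) (H z)"
      by (rule assms(10)[OF sub])
    assume "z \<in> inner_region \<phi>"
    then have z: "z \<in> sector \<phi>2" by (intro sub) simp
    show "norm (H z x) \<le> C * norm x"
      by (rule order_trans[OF C1(2)[OF z] mult_right_mono[OF le_C(1)]]) simp
    show "norm (z\<^sup>2 *\<^sub>C H z x) \<le> C * norm x"
      by (rule order_trans[OF C2(2)[OF z] mult_right_mono[OF le_C(2)]]) simp
    show "norm (z *\<^sub>C op_app B (H z x)) \<le> C * norm x"
      by (rule order_trans[OF C3(2)[OF z] mult_right_mono[OF le_C(3)]]) simp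
    show "bounded_clinear (\<lambda>x. z *\<^sub>C op_app B (H z x))"
      using assms(13) z by (simp add: uniformly_bounded_ops_def)
  qed (use assms(1-3,5,6) G M \<phi> C1(1) le_C(1) in auto)
  note linear = L_op_linear[OF assms(1,2) _ \<theta> p]
  note ext = L_op_extends[OF assms(3,17,18) \<theta> p]
  have comp: "op_app (D' \<circ>\<^sub>o\<^sub>p D') x + op_app (B \<circ>\<^sub>o\<^sub>p D') x + op_app A x =
      op_app (L_op A B D' \<theta> p) x" for x
    by (simp add: L_op_def)
  define g where "g = f - op_app (L_op A B D' \<theta> p) x0"
  have g: "g \<in> interp_space D \<theta> p" using assms(21) by (simp add: g_def)
  obtain u where u: "u \<in> op_dom A" "u \<in> op_dom D" "op_app D u \<in> op_dom D" "op_app D u \<in> op_dom B"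
    "op_app D (op_app D u) \<in> interp_space D \<theta> p" "op_app B (op_app D u) \<in> interp_space D \<theta> p"
    "op_app D (op_app D u) + op_app B (op_app D u) + op_app A u = g"
    using pencil_solution_exists[OF \<theta> p g] by blast
  have "op_app A u = g - op_app D (op_app D u) - op_app B (op_app D u)"
    using u(7) by (simp add: algebra_simps)
  then have "op_app A u \<in> interp_space D \<theta> p"
    using g u(5,6) by (simp add: interp_space_diff[OF assms(3) \<theta> p])
  then have uL: "u \<in> op_dom (L_op A B D \<theta> p)" using u by (simp add: L_op_dom_iff)
  have Lu: "op_app (L_op A B D \<theta> p) u = g" using u(7) by (simp add: L_op_app)
  show ?thesis
    unfolding comp
  proof (rule ex1I[of _ "x0 + u"])
    show "x0 + u \<in> op_dom (L_op A B D' \<theta> p) \<and> op_app (L_op A B D' \<theta> p) (x0 + u) = f \<and>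
        x0 + u - x0 \<in> op_dom (L_op A B D \<theta> p)"
      using linear(1,3)[OF assms(17,20) ext(1)[OF uL]] ext(2)[OF uL] Lu uL by (simp add: g_def)
  next
    fix x
    assume x: "x \<in> op_dom (L_op A B D' \<theta> p) \<and> op_app (L_op A B D' \<theta> p) x = f \<and>
        x - x0 \<in> op_dom (L_op A B D \<theta> p)"
    let ?d = "(x - x0) - u"
    have d: "?d \<in> op_dom (L_op A B D \<theta> p)"
      using linear(2)[OF assms(3) _ uL] x by blast
    have "op_app (L_op A B D \<theta> p) ?d = op_app (L_op A B D' \<theta> p) (x - x0) - g"
      using linear(4)[OF assms(3) _ uL] ext(2) Lu x by auto
    also have "\<dots> = 0" using linear(4)[OF assms(17) _ assms(20)] x by (simp add: g_def)
    finally have "op_app (L_op A B D \<theta> p) ?d = 0" .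
    with d have "?d = 0"
      unfolding L_op_dom_iff L_op_app by (blast intro: pencil_solution_unique)
    then show "x = x0 + u" by (simp add: algebra_simps)
  qed
qed

end
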